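(* Let $n\in\mathbb{N}$, $t_1,\dots,t_n\in\mathbb{R}$, $s_1,\dots,s_n>0$, and let $\mathbf{W}_Y=[W_Y(t_1,s_1)\ \cdots\ W_Y(t_n,s_n)]^\top$, $\mathbf{W}_f=[W_f(t_1,s_1)\ \cdots\ W_f(t_n,s_n)]^\top$ and $|\mathbf{W}_Y|=[|W_Y(t_1,s_1)|\ \cdots\ |W_Y(t_n,s_n)|]^\top$. Suppose the covariance matrix $\Gamma=\mathbb{E}[(\mathbf{W}_Y-\mathbb{E}\mathbf{W}_Y)(\mathbf{W}_Y-\mathbb{E}\mathbf{W}_Y)^*]$ is invertible. Then the following hold. (a) The random vector $|\mathbf{W}_Y|$ has the probability density function $$p(r_{1:n};|\mathbf{W}_Y|)=\Big(\prod_{\ell=1}^n r_\ell\Big)\int_0^{2\pi}\cdots\int_0^{2\pi}p(\mathbf{w};\mathbf{W}_Y)\,d\theta_1\cdots d\theta_n,\qquad r_{1:n}=(r_1,\dots,r_n)\in\mathbb{R}_{\ge0}^n,$$ where $\mathbf{w}=[r_1e^{i\theta_1}\ \cdots\ r_ne^{i\theta_n}]^\top$ and $$p(\mathbf{w};\mathbf{W}_Y)=\frac{1}{\pi^n\det(\Gamma)}\exp\left(-(\mathbf{w}-\mathbf{W}_f)^*\Gamma^{-1}(\mathbf{w}-\mathbf{W}_f)\right).$$ (b) (Case $n=1$.) For any $t\in\mathbb{R}$ and $s>0$ (the invertibility assumption meaning here $\mathbb{E}[|W_\Phi(t,s)-\mathbb{E}W_\Phi(t,s)|^2]>0$), $$p(r;|W_Y(t,s)|)=p_{\mathrm{Rice}}\left(r;|W_f(t,s)|,\tfrac12\mathbb{E}[|W_\Phi(t,s)|^2]\right),\qquad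 r\ge0.$$ (c) For $n=2$, for $r_1,r_2\ge 0$, $$p(r_1,r_2;|W_Y(t_1,s_1)|,|W_Y(t_2,s_2)|)=\frac{r_1}{\pi\Gamma_{11}}\int_0^{2\pi}p_{\mathrm{Rice}}\left(r_2;m,\tfrac12\Big(\Gamma_{22}-\frac{|\Gamma_{12}|^2}{\Gamma_{11}}\Big)\right)\exp\left(-\frac{|r_1e^{i\theta}-W_f(t_1,s_1)|^2}{\Gamma_{11}}\right)d\theta,$$ where $$m=\left|\frac{\overline{\Gamma_{12}}}{\Gamma_{11}}\left(r_1e^{i\theta}-W_f(t_1,s_1)\right)+W_f(t_2,s_2)\right|.$$
   Context: The function $\psi:\mathbb{R}\to\mathbb{C}$ belongs to $L^1(\mathbb{R})\cap L^2(\mathbb{R})$, with Fourier transform $\widehat\psi(\omega)=\int_{\mathbb{R}}e^{-it\omega}\psi(t)\,dt$. It is an analytic mother wavelet: $\widehat\psi(\omega)=0$ for $\omega\le0$; moreover $|\widehat\psi|$ is unimodal with a unique maximum point in $(0,\infty)$. The function $f:\mathbb{R}\to\mathbb{R}$ is bounded and deterministic. The noise $\Phi=\{\Phi(t)\}_{t\in\mathbb{R}}$ is a real-valued stationary Gaussian process with constant mean and covariance function $C_\Phi(t_1-t_2)=\mathrm{Cov}(\Phi(t_1),\Phi(t_2))$, which has the spectral representation $C_\Phi(t)=\int_{\mathbb{R}}e^{i\lambda t}F(d\lambda)$ with $F$ a nonnegative measure, $F(\mathbb{R})=C_\Phi(0)$. The observed signal is $Y=f+\Phi$. For $g\in\{f,\Phi,Y\}$,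 the analytic wavelet transform is $W_g(t,s)=\int_{\mathbb{R}}g(\tau)\frac{1}{\sqrt s}\overline{\psi\left(\frac{\tau-t}{s}\right)}d\tau$, $t\in\mathbb{R}$, $s>0$. The notation $p(\cdot;X)$ denotes the probability density function of $X$ (densities of complex vectors are with respect to Lebesgue measure on $\mathbb{C}^n\cong\mathbb{R}^{2n}$); $*$ is the conjugate transpose. $\Gamma_{\ell\ell'}$ denotes the $(\ell,\ell')$ entry of $\Gamma$, so $\Gamma_{12}=\mathbb{E}[(W_Y(t_1,s_1)-\mathbb{E}W_Y(t_1,s_1))\overline{(W_Y(t_2,s_2)-\mathbb{E}W_Y(t_2,s_2))}]$. For $m\ge0$, $\sigma^2>0$, the Rice density is $p_{\mathrm{Rice}}(r;m,\sigma^2)=\frac{r}{\sigma^2}\exp\left(-\frac{r^2+m^2}{2\sigma^2}\right)I_0\left(\frac{mr}{\sigma^2}\right)$, $r\ge0$, with $I_0(x)=\sum_{k\ge0}\frac{(x^2/4)^k}{(k!)^2}$ the modified Bessel function of the first kind of order zero. *)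

theory Defs
  imports "HOL-Probability.Probability"
begin

section \<open>Analytic mother wavelets and the wavelet transform\<close>

text \<open>Integrals over the real line are taken with respect to the completed Lebesgue measure, so
  that signals and wavelets only need to be Lebesgue (not necessarily Borel) measurable.\<close>

definition fourier_transform :: "(real \<Rightarrow> complex) \<Rightarrow> real \<Rightarrow> complex" where
  "fourier_transform g \<omega> =
     (LINT t|lebesgue. exp (- (\<i> * complex_of_real t * complex_of_real \<omega>)) * g t)"

definition analytic_mother_wavelet :: "(real \<Rightarrow> complex) \<Rightarrow> bool" where
  "analytic_mother_wavelet \<psi> \<longleftrightarrow>
     integrable lebesgue \<psi> \<and>
     integrable lebesgue (\<lambda>t. (cmod (\<psi> t))\<^sup>2) \<and>
     (\<forall>\<omega>\<le>0. fourier_transform \<psi> \<omega> = 0) \<and>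
     (\<exists>p>0. mono_on {..p} (\<lambda>\<omega>. cmod (fourier_transform \<psi> \<omega>)) \<and>
            antimono_on {p..} (\<lambda>\<omega>. cmod (fourier_transform \<psi> \<omega>)) \<and>
            (\<forall>\<omega>. \<omega> \<noteq> p \<longrightarrow> cmod (fourier_transform \<psi> \<omega>) < cmod (fourier_transform \<psi> p)))"

definition wavelet_transform ::
    "(real \<Rightarrow> complex) \<Rightarrow> (real \<Rightarrow> real) \<Rightarrow> real \<Rightarrow> real \<Rightarrow> complex" where
  "wavelet_transform \<psi> g t s =
     (LINT \<tau>|lebesgue. complex_of_real (g \<tau>) * complex_of_real (1 / sqrt s) * cnj (\<psi> ((\<tau> - t) / s)))"

definition wavelet_vector ::
    "(real \<Rightarrow> complex) \<Rightarrow> (real \<Rightarrow> real) \<Rightarrow> real^'n \<Rightarrow> real^'n \<Rightarrow> complex^'n" where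
  "wavelet_vector \<psi> g t s = (\<chi> l. wavelet_transform \<psi> g (t $ l) (s $ l))"

definition modulus_vector :: "complex^'n \<Rightarrow> real^'n" where
  "modulus_vector w = (\<chi> l. cmod (w $ l))"

section \<open>Stationary Gaussian noise\<close>

text \<open>Constants count as (degenerate) Gaussian random variables.\<close>

definition gaussian_rv :: "'w measure \<Rightarrow> ('w \<Rightarrow> real) \<Rightarrow> bool" where
  "gaussian_rv M X \<longleftrightarrow>
     X \<in> borel_measurable M \<and>
     ((\<exists>\<mu> \<sigma>. 0 < \<sigma> \<and> distributed M lborel X (\<lambda>x. ennreal (normal_density \<mu> \<sigma> x))) \<or>
      (\<exists>\<mu>. AE \<omega> in M. X \<omega> = \<mu>))"

definition gaussian_process :: "'w measure \<Rightarrow> (real \<Rightarrow> 'w \<Rightarrow> real) \<Rightarrow> bool" where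
  "gaussian_process M \<Phi> \<longleftrightarrow>
     (\<forall>T (a :: real \<Rightarrow> real). finite T \<longrightarrow> gaussian_rv M (\<lambda>\<omega>. \<Sum>t\<in>T. a t * \<Phi> t \<omega>))"

text \<open>For a Gaussian process, constant mean and translation-invariant covariance are equivalent
  to translation invariance of all finite-dimensional distributions. Joint measurability is what
  makes the pathwise wavelet transform of the process a random variable.\<close>

definition stationary_gaussian_process ::
    "'w measure \<Rightarrow> (real \<Rightarrow> 'w \<Rightarrow> real) \<Rightarrow> (real \<Rightarrow> real) \<Rightarrow> bool" where
  "stationary_gaussian_process M \<Phi> C \<longleftrightarrow>
     (\<lambda>(\<omega>, t). \<Phi> t \<omega>) \<in> borel_measurable (M \<Otimes>\<^sub>M lebesgue) \<and>
     gaussian_process M \<Phi> \<and>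
     (\<exists>\<mu>. \<forall>t. (LINT \<omega>|M. \<Phi> t \<omega>) = \<mu>) \<and>
     (\<forall>t1 t2. (LINT \<omega>|M. (\<Phi> t1 \<omega> - (LINT \<omega>'|M. \<Phi> t1 \<omega>')) * (\<Phi> t2 \<omega> - (LINT \<omega>'|M. \<Phi> t2 \<omega>')))
               = C (t1 - t2))"

definition spectral_measure :: "(real \<Rightarrow> real) \<Rightarrow> real measure \<Rightarrow> bool" where
  "spectral_measure C F \<longleftrightarrow>
     finite_borel_measure F \<and>
     (\<forall>t. complex_of_real (C t) = char F t) \<and>
     measure F UNIV = C 0"

section \<open>Covariance matrices and densities\<close>

definition covariance_matrix :: "'w measure \<Rightarrow> ('w \<Rightarrow> complex^'n) \<Rightarrow> complex^'n^'n" where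
  "covariance_matrix M X =
     (\<chi> i j. LINT \<omega>|M. (X \<omega> $ i - (LINT \<omega>'|M. X \<omega>' $ i)) * cnj (X \<omega> $ j - (LINT \<omega>'|M. X \<omega>' $ j)))"

text \<open>On \<^typ>\<open>complex^'n\<close> the measure \<^const>\<open>lborel\<close> is Lebesgue measure under the identification of
  each complex coordinate with its real and imaginary part.\<close>

definition has_pdf :: "'w measure \<Rightarrow> ('w \<Rightarrow> 'a::euclidean_space) \<Rightarrow> ('a \<Rightarrow> real) \<Rightarrow> bool" where
  "has_pdf M X p \<longleftrightarrow> (\<forall>x. 0 \<le> p x) \<and> distributed M lborel X (\<lambda>x. ennreal (p x))"

definition complex_normal_density ::
    "complex^'n \<Rightarrow> complex^'n^'n \<Rightarrow> complex^'n \<Rightarrow> complex" where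
  "complex_normal_density \<mu> \<Gamma> w =
     1 / (complex_of_real (pi ^ CARD('n)) * det \<Gamma>) *
     exp (- (\<Sum>i\<in>UNIV. cnj ((w - \<mu>) $ i) * (matrix_inv \<Gamma> *v (w - \<mu>)) $ i))"

definition bessel_I0 :: "real \<Rightarrow> real" where
  "bessel_I0 x = (\<Sum>k. (x\<^sup>2 / 4) ^ k / (fact k)\<^sup>2)"

text \<open>The formula is meant for \<open>r \<ge> 0\<close> only; as a density it is extended by zero.\<close>

definition rice_density :: "real \<Rightarrow> real \<Rightarrow> real \<Rightarrow> real" where
  "rice_density r m v = r / v * exp (- (r\<^sup>2 + m\<^sup>2) / (2 * v)) * bessel_I0 (m * r / v)"

end

theory Submission
  imports Defs
begin

text \<open>The wavelet coefficients of the noise form a circularly symmetric complex Gaussian vector, and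
everything else follows from its density.

The coefficients are Gaussian because they are limits of finite linear combinations of the process:
if the noise is integrated against a real weight, its characteristic function is that of a normal law
whose variance is the integral of the squared modulus of the Fourier transform of the weight against
the spectral measure (\<open>char_weighted_noise\<close>). They are circularly symmetric because the wavelet is
analytic. The transform \<open>H\<close> of a weight built from atoms of \<open>\<psi>\<close> vanishes on one half-line, so of
\<open>H l\<close> and \<open>H (- l)\<close> at least one is zero; hence the real part of \<open>u Z\<close> has the same law for every
unimodular \<open>u\<close>, where \<open>Z\<close> is the integral (\<open>analytic_weighted_noise\<close>). The mean is zero because
\<open>H 0 = 0\<close>. So the vector \<open>D\<close> of noise coefficients with covariance \<open>\<Gamma>\<close> has the characteristic function
\<open>a \<mapsto> exp (- a* \<Gamma> a / 4)\<close> (\<open>analytic_weights_char\<close>).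

The density comes from whitening. Write \<open>\<Gamma>\<close> inverse as \<open>B* B\<close>. Then \<open>B D\<close> has the characteristic
function \<open>exp (- |a|^2 / 4)\<close>, which makes its real coordinates independent normal variables, because a
joint characteristic function determines the probabilities of boxes (\<open>prob_eq_prod_of_joint_char\<close>).
The density is carried back along \<open>B\<close>. A factor \<open>B\<close> obtained by completing squares is a product of
maps that change a single coordinate, so its effect on Lebesgue measure, the factor \<open>|det B|^2\<close>, is a
matter of Fubini and one affine substitution at a time (\<open>Cholesky_scaling\<close>).

The moduli are treated by polar coordinates in every component (\<open>nn_integral_vec_polar\<close>). For one
coefficient the angular integral is the integral representation of \<open>I\<^sub>0\<close>, which gives the Rice density
(\<open>rice_density_eq_angular_integral\<close>). For two coefficients, completing the square splits the exponent
into that of the first coefficient and that of the second given the first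
(\<open>hermitian_form_matrix_inv_2\<close>); the angular integral of the latter is again a Rice density.\<close>

section \<open>Lebesgue measure on spaces of vectors\<close>

lemma prod_Basis_vec:
  fixes g :: "'b::euclidean_space ^ 'n \<Rightarrow> 'c::comm_monoid_mult"
  shows "(\<Prod>b\<in>Basis. g b) = (\<Prod>i\<in>UNIV. \<Prod>b\<in>Basis. g (axis i b))"
proof -
  have "bij_betw (\<lambda>(i, b). axis i b) (UNIV \<times> Basis) (Basis :: ('b ^ 'n) set)"
    by (auto simp: bij_betw_def inj_on_def axis_eq_axis Basis_vec_def)
  from prod.reindex_bij_betw[OF this, of g] show ?thesis
    by (simp add: prod.cartesian_product split_def)
qed

lemma measurable_vec_lambda [measurable (raw)]:
  fixes f :: "'a \<Rightarrow> 'n::finite \<Rightarrow> 'b::euclidean_space"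
  assumes "\<And>i. (\<lambda>x. f x i) \<in> borel_measurable M"
  shows "(\<lambda>x. \<chi> i. f x i) \<in> borel_measurable M"
proof (subst borel_measurable_euclidean_space, intro ballI)
  fix b :: "'b ^ 'n" assume "b \<in> Basis"
  then obtain i u where b: "b = axis i u" by (auto simp: Basis_vec_def)
  show "(\<lambda>x. (\<chi> i. f x i) \<bullet> b) \<in> borel_measurable M"
    using assms[of i] by (simp add: b inner_axis)
qed

lemma measurable_vec_nth' [measurable (raw)]:
  fixes f :: "'a \<Rightarrow> 'b::euclidean_space ^ 'n"
  assumes "f \<in> borel_measurable M"
  shows "(\<lambda>x. f x $ i) \<in> borel_measurable M"
  by (rule borel_measurable_continuous_on[OF _ assms]) (intro continuous_intros)

text \<open>Boxes determine Lebesgue measure, and their volumes multiply over the index as well as over the basis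
of one component. This is what turns integrals over vectors into iterated integrals over components.\<close>

lemma lborel_vec:
  "lborel = distr (PiM UNIV (\<lambda>_::'n::finite. lborel :: 'b::euclidean_space measure)) borel (\<lambda>x. \<chi> i. x i)"
proof (rule lborel_eqI)
  interpret product_sigma_finite "\<lambda>_::'n. lborel :: 'b measure" ..
  fix l u :: "'b ^ 'n" assume le: "\<And>b. b \<in> Basis \<Longrightarrow> l \<bullet> b \<le> u \<bullet> b"
  have le': "l $ i \<bullet> b \<le> u $ i \<bullet> b" if "b \<in> Basis" for i b
    using le[of "axis i b"] that by (simp add: inner_axis)
  have vim: "(\<lambda>x. \<chi> i. x i) -` box l u \<inter> space (PiM UNIV (\<lambda>_::'n. lborel :: 'b measure))
      = PiE UNIV (\<lambda>i. box (l $ i) (u $ i))"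
    by (auto simp: space_PiM box_def Basis_vec_def inner_axis PiE_def Pi_def)
  have "emeasure (distr (PiM UNIV (\<lambda>_::'n. lborel :: 'b measure)) borel (\<lambda>x. \<chi> i. x i)) (box l u)
      = emeasure (PiM UNIV (\<lambda>_::'n. lborel :: 'b measure)) (PiE UNIV (\<lambda>i. box (l $ i) (u $ i)))"
    by (subst emeasure_distr) (auto simp: vim)
  also have "\<dots> = (\<Prod>i\<in>UNIV. emeasure lborel (box (l $ i) (u $ i)))"
    by (subst emeasure_PiM) auto
  also have "\<dots> = (\<Prod>i\<in>UNIV. ennreal (\<Prod>b\<in>Basis. (u $ i - l $ i) \<bullet> b))"
    by (intro prod.cong refl) (auto simp: le' inner_diff_left intro!: emeasure_lborel_box)
  also have "\<dots> = ennreal (\<Prod>i\<in>UNIV. \<Prod>b\<in>Basis. (u $ i - l $ i) \<bullet> b)"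
    by (subst prod_ennreal) (auto simp: le' inner_diff_left intro!: prod_nonneg)
  also have "\<dots> = ennreal (\<Prod>b\<in>Basis. (u - l) \<bullet> b)"
    by (simp add: prod_Basis_vec inner_axis)
  finally show "emeasure (distr (PiM UNIV (\<lambda>_::'n. lborel :: 'b measure)) borel (\<lambda>x. \<chi> i. x i)) (box l u)
      = (\<Prod>b\<in>Basis. (u - l) \<bullet> b)" .
qed simp

lemma nn_integral_lborel_vec_prod:
  fixes g :: "'n::finite \<Rightarrow> 'b::euclidean_space \<Rightarrow> ennreal"
  assumes [measurable]: "\<And>i. g i \<in> borel_measurable borel"
  shows "(\<integral>\<^sup>+x. (\<Prod>i\<in>UNIV. g i (x $ i)) \<partial>lborel) = (\<Prod>i\<in>UNIV. \<integral>\<^sup>+y. g i y \<partial>lborel)"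
proof -
  interpret product_sigma_finite "\<lambda>_::'n. lborel :: 'b measure" ..
  show ?thesis
    by (subst lborel_vec, subst nn_integral_distr) (simp_all add: product_nn_integral_prod)
qed

lemma nn_integral_lborel_affine:
  fixes f :: "'b::euclidean_space \<Rightarrow> ennreal"
  assumes [measurable]: "f \<in> borel_measurable borel" and c: "c > 0"
  shows "ennreal (c ^ DIM('b)) * (\<integral>\<^sup>+y. f (t + c *\<^sub>R y) \<partial>lborel) = (\<integral>\<^sup>+y. f y \<partial>lborel)"
proof -
  have "(\<integral>\<^sup>+y. f y \<partial>lborel) = (\<integral>\<^sup>+y. f y \<partial>density (distr lborel borel (\<lambda>x. t + c *\<^sub>R x)) (\<lambda>_. \<bar>c\<bar>^DIM('b)))"
    using c by (subst lborel_affine[of c t]) auto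
  also have "\<dots> = ennreal (c ^ DIM('b)) * (\<integral>\<^sup>+y. f (t + c *\<^sub>R y) \<partial>lborel)"
    using c by (simp add: nn_integral_density nn_integral_distr nn_integral_cmult ennreal_power)
  finally show ?thesis by simp
qed

lemma nn_integral_lborel_vec_split:
  fixes f :: "'b::euclidean_space ^ 'n \<Rightarrow> ennreal"
  assumes [measurable]: "f \<in> borel_measurable borel"
  shows "(\<integral>\<^sup>+z. f z \<partial>lborel) =
    (\<integral>\<^sup>+x. \<integral>\<^sup>+y. f (\<chi> i. if i = k then y else x i) \<partial>lborel \<partial>PiM (- {k}) (\<lambda>_::'n. lborel :: 'b measure))"
proof -
  interpret product_sigma_finite "\<lambda>_::'n. lborel :: 'b measure" ..
  have ins: "(UNIV :: 'n set) = insert k (- {k})" by auto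
  have m[measurable]: "(\<lambda>x. f (vec_lambda x)) \<in> borel_measurable (Pi\<^sub>M UNIV (\<lambda>_::'n. lborel :: 'b measure))"
    by measurable
  have "(\<integral>\<^sup>+z. f z \<partial>lborel) = (\<integral>\<^sup>+x. f (\<chi> i. x i) \<partial>PiM (insert k (- {k})) (\<lambda>_::'n. lborel :: 'b measure))"
    by (subst lborel_vec, subst nn_integral_distr) (simp_all flip: ins)
  also have "\<dots> = (\<integral>\<^sup>+x. \<integral>\<^sup>+y. f (\<chi> i. (x(k := y)) i) \<partial>lborel \<partial>PiM (- {k}) (\<lambda>_::'n. lborel :: 'b measure))"
    by (rule product_nn_integral_insert) (use m in \<open>auto simp flip: ins\<close>)
  finally show ?thesis by (simp add: fun_upd_def)
qed

text \<open>The coordinate \<open>k\<close> is integrated first, with the others held fixed. There the map is affine with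
slope \<open>d\<close>, since \<open>c\<close> depends on the other coordinates only.\<close>

lemma nn_integral_lborel_coordinate_map:
  fixes f :: "'b::euclidean_space ^ 'n \<Rightarrow> ennreal" and c :: "'b ^ 'n \<Rightarrow> 'b"
  assumes [measurable]: "f \<in> borel_measurable borel" "c \<in> borel_measurable borel"
    and d: "d > 0" and c: "\<And>z z'. (\<And>i. i \<noteq> k \<Longrightarrow> z $ i = z' $ i) \<Longrightarrow> c z = c z'"
  shows "ennreal (d ^ DIM('b)) * (\<integral>\<^sup>+z. f (\<chi> i. if i = k then c z + d *\<^sub>R z $ k else z $ i) \<partial>lborel) =
    (\<integral>\<^sup>+z. f z \<partial>lborel)" (is "_ * integral\<^sup>N _ ?g = _")
proof -
  let ?P = "PiM (- {k}) (\<lambda>_::'n. lborel :: 'b measure)"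
  let ?c = "\<lambda>x. c (\<chi> i. if i = k then 0 else x i)"
  have g: "?g \<in> borel_measurable borel" by measurable
  have coord: "(\<lambda>x. fst x i) \<in> borel_measurable (?P \<Otimes>\<^sub>M lborel)" if "i \<noteq> k" for i
    using measurable_compose[OF measurable_fst
        measurable_component_singleton[of i "- {k}" "\<lambda>_. lborel :: 'b measure"]] that by simp
  have upd: "(\<lambda>x. \<chi> i. if i = k then u x else fst x i) \<in> borel_measurable (?P \<Otimes>\<^sub>M lborel)"
    if "u \<in> borel_measurable (?P \<Otimes>\<^sub>M lborel)" for u :: "('n \<Rightarrow> 'b) \<times> 'b \<Rightarrow> 'b"
  proof (rule measurable_vec_lambda)
    fix i
    show "(\<lambda>x. if i = k then u x else fst x i) \<in> borel_measurable (?P \<Otimes>\<^sub>M lborel)"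
      using coord[of i] that by (cases "i = k") auto
  qed
  have "(\<lambda>x. ?c (fst x) + d *\<^sub>R snd x) \<in> borel_measurable (?P \<Otimes>\<^sub>M lborel)"
    using measurable_compose[OF upd[of "\<lambda>_. 0"] assms(2)] by measurable
  from measurable_compose[OF upd[OF this] assms(1)]
  have m: "(\<lambda>(x, y). f (\<chi> i. if i = k then ?c x + d *\<^sub>R y else x i)) \<in> borel_measurable (?P \<Otimes>\<^sub>M lborel)"
    by (simp add: split_def)
  have "integral\<^sup>N lborel ?g = (\<integral>\<^sup>+x. \<integral>\<^sup>+y. f (\<chi> i. if i = k then ?c x + d *\<^sub>R y else x i) \<partial>lborel \<partial>?P)"
    apply (subst nn_integral_lborel_vec_split[OF g, of k])
    apply (intro nn_integral_cong arg_cong[where f = f])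
    apply (auto simp: vec_eq_iff intro!: c)
    done
  also have "ennreal (d ^ DIM('b)) * \<dots> =
      (\<integral>\<^sup>+x. ennreal (d ^ DIM('b)) * (\<integral>\<^sup>+y. f (\<chi> i. if i = k then ?c x + d *\<^sub>R y else x i) \<partial>lborel) \<partial>?P)"
    by (rule nn_integral_cmult[symmetric]) (use lborel.borel_measurable_nn_integral[OF m] in simp)
  also have "\<dots> = (\<integral>\<^sup>+x. \<integral>\<^sup>+y. f (\<chi> i. if i = k then y else x i) \<partial>lborel \<partial>?P)"
    by (intro nn_integral_cong nn_integral_lborel_affine[OF _ d]) measurable
  also have "\<dots> = (\<integral>\<^sup>+z. f z \<partial>lborel)"
    by (rule nn_integral_lborel_vec_split[symmetric]) measurable
  finally show ?thesis .
qed


section \<open>Positive definite matrices and their Cholesky factors\<close>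

definition conj_transpose :: "complex^'n^'m \<Rightarrow> complex^'m^'n" where
  "conj_transpose A = (\<chi> i j. cnj (A $ j $ i))"

definition hermitian_form :: "complex^'n^'n \<Rightarrow> complex^'n \<Rightarrow> complex" where
  "hermitian_form A x = (\<Sum>i\<in>UNIV. cnj (x $ i) * (A *v x) $ i)"

definition pos_definite :: "complex^'n^'n \<Rightarrow> bool" where
  "pos_definite A \<longleftrightarrow> conj_transpose A = A \<and> (\<forall>x. x \<noteq> 0 \<longrightarrow> 0 < Re (hermitian_form A x))"

lemma conj_transpose_mult: "conj_transpose (A ** B) = conj_transpose B ** conj_transpose A"
  by (simp add: conj_transpose_def matrix_matrix_mult_def vec_eq_iff mult.commute)

lemma conj_transpose_conj_transpose [simp]: "conj_transpose (conj_transpose A) = A"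
  by (simp add: conj_transpose_def)

lemma det_conj_transpose: "det (conj_transpose A) = cnj (det A)"
proof -
  have "det (conj_transpose A) = det (transpose (\<chi> i j. cnj (A $ i $ j)))"
    by (simp add: conj_transpose_def transpose_def)
  also have "\<dots> = cnj (det A)"
    unfolding det_transpose by (simp add: det_def)
  finally show ?thesis .
qed

lemma conj_transpose_mat_1: "conj_transpose (mat 1) = mat 1"
  by (simp add: conj_transpose_def mat_def vec_eq_iff)

lemma conj_transpose_adjoint: "(\<Sum>i\<in>UNIV. cnj (x $ i) * (conj_transpose B *v y) $ i) = (\<Sum>i\<in>UNIV. cnj ((B *v x) $ i) * y $ i)"
  unfolding matrix_vector_mult_def conj_transpose_def
  by (simp add: sum_distrib_left sum_distrib_right) (subst sum.swap, simp add: mult_ac)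

lemma hermitian_form_congruence: "hermitian_form (conj_transpose B ** A ** B) x = hermitian_form A (B *v x)"
  unfolding hermitian_form_def by (simp add: conj_transpose_adjoint flip: matrix_vector_mul_assoc)

lemma hermitian_form_mat_1: "hermitian_form (mat 1) x = complex_of_real ((norm x)\<^sup>2)"
  by (simp add: hermitian_form_def norm_vec_def L2_set_def sum_nonneg)
    (simp add: complex_norm_square[symmetric] mult.commute)

lemma hermitian_form_axis: "hermitian_form A (axis k 1) = A $ k $ k"
  unfolding hermitian_form_def matrix_vector_mul_component
  by (simp add: axis_def matrix_vector_mult_def if_distrib[of cnj] if_distrib[of "\<lambda>x. x * _"]
      if_distrib[of "\<lambda>x. _ * x"] cong: if_cong)

text \<open>In the Leibniz formula a permutation other than the identity moves some index \<open>i \<noteq> k\<close>, and the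
entry that it picks in row \<open>i\<close> is zero.\<close>

lemma det_single_row:
  fixes E :: "'a::comm_ring_1 ^ 'n ^ 'n"
  assumes "\<And>i j. i \<noteq> k \<Longrightarrow> E $ i $ j = (if i = j then 1 else 0)"
  shows "det E = E $ k $ k"
proof -
  have zero: "(\<Prod>i\<in>UNIV. E $ i $ p i) = 0" if p: "p permutes UNIV" "p \<noteq> id" for p
  proof -
    have "\<exists>i. i \<noteq> k \<and> p i \<noteq> i"
    proof (rule ccontr)
      assume "\<not> ?thesis"
      then have *: "p i = i" if "i \<noteq> k" for i using that by auto
      have "p k = k"
        using permutes_inj[OF p(1)] * by (metis injD)
      with * have "p = id" by (metis eq_id_iff)
      with p(2) show False by simp
    qed
    then obtain i where "i \<noteq> k" "p i \<noteq> i" by blast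
    then have "E $ i $ p i = 0" using assms[of i "p i"] by simp
    then show ?thesis by (intro prod_zero) auto
  qed
  have "det E = of_int (sign id) * (\<Prod>i\<in>UNIV. E $ i $ (id i))"
    unfolding det_def
    by (subst sum.remove[of _ id]) (auto simp: permutes_id zero intro!: sum.neutral)
  also have "of_int (sign id) * (\<Prod>i\<in>UNIV. E $ i $ (id i)) = E $ k $ k * (\<Prod>i\<in>UNIV - {k}. E $ i $ i)"
    by (subst prod.remove[of _ k]) (auto simp: sign_id)
  finally show ?thesis using assms by simp
qed

lemma pos_definite_cnj: "pos_definite A \<Longrightarrow> A $ i $ j = cnj (A $ j $ i)"
  unfolding pos_definite_def conj_transpose_def by (metis vec_lambda_beta)

lemma pos_definite_diagonal:
  assumes "pos_definite A"
  shows "A $ k $ k = complex_of_real (Re (A $ k $ k))" "0 < Re (A $ k $ k)"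
proof -
  have "Im (A $ k $ k) = Im (cnj (A $ k $ k))"
    using pos_definite_cnj[OF assms, of k k] by (rule arg_cong)
  then show "A $ k $ k = complex_of_real (Re (A $ k $ k))" by (simp add: complex_eq_iff)
  have "axis k 1 \<noteq> (0 :: complex^'a)" by simp
  then show "0 < Re (A $ k $ k)" using assms unfolding hermitian_form_axis[symmetric] pos_definite_def by blast
qed

text \<open>Completing the square in the coordinate \<open>k\<close> writes \<open>K\<close> as \<open>E* K' E\<close>, where \<open>E\<close> changes the coordinate
\<open>k\<close> only and \<open>K'\<close> is the Schur complement of the entry \<open>(k, k)\<close>, extended by \<open>1\<close> at that entry. So
\<open>K'\<close> differs from the identity in one coordinate less, and the induction runs over the set of the
coordinates that are left. The product \<open>B\<close> of the maps \<open>E\<close> inherits the scaling of Lebesgue measure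
from its factors, and the determinant of \<open>E\<close> is its entry at \<open>(k, k)\<close>.\<close>

lemma Cholesky_scaling:
  fixes K :: "complex^'n^'n"
  assumes "finite S" "pos_definite K" "\<And>i j. i \<notin> S \<Longrightarrow> K $ i $ j = (if i = j then 1 else 0)"
  shows "\<exists>B. conj_transpose B ** B = K \<and>
    (\<forall>f\<in>borel_measurable borel. ennreal ((cmod (det B))\<^sup>2) * (\<integral>\<^sup>+z. f (B *v z) \<partial>lborel) = (\<integral>\<^sup>+z. f z \<partial>lborel))"
  using assms
proof (induction S arbitrary: K rule: finite_induct)
  case empty
  then have "K = mat 1" by (simp add: vec_eq_iff mat_def)
  then show ?case
    by (intro exI[of _ "mat 1"]) (simp add: conj_transpose_mat_1)
next
  case (insert k T)
  define a where "a = Re (K $ k $ k)"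
  have herm: "cnj (K $ j $ i) = K $ i $ j" for i j
    using insert.prems(1) by (auto simp: pos_definite_def conj_transpose_def vec_eq_iff)
  have a0: "a > 0"
    using insert.prems(1) hermitian_form_axis[of K k] unfolding pos_definite_def a_def
    by (metis axis_eq_0_iff one_neq_zero)
  have Kkk: "K $ k $ k = complex_of_real a"
    using herm[of k k] by (simp add: a_def complex_eq_iff)
  \<comment> \<open>The entry of \<open>E\<close> at \<open>(k, k)\<close>: a positive real number, so that \<open>E\<close> is a real scaling in the
coordinate \<open>k\<close> up to a shift.\<close>
  define r where "r = complex_of_real (sqrt a)"
  have rr: "r * r = complex_of_real a" "cnj r = r" "r \<noteq> 0"
    using a0 by (auto simp: r_def simp flip: of_real_mult)
  define E :: "complex^'n^'n" where
    "E = (\<chi> i j. if i = k then K $ k $ j / r else if i = j then 1 else 0)"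
  define K' :: "complex^'n^'n" where
    "K' = (\<chi> i j. if i = k \<or> j = k then if i = j then 1 else 0 else K $ i $ j - K $ i $ k * K $ k $ j / a)"
  have Ev: "(E *v z) $ i = (if i = k then (\<Sum>j\<in>- {k}. K $ k $ j / r * z $ j) + sqrt a *\<^sub>R z $ k else z $ i)" for z i
  proof (cases "i = k")
    case True
    have "K $ k $ k / r = r" using rr Kkk by (simp add: field_simps)
    then show ?thesis using True
      by (simp add: matrix_vector_mult_def E_def sum.remove[of UNIV k] Compl_eq_Diff_UNIV r_def scaleR_conv_of_real)
  next
    case False
    then show ?thesis by (simp add: matrix_vector_mult_def E_def if_distrib[of "\<lambda>x. x * _"] cong: if_cong)
  qed
  have K: "conj_transpose E ** K' ** E = K"
  proof -
    have K'E: "(K' ** E) $ l $ j = (if l = k then K $ k $ j / r else if j = k then 0 else K' $ l $ j)" for l j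
    proof -
      have "(K' ** E) $ l $ j = K' $ l $ k * E $ k $ j + (\<Sum>m\<in>- {k}. K' $ l $ m * E $ m $ j)"
        by (simp add: matrix_matrix_mult_def sum.remove[of UNIV k] Compl_eq_Diff_UNIV)
      also have "(\<Sum>m\<in>- {k}. K' $ l $ m * E $ m $ j) = (\<Sum>m\<in>- {k}. if m = j then K' $ l $ m else 0)"
        by (intro sum.cong) (auto simp: E_def)
      finally show ?thesis by (auto simp: K'_def E_def)
    qed
    have "(conj_transpose E ** (K' ** E)) $ i $ j = K $ i $ j" for i j
    proof -
      have "(conj_transpose E ** (K' ** E)) $ i $ j =
          cnj (E $ k $ i) * (K' ** E) $ k $ j + (\<Sum>l\<in>- {k}. cnj (E $ l $ i) * (K' ** E) $ l $ j)"
        by (simp add: matrix_matrix_mult_def conj_transpose_def sum.remove[of UNIV k] Compl_eq_Diff_UNIV)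
      also have "(\<Sum>l\<in>- {k}. cnj (E $ l $ i) * (K' ** E) $ l $ j) = (\<Sum>l\<in>- {k}. if l = i then (K' ** E) $ l $ j else 0)"
        by (intro sum.cong) (auto simp: E_def)
      also have "\<dots> = (if i = k then 0 else (K' ** E) $ i $ j)" by simp
      also have "cnj (E $ k $ i) * (K' ** E) $ k $ j = K $ i $ k * K $ k $ j / a"
        unfolding K'E using rr by (simp add: E_def herm flip: rr(1))
      finally show ?thesis
        unfolding K'E using a0 by (auto simp: K'_def Kkk)
    qed
    then show ?thesis by (simp add: vec_eq_iff matrix_mul_assoc)
  qed
  have "pos_definite K'"
    unfolding pos_definite_def
  proof (intro conjI allI impI)
    show "conj_transpose K' = K'"
      by (auto simp: conj_transpose_def K'_def vec_eq_iff herm mult.commute)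
    fix x :: "complex^'n" assume x: "x \<noteq> 0"
    define y where "y = (\<chi> i. if i = k then (x $ k - (\<Sum>j\<in>- {k}. K $ k $ j / r * x $ j)) / r else x $ i)"
    have "E *v y = x"
      using rr(3) by (simp add: vec_eq_iff Ev) (auto simp: y_def r_def scaleR_conv_of_real)
    moreover from this x have "y \<noteq> 0" by auto
    ultimately show "0 < Re (hermitian_form K' x)"
      using insert.prems(1) hermitian_form_congruence[of E K' y] by (metis K pos_definite_def)
  qed
  moreover have "K' $ i $ j = (if i = j then 1 else 0)" if "i \<notin> T" for i j
    using that insert.prems(2)[of i] insert.prems(2)[of i k] by (auto simp: K'_def)
  ultimately obtain B where B: "conj_transpose B ** B = K'"
    "\<And>f. f \<in> borel_measurable borel \<Longrightarrow>
      ennreal ((cmod (det B))\<^sup>2) * (\<integral>\<^sup>+z. f (B *v z) \<partial>lborel) = (\<integral>\<^sup>+z. f z \<partial>lborel)"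
    using insert.IH by blast
  have det: "det (B ** E) = det B * r"
  proof -
    have "det E = r" using rr Kkk by (subst det_single_row[of k]) (auto simp: E_def field_simps)
    then show ?thesis by (simp add: det_mul)
  qed
  show ?case
  proof (intro exI[of _ "B ** E"] conjI ballI)
    show "conj_transpose (B ** E) ** (B ** E) = K"
      using B(1) K by (simp add: conj_transpose_mult matrix_mul_assoc) (simp flip: matrix_mul_assoc)
    fix f :: "complex^'n \<Rightarrow> ennreal" assume f: "f \<in> borel_measurable borel"
    have [measurable]: "(*v) B \<in> borel_measurable borel"
      by (intro borel_measurable_continuous_onI linear_continuous_on matrix_vector_mul_bounded_linear)
    have fB[measurable]: "(\<lambda>z. f (B *v z)) \<in> borel_measurable borel"
      using f by measurable
    have "ennreal ((cmod (det (B ** E)))\<^sup>2) * (\<integral>\<^sup>+z. f ((B ** E) *v z) \<partial>lborel) =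
        ennreal ((cmod (det B))\<^sup>2) * (ennreal (sqrt a ^ DIM(complex)) *
        (\<integral>\<^sup>+z. f (B *v (\<chi> i. if i = k then (\<Sum>j\<in>- {k}. K $ k $ j / r * z $ j) + sqrt a *\<^sub>R z $ k else z $ i)) \<partial>lborel))"
    proof -
      have "(B ** E) *v z = B *v (\<chi> i. if i = k then (\<Sum>j\<in>- {k}. K $ k $ j / r * z $ j) + sqrt a *\<^sub>R z $ k else z $ i)" for z
        unfolding matrix_vector_mul_assoc[symmetric]
        by (rule arg_cong[where f = "(*v) B"]) (simp add: vec_eq_iff Ev)
      moreover have "ennreal ((cmod (det (B ** E)))\<^sup>2) = ennreal ((cmod (det B))\<^sup>2) * ennreal (sqrt a ^ DIM(complex))"
        using a0 by (simp add: det norm_mult power_mult_distrib ennreal_mult r_def)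
      ultimately show ?thesis by (simp add: mult.assoc)
    qed
    also have "\<dots> = ennreal ((cmod (det B))\<^sup>2) * (\<integral>\<^sup>+z. f (B *v z) \<partial>lborel)"
      using a0 by (subst nn_integral_lborel_coordinate_map[OF fB]) (auto intro!: sum.cong)
    also have "\<dots> = (\<integral>\<^sup>+z. f z \<partial>lborel)" by (rule B(2)[OF f])
    finally show "ennreal ((cmod (det (B ** E)))\<^sup>2) * (\<integral>\<^sup>+z. f ((B ** E) *v z) \<partial>lborel) = (\<integral>\<^sup>+z. f z \<partial>lborel)" .
  qed
qed

lemma pos_definite_Cholesky:
  fixes K :: "complex^'n^'n"
  assumes "pos_definite K"
  shows "\<exists>B. conj_transpose B ** B = K \<and> (\<forall>f\<in>borel_measurable borel.
      ennreal ((cmod (det B))\<^sup>2) * (\<integral>\<^sup>+z. f (B *v z) \<partial>lborel) = (\<integral>\<^sup>+z. f z \<partial>lborel))"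
proof -
  have "K $ i $ j = (if i = j then 1 else 0)" if "i \<notin> UNIV" for i j using that by simp
  from Cholesky_scaling[OF finite assms this] show ?thesis .
qed

lemma matrix_inv_both:
  fixes A :: "'a::field^'n^'n"
  assumes "invertible A"
  shows "A ** matrix_inv A = mat 1" "matrix_inv A ** A = mat 1"
  using assms someI_ex[of "\<lambda>A'. A ** A' = mat 1 \<and> A' ** A = mat 1"]
  unfolding invertible_def matrix_inv_def by auto

lemma matrix_inv_eqI:
  fixes A :: "'a::field^'n^'n"
  assumes "A ** B = mat 1"
  shows "matrix_inv A = B"
proof -
  have "invertible A" using assms by (auto simp: invertible_right_inverse)
  then have "matrix_inv A ** (A ** B) = B"
    by (simp add: matrix_mul_assoc matrix_inv_both)
  then show ?thesis by (simp add: assms)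
qed

text \<open>If the form vanishes at some \<open>y \<noteq> 0\<close>, then a short step from \<open>y\<close> in the direction of \<open>- A y\<close>, which
is not zero by invertibility, makes it negative.\<close>

lemma pos_definite_of_psd:
  fixes A :: "complex^'n^'n"
  assumes herm: "conj_transpose A = A" and psd: "\<And>x. 0 \<le> Re (hermitian_form A x)" and inv: "invertible A"
  shows "pos_definite A"
  unfolding pos_definite_def
proof (intro conjI allI impI herm)
  fix y :: "complex^'n" assume y: "y \<noteq> 0"
  show "0 < Re (hermitian_form A y)"
  proof (rule ccontr)
    assume "\<not> ?thesis"
    then have y0: "Re (hermitian_form A y) = 0" using psd[of y] by simp
    define z where "z = A *v y"
    define b where "b = (norm z)\<^sup>2"
    define c where "c = Re (hermitian_form A z)"
    have zz: "(\<Sum>i\<in>UNIV. cnj (z $ i) * z $ i) = complex_of_real b"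
      using hermitian_form_mat_1[of z] by (simp add: hermitian_form_def b_def)
    have yz: "(\<Sum>i\<in>UNIV. cnj (y $ i) * (A *v z) $ i) = complex_of_real b"
      using conj_transpose_adjoint[of y A z] by (simp add: herm zz flip: z_def)
    have quad: "0 \<le> 2 * t * b + t\<^sup>2 * c" for t :: real
    proof -
      have "hermitian_form A (y + complex_of_real t *s z) = hermitian_form A y + complex_of_real t * (\<Sum>i\<in>UNIV. cnj (y $ i) * (A *v z) $ i)
          + complex_of_real t * (\<Sum>i\<in>UNIV. cnj (z $ i) * (A *v y) $ i) + complex_of_real (t\<^sup>2) * hermitian_form A z"
        unfolding hermitian_form_def matrix_vector_right_distrib vector_scalar_commute
        by (simp add: sum.distrib sum_distrib_left algebra_simps power2_eq_square)
      then have "Re (hermitian_form A (y + complex_of_real t *s z)) = 2 * t * b + t\<^sup>2 * c"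
        unfolding yz z_def[symmetric] zz by (simp add: y0 c_def)
      then show ?thesis using psd[of "y + complex_of_real t *s z"] by simp
    qed
    have c: "c \<ge> 0" using psd by (simp add: c_def)
    have "z \<noteq> 0"
    proof
      assume "z = 0"
      then have "matrix_inv A *v (A *v y) = 0" by (simp add: z_def)
      then show False using y by (simp add: matrix_vector_mul_assoc matrix_inv_both[OF inv])
    qed
    then have b: "b > 0" by (simp add: b_def)
    define t where "t = b / (c + 1)"
    have t: "t > 0" using b c by (simp add: t_def)
    have "t * (c + 1) = b" using c by (simp add: t_def)
    then have "t * c < 2 * b" using t b by (simp add: algebra_simps)
    then have "t * (t * c) < t * (2 * b)" using t by (rule mult_strict_left_mono)
    then show False using quad[of "- t"] by (simp add: power2_eq_square mult_ac)
  qed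
qed

lemma pos_definite_matrix_inv:
  assumes pd: "pos_definite A" and inv: "invertible A"
  shows "pos_definite (matrix_inv A)"
proof -
  let ?K = "matrix_inv A"
  have herm: "conj_transpose A = A" using pd by (simp add: pos_definite_def)
  have "conj_transpose ?K = ?K"
  proof -
    have "conj_transpose (?K ** A) = A ** conj_transpose ?K" by (simp add: conj_transpose_mult herm)
    then have "A ** conj_transpose ?K = mat 1" by (simp add: matrix_inv_both[OF inv] conj_transpose_mat_1)
    then show ?thesis by (metis matrix_inv_eqI)
  qed
  moreover have "0 < Re (hermitian_form ?K x)" if x: "x \<noteq> 0" for x
  proof -
    have Ax: "A *v (?K *v x) = x" by (simp add: matrix_vector_mul_assoc matrix_inv_both[OF inv])
    then have "?K *v x \<noteq> 0" using x by auto
    then have "0 < Re (hermitian_form A (?K *v x))" using pd by (simp add: pos_definite_def)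
    also have "hermitian_form A (?K *v x) = hermitian_form ?K (A *v (?K *v x))"
      by (simp add: herm matrix_inv_both[OF inv] flip: hermitian_form_congruence)
    finally show ?thesis by (simp add: Ax)
  qed
  ultimately show ?thesis by (simp add: pos_definite_def)
qed

lemma pos_definite_det:
  fixes A :: "complex^'n^'n"
  assumes "pos_definite A"
  obtains d where "d > 0" "det A = complex_of_real d"
proof -
  obtain B :: "complex^'n^'n" where B: "conj_transpose B ** B = A"
    using pos_definite_Cholesky[OF assms] by blast
  have detA: "det A = complex_of_real ((cmod (det B))\<^sup>2)"
    by (simp add: B[symmetric] det_mul det_conj_transpose complex_norm_square mult.commute del: of_real_power)
  have ker: "x = 0" if "B *v x = 0" for x
  proof (rule ccontr)
    assume "x \<noteq> 0"
    moreover have "hermitian_form A x = 0"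
      using hermitian_form_congruence[of B "mat 1" x] that by (simp add: B hermitian_form_mat_1)
    ultimately show False using assms by (force simp: pos_definite_def)
  qed
  then have "invertible B"
    by (simp add: invertible_left_inverse matrix_left_invertible_ker)
  then have "det B \<noteq> 0" by (simp add: invertible_det_nz)
  with detA show ?thesis by (intro that[of "(cmod (det B))\<^sup>2"]) simp_all
qed

section \<open>Joint characteristic functions\<close>

lemma (in prob_space) integrable_bounded:
  fixes f :: "'a \<Rightarrow> 'b::{banach, second_countable_topology}"
  assumes "f \<in> borel_measurable M" "\<And>x. norm (f x) \<le> B"
  shows "integrable M f"
  by (rule integrable_const_bound[of _ B]) (use assms in auto)

lemma char_uminus: "char N (- t) = cnj (char N t)"
proof -
  have "char N (- t) = (CLINT x|N. cnj (iexp (t * x)))"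
    unfolding char_def by (intro Bochner_Integration.integral_cong refl) (simp add: exp_cnj)
  then show ?thesis by (simp add: char_def)
qed

text \<open>The weight \<open>2 + h\<close> is positive, so that \<open>(2 + h) / (2 + E h)\<close> is the density of another probability
measure. By assumption \<open>X\<close> has the characteristic function of \<open>N\<close> under it as well, and Levy's
uniqueness theorem gives the distribution of \<open>X\<close> under both measures.\<close>

lemma (in prob_space) weighted_distribution_real:
  fixes h X :: "'a \<Rightarrow> real"
  assumes [measurable]: "h \<in> borel_measurable M" "X \<in> borel_measurable M"
    and h: "\<And>\<omega>. \<bar>h \<omega>\<bar> \<le> 1"
    and N: "real_distribution N"
    and X: "\<And>t. (CLINT \<omega>|M. iexp (t * X \<omega>)) = char N t"
    and hX: "\<And>t. (CLINT \<omega>|M. h \<omega> * iexp (t * X \<omega>)) = expectation h * char N t"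
    and A: "A \<in> sets borel"
  shows "expectation (\<lambda>\<omega>. h \<omega> * indicator A (X \<omega>)) = expectation h * measure N A"
proof -
  interpret N: real_distribution N by fact
  have int: "integrable M (\<lambda>\<omega>. h \<omega> * g \<omega>)"
    if [measurable]: "g \<in> borel_measurable M" and "\<And>\<omega>. norm (g \<omega>) \<le> 1" for g :: "'a \<Rightarrow> real"
    using h that(2) by (intro integrable_bounded[where B = 1]) (auto simp: abs_mult intro!: mult_le_one)
  have inth: "integrable M h" using h by (intro integrable_bounded[where B = 1]) auto
  have c: "-1 \<le> expectation h"
    using integral_mono[of M "\<lambda>_. -1" h] inth h by (simp add: abs_le_iff prob_space minus_le_iff)
  define w where "w \<omega> = (2 + h \<omega>) / (2 + expectation h)" for \<omega>
  have w0: "w \<omega> \<ge> 0" for \<omega> using c h[of \<omega>] by (auto simp: w_def abs_le_iff)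
  have [measurable]: "w \<in> borel_measurable M" unfolding w_def by measurable
  have intw: "integrable M w" unfolding w_def using inth by simp
  have Ew: "expectation w = 1"
  proof -
    have "expectation w = (2 + expectation h) / (2 + expectation h)"
      unfolding w_def using inth by (simp add: prob_space)
    then show ?thesis using c by simp
  qed
  define M' where "M' = density M (\<lambda>\<omega>. ennreal (w \<omega>))"
  have "prob_space M'"
  proof
    show "emeasure M' (space M') = 1"
      using w0 intw Ew by (simp add: M'_def emeasure_density nn_integral_eq_integral cong: nn_integral_cong)
  qed
  then interpret M': prob_space M' .
  have [measurable]: "X \<in> borel_measurable M'" by (simp add: M'_def)
  have N': "real_distribution (distr M' borel X)"
    by (rule M'.real_distribution_distr) measurable
  have "char (distr M' borel X) t = char N t" for t
  proof -
    have "char (distr M' borel X) t = (CLINT \<omega>|M'. iexp (t * X \<omega>))"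
      unfolding char_def by (rule integral_distr) measurable
    also have "\<dots> = (CLINT \<omega>|M. w \<omega> *\<^sub>R iexp (t * X \<omega>))"
      unfolding M'_def using w0 by (subst integral_density) auto
    also have "\<dots> = (CLINT \<omega>|M. (2 * iexp (t * X \<omega>) + h \<omega> * iexp (t * X \<omega>)) / complex_of_real (2 + expectation h))"
      by (intro Bochner_Integration.integral_cong refl) (simp add: w_def scaleR_conv_of_real field_simps)
    also have "\<dots> = ((CLINT \<omega>|M. 2 * iexp (t * X \<omega>)) + (CLINT \<omega>|M. h \<omega> * iexp (t * X \<omega>))) / complex_of_real (2 + expectation h)"
    proof -
      have "integrable M (\<lambda>\<omega>. 2 * iexp (t * X \<omega>))"
        by (intro integrable_bounded[where B = 2]) (auto simp: norm_mult)
      moreover have "integrable M (\<lambda>\<omega>. h \<omega> * iexp (t * X \<omega>))"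
        using h by (intro integrable_bounded[where B = 1]) (auto simp: norm_mult)
      ultimately show ?thesis by (simp only: integral_divide_zero Bochner_Integration.integral_add)
    qed
    also have "\<dots> = (2 * char N t + expectation h * char N t) / complex_of_real (2 + expectation h)"
      by (simp only: hX integral_mult_right_zero X)
    also have "\<dots> = char N t"
    proof -
      have "complex_of_real (2 + expectation h) \<noteq> 0"
        unfolding of_real_eq_0_iff using c by linarith
      then show ?thesis by (simp add: field_simps)
    qed
    finally show ?thesis .
  qed
  then have eq: "distr M' borel X = N"
    by (intro Levy_uniqueness N' N ext)
  have "char (distr M borel X) = char N"
    using X by (auto simp: char_def integral_distr)
  then have eqM: "distr M borel X = N"
    by (intro Levy_uniqueness real_distribution_distr N) measurable
  have "measure N A = (LINT x|distr M' borel X. indicator A x)"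
    using A by (simp add: eq)
  also have "\<dots> = (LINT \<omega>|M'. indicator A (X \<omega>))"
    using A by (intro integral_distr) auto
  also have "\<dots> = (LINT \<omega>|M. w \<omega> * indicator A (X \<omega>))"
    unfolding M'_def using w0 A by (subst integral_density) auto
  also have "\<dots> = (LINT \<omega>|M. (2 * indicator A (X \<omega>) + h \<omega> * indicator A (X \<omega>)) / (2 + expectation h))"
    by (intro Bochner_Integration.integral_cong refl) (simp add: w_def field_simps)
  also have "\<dots> = ((LINT \<omega>|M. 2 * indicator A (X \<omega>)) + (LINT \<omega>|M. h \<omega> * indicator A (X \<omega>))) / (2 + expectation h)"
  proof -
    have "integrable M (\<lambda>\<omega>. 2 * indicator A (X \<omega>) :: real)"
      using A by (intro integrable_bounded[where B = 2]) (auto simp: indicator_def)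
    moreover have "integrable M (\<lambda>\<omega>. h \<omega> * indicator A (X \<omega>))"
      using A by (intro int) (auto simp: indicator_def)
    ultimately show ?thesis by simp
  qed
  also have "(LINT \<omega>|M. 2 * indicator A (X \<omega>)) = 2 * measure N A"
  proof -
    have "measure N A = (LINT x|distr M borel X. indicator A x)" using A by (simp add: eqM)
    also have "\<dots> = (LINT \<omega>|M. indicator A (X \<omega>))" using A by (intro integral_distr) auto
    finally show ?thesis by simp
  qed
  finally have "measure N A * (2 + expectation h) = 2 * measure N A + (LINT \<omega>|M. h \<omega> * indicator A (X \<omega>))"
    using c by (simp add: eq_divide_eq)
  then show ?thesis by (simp add: algebra_simps)
qed

text \<open>The real parts of \<open>u G\<close> with \<open>u = 1\<close> and \<open>u = - \<i>\<close> are the real and the imaginary part of \<open>G\<close>, and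
both satisfy the hypotheses of the real case.\<close>

lemma (in prob_space) weighted_distribution:
  fixes G :: "'a \<Rightarrow> complex" and X :: "'a \<Rightarrow> real"
  assumes G[measurable]: "G \<in> borel_measurable M" and X[measurable]: "X \<in> borel_measurable M"
    and bnd: "\<And>\<omega>. cmod (G \<omega>) \<le> 1"
    and N: "real_distribution N"
    and charX: "\<And>t. (CLINT \<omega>|M. iexp (t * X \<omega>)) = char N t"
    and GX: "\<And>t. (CLINT \<omega>|M. G \<omega> * iexp (t * X \<omega>)) = (CLINT \<omega>|M. G \<omega>) * char N t"
    and A: "A \<in> sets borel"
  shows "(CLINT \<omega>|M. G \<omega> * indicator A (X \<omega>)) = (CLINT \<omega>|M. G \<omega>) * measure N A"
proof -
  have int: "integrable M (\<lambda>\<omega>. u * (G \<omega> * g \<omega>))"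
    if [measurable]: "g \<in> borel_measurable M" and "\<And>\<omega>. cmod (g \<omega>) \<le> 1" and "cmod u = 1" for u g
    using bnd that(2,3) by (intro integrable_bounded[where B = 1]) (auto simp: norm_mult intro: mult_le_one)
  have Re: "expectation (\<lambda>\<omega>. Re (u * G \<omega>) * indicator A (X \<omega>)) = Re (u * (CLINT \<omega>|M. G \<omega>)) * measure N A"
    if u: "cmod u = 1" for u
  proof -
    have intu: "integrable M (\<lambda>\<omega>. u * G \<omega>)" using int[OF _ _ u, of "\<lambda>_. 1"] by simp
    have ERe: "expectation (\<lambda>\<omega>. Re (u * G \<omega>)) = Re (u * (CLINT \<omega>|M. G \<omega>))"
      by (subst integral_Re[OF intu]) simp
    have "expectation (\<lambda>\<omega>. Re (u * G \<omega>) * indicator A (X \<omega>)) = expectation (\<lambda>\<omega>. Re (u * G \<omega>)) * measure N A"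
    proof (rule weighted_distribution_real[OF _ _ _ N charX _ A])
      show "\<bar>Re (u * G \<omega>)\<bar> \<le> 1" for \<omega>
        using abs_Re_le_cmod[of "u * G \<omega>"] bnd[of \<omega>] u by (simp add: norm_mult)
      have inte: "integrable M (\<lambda>\<omega>. u * (G \<omega> * iexp (r * X \<omega>)))" for r
        by (rule int[OF _ _ u]) auto
      fix t
      \<comment> \<open>The conjugate of the identity at \<open>- t\<close> is the identity for the conjugate of \<open>G\<close> at \<open>t\<close>.\<close>
      have "(CLINT \<omega>|M. Re (u * G \<omega>) * iexp (t * X \<omega>)) =
          (CLINT \<omega>|M. (u * (G \<omega> * iexp (t * X \<omega>)) + cnj (u * (G \<omega> * iexp (- t * X \<omega>)))) / 2)"
      proof (intro Bochner_Integration.integral_cong refl)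
        fix \<omega>
        have "complex_of_real (Re z) * e = (z * e + cnj z * e) / 2" for z e :: complex
          by (simp add: complex_add_cnj flip: distrib_right)
        from this[of "u * G \<omega>" "iexp (t * X \<omega>)"]
        show "Re (u * G \<omega>) * iexp (t * X \<omega>) = (u * (G \<omega> * iexp (t * X \<omega>)) + cnj (u * (G \<omega> * iexp (- t * X \<omega>)))) / 2"
          by (simp add: exp_cnj mult.assoc)
      qed
      also have "\<dots> = (u * ((CLINT \<omega>|M. G \<omega>) * char N t) + cnj (u * ((CLINT \<omega>|M. G \<omega>) * char N (- t)))) / 2"
        unfolding GX[symmetric] integral_mult_right_zero[symmetric] Bochner_Integration.integral_cnj[symmetric]
          integral_divide_zero
        by (subst Bochner_Integration.integral_add[OF inte integrable_cnj[OF inte]]) (rule refl)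
      also have "\<dots> = Re (u * (CLINT \<omega>|M. G \<omega>)) * char N t"
      proof -
        have "(z * c + cnj z * c) / 2 = complex_of_real (Re z) * c" for z c :: complex
          by (simp add: complex_add_cnj flip: distrib_right)
        from this[of "u * (CLINT \<omega>|M. G \<omega>)" "char N t"] show ?thesis
          by (simp add: char_uminus mult.assoc)
      qed
      finally show "(CLINT \<omega>|M. Re (u * G \<omega>) * iexp (t * X \<omega>)) = expectation (\<lambda>\<omega>. Re (u * G \<omega>)) * char N t"
        unfolding ERe .
    qed measurable
    then show ?thesis unfolding ERe .
  qed
  have intA: "integrable M (\<lambda>\<omega>. G \<omega> * indicator A (X \<omega>))"
    using int[of "\<lambda>\<omega>. indicator A (X \<omega>)" 1] A by (simp add: indicator_def)
  have "Re (CLINT \<omega>|M. G \<omega> * indicator A (X \<omega>)) = expectation (\<lambda>\<omega>. Re (G \<omega>) * indicator A (X \<omega>))"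
    by (subst integral_Re[OF intA, symmetric]) (auto intro!: Bochner_Integration.integral_cong simp: indicator_def)
  moreover have "Im (CLINT \<omega>|M. G \<omega> * indicator A (X \<omega>)) = expectation (\<lambda>\<omega>. Im (G \<omega>) * indicator A (X \<omega>))"
    by (subst integral_Im[OF intA, symmetric]) (auto intro!: Bochner_Integration.integral_cong simp: indicator_def)
  ultimately show ?thesis using Re[of 1] Re[of "- \<i>"] by (simp add: complex_eq_iff)
qed

text \<open>A joint characteristic function that factorises makes the variables independent. In the expectation
of the product of the \<open>iexp (a i * X i)\<close>, these factors are replaced by indicators one at a time; the
product of the factors for the other indices is a bounded weight for \<open>X k\<close>, which
\<open>weighted_distribution\<close> handles.\<close>

lemma (in prob_space) prob_eq_prod_of_joint_char:
  fixes X :: "'i \<Rightarrow> 'a \<Rightarrow> real" and N :: "'i \<Rightarrow> real measure"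
  assumes I: "finite I" and X[measurable]: "\<And>i. i \<in> I \<Longrightarrow> X i \<in> borel_measurable M"
    and N: "\<And>i. i \<in> I \<Longrightarrow> real_distribution (N i)"
    and char: "\<And>a. (CLINT \<omega>|M. iexp (\<Sum>i\<in>I. a i * X i \<omega>)) = (\<Prod>i\<in>I. char (N i) (a i))"
    and A[measurable]: "\<And>i. i \<in> I \<Longrightarrow> A i \<in> sets borel"
  shows "prob {\<omega>\<in>space M. \<forall>i\<in>I. X i \<omega> \<in> A i} = (\<Prod>i\<in>I. measure (N i) (A i))"
proof -
  define W where "W S a \<omega> = (\<Prod>i\<in>S. indicator (A i) (X i \<omega>)) * (\<Prod>i\<in>I - S. iexp (a i * X i \<omega>))"
    for S a \<omega>
  have iexp_sum: "iexp (\<Sum>i\<in>I. a i * X i \<omega>) = (\<Prod>i\<in>I. iexp (a i * X i \<omega>))" for a \<omega>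
    by (simp add: exp_sum I sum_distrib_left)
  have marginal: "(CLINT \<omega>|M. iexp (t * X k \<omega>)) = char (N k) t" if k: "k \<in> I" for k t
  proof -
    have "(\<Sum>i\<in>I. (if i = k then t else 0) * X i \<omega>) = t * X k \<omega>" for \<omega>
      using I k by (subst sum.remove[of _ k]) (auto intro!: sum.neutral)
    moreover have "(\<Prod>i\<in>I. char (N i) (if i = k then t else 0)) = char (N k) t"
      using I k N by (subst prod.remove[of _ k]) (auto intro!: prod.neutral simp: real_distribution.char_zero)
    ultimately show ?thesis using char[of "\<lambda>i. if i = k then t else 0"] by simp
  qed
  have claim: "(CLINT \<omega>|M. W S a \<omega>) = (\<Prod>i\<in>S. measure (N i) (A i)) * (\<Prod>i\<in>I - S. char (N i) (a i))"
    if "finite S" "S \<subseteq> I" for S a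
    using that
  proof (induction S arbitrary: a rule: finite_induct)
    case empty
    show ?case using char[of a] unfolding iexp_sum by (simp add: W_def)
  next
    case (insert k S)
    then have k: "k \<in> I" "k \<notin> S" and S: "S \<subseteq> I" "finite S" by auto
    define G where "G \<omega> = (\<Prod>i\<in>S. indicator (A i) (X i \<omega>)) * (\<Prod>i\<in>I - insert k S. iexp (a i * X i \<omega>))" for \<omega>
    define c where "c = (\<Prod>i\<in>S. measure (N i) (A i)) * (\<Prod>i\<in>I - insert k S. char (N i) (a i))"
    have IS: "I - S = insert k (I - insert k S)" using k by auto
    have fin: "finite (I - insert k S)" using I by auto
    have Wk: "W S (a(k := t)) \<omega> = G \<omega> * iexp (t * X k \<omega>)" for t \<omega>
    proof -
      have "(\<Prod>i\<in>I - insert k S. iexp ((a(k := t)) i * X i \<omega>)) = (\<Prod>i\<in>I - insert k S. iexp (a i * X i \<omega>))"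
        by (intro prod.cong) auto
      then show ?thesis unfolding W_def G_def IS using fin by (simp add: mult_ac)
    qed
    have ck: "(\<Prod>i\<in>S. measure (N i) (A i)) * (\<Prod>i\<in>I - S. char (N i) ((a(k := t)) i)) = c * char (N k) t" for t
    proof -
      have "(\<Prod>i\<in>I - insert k S. char (N i) ((a(k := t)) i)) = (\<Prod>i\<in>I - insert k S. char (N i) (a i))"
        by (intro prod.cong) auto
      then show ?thesis unfolding c_def IS using fin by (simp add: mult_ac)
    qed
    have Gt: "(CLINT \<omega>|M. G \<omega> * iexp (t * X k \<omega>)) = c * char (N k) t" for t
      using insert.IH[OF S(1), of "a(k := t)"] unfolding Wk ck .
    have G0: "(CLINT \<omega>|M. G \<omega>) = c"
      using Gt[of 0] N[OF k(1)] by (simp add: real_distribution.char_zero)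
    have "(CLINT \<omega>|M. G \<omega> * indicator (A k) (X k \<omega>)) = (CLINT \<omega>|M. G \<omega>) * measure (N k) (A k)"
    proof (rule weighted_distribution[OF _ _ _ N[OF k(1)] marginal[OF k(1)]])
      show "G \<in> borel_measurable M"
        unfolding G_def using S by (intro borel_measurable_times borel_measurable_prod) (auto simp: subset_iff)
      show "X k \<in> borel_measurable M" "A k \<in> sets borel" using k by auto
      show "cmod (G \<omega>) \<le> 1" for \<omega>
        unfolding G_def norm_mult prod_norm[symmetric]
        by (intro mult_le_one prod_le_1 prod_nonneg) (auto simp: indicator_def)
    qed (simp only: Gt G0)
    moreover have "W (insert k S) a \<omega> = G \<omega> * indicator (A k) (X k \<omega>)" for \<omega>
      unfolding W_def G_def using S k by (simp add: mult_ac)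
    ultimately show ?case using S k by (simp add: G0 c_def mult_ac)
  qed
  have "complex_of_real (prob {\<omega>\<in>space M. \<forall>i\<in>I. X i \<omega> \<in> A i}) = (CLINT \<omega>|M. W I (\<lambda>_. 0) \<omega>)"
  proof -
    have "{\<omega>\<in>space M. \<forall>i\<in>I. X i \<omega> \<in> A i} \<in> sets M"
      using I by (intro sets.sets_Collect_finite_All) (auto intro!: measurable_sets_Collect)
    then have "prob {\<omega>\<in>space M. \<forall>i\<in>I. X i \<omega> \<in> A i} = expectation (indicator {\<omega>\<in>space M. \<forall>i\<in>I. X i \<omega> \<in> A i})"
      by simp
    moreover have "W I (\<lambda>_. 0) \<omega> = complex_of_real (indicator {\<omega>\<in>space M. \<forall>i\<in>I. X i \<omega> \<in> A i} \<omega>)" if "\<omega> \<in> space M" for \<omega>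
      using that I unfolding W_def by (auto simp: indicator_def intro!: prod_zero)
    ultimately show ?thesis
      by (simp cong: Bochner_Integration.integral_cong)
  qed
  also have "\<dots> = complex_of_real (\<Prod>i\<in>I. measure (N i) (A i))"
    using claim[of I] I by simp
  finally show ?thesis unfolding of_real_eq_iff .
qed

lemma char_normal_density:
  assumes "\<sigma> > 0"
  shows "char (density lborel (\<lambda>x. ennreal (normal_density \<mu> \<sigma> x))) t = exp (\<i> * complex_of_real (\<mu> * t) - complex_of_real (\<sigma>\<^sup>2 * t\<^sup>2 / 2))"
proof -
  interpret N: real_distribution std_normal_distribution by (rule real_dist_normal_dist)
  have "distributed std_normal_distribution lborel (\<lambda>x. x) (\<lambda>x. ennreal (std_normal_density x))"
    by (auto simp: distributed_def distr_id2)
  from N.normal_density_affine[OF this, of \<sigma> \<mu>]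
  have "density lborel (\<lambda>x. ennreal (normal_density \<mu> \<sigma> x)) = distr std_normal_distribution lborel (\<lambda>x. \<mu> + \<sigma> * x)"
    using assms by (simp add: distributed_def)
  then have "char (density lborel (\<lambda>x. ennreal (normal_density \<mu> \<sigma> x))) t =
      (CLINT x|std_normal_distribution. iexp (t * \<mu>) * iexp (t * \<sigma> * x))"
    by (simp add: char_def integral_distr algebra_simps exp_add)
  also have "\<dots> = iexp (t * \<mu>) * char std_normal_distribution (t * \<sigma>)"
    by (simp add: char_def)
  also have "char std_normal_distribution (t * \<sigma>) = exp (- complex_of_real (\<sigma>\<^sup>2 * t\<^sup>2 / 2))"
    by (simp add: char_std_normal_distribution power_mult_distrib mult.commute flip: exp_of_real)
  finally show ?thesis
    by (simp add: mult_exp_exp mult_ac)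
qed

text \<open>The assumed characteristic function factorises over the basis into those of centred normal laws,
which gives the probabilities of all boxes.\<close>

lemma (in prob_space) distributed_isotropic_gaussian:
  fixes U :: "'a \<Rightarrow> 'b::euclidean_space"
  assumes [measurable]: "U \<in> borel_measurable M" and \<sigma>: "\<sigma> > 0"
    and char: "\<And>a. (CLINT \<omega>|M. iexp (a \<bullet> U \<omega>)) = complex_of_real (exp (- \<sigma>\<^sup>2 * (norm a)\<^sup>2 / 2))"
  shows "distributed M lborel U (\<lambda>x. ennreal (\<Prod>b\<in>Basis. normal_density 0 \<sigma> (x \<bullet> b)))"
proof -
  define N where "N = density lborel (\<lambda>x. ennreal (normal_density 0 \<sigma> x))"
  have N: "real_distribution N"
    unfolding N_def real_distribution_def real_distribution_axioms_def
    using prob_space_normal_density[OF \<sigma>] by simp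
  have joint: "(CLINT \<omega>|M. iexp (\<Sum>b\<in>Basis. c b * (U \<omega> \<bullet> b))) = (\<Prod>b\<in>Basis. char N (c b))" for c :: "'b \<Rightarrow> real"
  proof -
    let ?a = "\<Sum>b\<in>Basis. c b *\<^sub>R b"
    have n: "(norm ?a)\<^sup>2 = (\<Sum>b\<in>Basis. (c b)\<^sup>2)"
      by (subst norm_eq_sqrt_inner, subst euclidean_inner) (simp add: sum_nonneg power2_eq_square)
    have "(\<Sum>b\<in>Basis. c b * (U \<omega> \<bullet> b)) = ?a \<bullet> U \<omega>" for \<omega>
      by (subst inner_commute) (simp add: inner_sum_right)
    then have "(CLINT \<omega>|M. iexp (\<Sum>b\<in>Basis. c b * (U \<omega> \<bullet> b))) = exp (complex_of_real (- \<sigma>\<^sup>2 * (norm ?a)\<^sup>2 / 2))"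
      by (simp only: char exp_of_real)
    also have "- \<sigma>\<^sup>2 * (norm ?a)\<^sup>2 / 2 = (\<Sum>b\<in>Basis. - (\<sigma>\<^sup>2 * (c b)\<^sup>2 / 2))"
      by (simp only: n) (simp add: sum_distrib_left sum_negf sum_divide_distrib)
    also have "exp (complex_of_real \<dots>) = (\<Prod>b\<in>Basis. char N (c b))"
      unfolding of_real_sum by (subst exp_sum) (simp_all add: N_def char_normal_density[OF \<sigma>])
    finally show ?thesis .
  qed
  have "distr M borel U = density lborel (\<lambda>x. ennreal (\<Prod>b\<in>Basis. normal_density 0 \<sigma> (x \<bullet> b)))" (is "?L = ?R")
  proof (rule measure_eqI_generator_eq)
    let ?E = "range (\<lambda>(a, b). box a b::'b set)"
    show "Int_stable ?E" by (auto simp: Int_stable_def box_Int_box)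
    show "?E \<subseteq> Pow UNIV" "sets ?L = sigma_sets UNIV ?E" "sets ?R = sigma_sets UNIV ?E"
      by (simp_all add: borel_eq_box)
    let ?A = "\<lambda>n::nat. box (- (real n *\<^sub>R One)) (real n *\<^sub>R One) :: 'b set"
    show "range ?A \<subseteq> ?E" "(\<Union>i. ?A i) = UNIV"
      unfolding UN_box_eq_UNIV by auto
    interpret L: prob_space ?L by (rule prob_space_distr) measurable
    show "emeasure ?L (?A i) \<noteq> \<infinity>" for i by simp
    fix B assume "B \<in> ?E"
    then obtain l u where B: "B = box l u" by auto
    have "emeasure ?L B = emeasure M {\<omega>\<in>space M. \<forall>b\<in>Basis. U \<omega> \<bullet> b \<in> {l \<bullet> b <..< u \<bullet> b}}"
      by (subst emeasure_distr) (auto simp: B box_def intro!: arg_cong[where f = "emeasure M"])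
    also have "\<dots> = ennreal (\<Prod>b\<in>Basis. measure N {l \<bullet> b <..< u \<bullet> b})"
      unfolding emeasure_eq_measure
      by (subst prob_eq_prod_of_joint_char[where N = "\<lambda>_. N", OF finite_Basis _ N joint]) auto
    also have "\<dots> = (\<Prod>b\<in>Basis. emeasure N {l \<bullet> b <..< u \<bullet> b})"
    proof -
      interpret N: real_distribution N by (rule N)
      show ?thesis by (simp add: N.emeasure_eq_measure prod_ennreal)
    qed
    also have "\<dots> = (\<Prod>b\<in>Basis. \<integral>\<^sup>+x. ennreal (normal_density 0 \<sigma> x) * indicator {l \<bullet> b <..< u \<bullet> b} x \<partial>lborel)"
      by (simp add: N_def emeasure_density)
    also have "\<dots> = (\<integral>\<^sup>+x. (\<Prod>b\<in>Basis. ennreal (normal_density 0 \<sigma> (x \<bullet> b)) * indicator {l \<bullet> b <..< u \<bullet> b} (x \<bullet> b)) \<partial>lborel)"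
      by (subst nn_integral_lborel_prod) auto
    also have "\<dots> = (\<integral>\<^sup>+x. ennreal (\<Prod>b\<in>Basis. normal_density 0 \<sigma> (x \<bullet> b)) * indicator B x \<partial>lborel)"
      by (intro nn_integral_cong)
         (auto simp: prod.distrib prod_ennreal B box_def indicator_def intro!: prod_zero)
    also have "\<dots> = emeasure ?R B"
      by (simp add: emeasure_density B)
    finally show "emeasure ?L B = emeasure ?R B" .
  qed
  then show ?thesis unfolding distributed_def by (simp cong: distr_cong)
qed

section \<open>Polar coordinates\<close>

lemma lborel_complex: "lborel = distr (lborel \<Otimes>\<^sub>M lborel) borel (\<lambda>(x, y). Complex x y)"
proof (rule lborel_eqI)
  have [measurable]: "(\<lambda>(x, y). Complex x y) \<in> borel_measurable (lborel \<Otimes>\<^sub>M lborel)"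
    by (simp add: Complex_eq split_def)
  fix l u :: complex assume le: "\<And>b. b \<in> Basis \<Longrightarrow> l \<bullet> b \<le> u \<bullet> b"
  have "emeasure (distr (lborel \<Otimes>\<^sub>M lborel) borel (\<lambda>(x, y). Complex x y)) (box l u) =
      emeasure (lborel \<Otimes>\<^sub>M lborel) ({Re l <..< Re u} \<times> {Im l <..< Im u})"
    by (subst emeasure_distr)
       (auto simp: box_def Basis_complex_def inner_complex_def space_pair_measure
         intro!: arg_cong[where f = "emeasure (lborel \<Otimes>\<^sub>M lborel)"])
  also have "\<dots> = ennreal ((Re u - Re l) * (Im u - Im l))"
    using le[of 1] le[of \<i>] by (subst lborel.emeasure_pair_measure_Times)
      (simp_all add: Basis_complex_def inner_complex_def ennreal_mult)
  also have "\<dots> = (\<Prod>b\<in>Basis. (u - l) \<bullet> b)"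
    by (simp add: Basis_complex_def inner_complex_def)
  finally show "emeasure (distr (lborel \<Otimes>\<^sub>M lborel) borel (\<lambda>(x, y). Complex x y)) (box l u)
      = (\<Prod>b\<in>Basis. (u - l) \<bullet> b)" .
qed simp

lemma measurable_Complex [measurable (raw)]:
  assumes "f \<in> borel_measurable M" "g \<in> borel_measurable M"
  shows "(\<lambda>x. Complex (f x) (g x)) \<in> borel_measurable M"
  unfolding Complex_eq using assms by measurable

lemma measurable_rcis [measurable (raw)]:
  assumes "f \<in> borel_measurable M" "g \<in> borel_measurable M"
  shows "(\<lambda>x. rcis (f x) (g x)) \<in> borel_measurable M"
  unfolding rcis_def cis_conv_exp using assms by measurable

text \<open>The interval \<open>[- (n + 1), n + 1]\<close> is the image under \<open>tan\<close> of a compact interval, on which the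
ordinary substitution rule holds; both sides are the suprema over \<open>n\<close>.\<close>

lemma nn_integral_tan_substitution:
  fixes g :: "real \<Rightarrow> ennreal"
  assumes [measurable]: "g \<in> borel_measurable borel"
  shows "(\<integral>\<^sup>+y. g y \<partial>lborel) =
    (\<integral>\<^sup>+\<phi>. g (tan \<phi>) * ennreal (inverse ((cos \<phi>)\<^sup>2)) * indicator {-(pi/2)<..<pi/2} \<phi> \<partial>lborel)"
proof -
  let ?a = "\<lambda>n::nat. arctan (real (Suc n))" and ?k = "\<lambda>\<phi>. g (tan \<phi>) * ennreal (inverse ((cos \<phi>)\<^sup>2))"
  let ?R = "\<lambda>n::nat. {- real (Suc n)..real (Suc n)}" and ?A = "\<lambda>n. {- ?a n..?a n}" and ?J = "{-(pi/2)<..<pi/2}"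
  have a: "0 < ?a n" "?a n < pi / 2" for n
    by (simp add: zero_less_arctan_iff) (rule arctan_ubound)
  have "incseq (\<lambda>n y. g y * indicator (?R n) y)"
    by (auto simp: incseq_def le_fun_def indicator_def)
  then have A: "(\<integral>\<^sup>+y. (SUP n. g y * indicator (?R n) y) \<partial>lborel)
      = (SUP n. \<integral>\<^sup>+y. g y * indicator (?R n) y \<partial>lborel)"
    by (intro nn_integral_monotone_convergence_SUP) auto
  have B: "(\<lambda>y. SUP n. g y * indicator (?R n) y) = g"
  proof (intro ext antisym SUP_least)
    fix y
    obtain n where "\<bar>y\<bar> \<le> real n" using real_arch_simple by blast
    then have "g y \<le> g y * indicator (?R n) y" by (auto simp: indicator_def)
    also have "\<dots> \<le> (SUP n. g y * indicator (?R n) y)"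
      by (rule SUP_upper) simp
    finally show "g y \<le> (SUP n. g y * indicator (?R n) y)" .
  qed (auto simp: indicator_def)
  have C: "(\<integral>\<^sup>+y. g y * indicator (?R n) y \<partial>lborel) =
      (\<integral>\<^sup>+\<phi>. ?k \<phi> * indicator (?A n) \<phi> \<partial>lborel)" for n
  proof -
    have cos: "cos \<phi> > 0" if "\<phi> \<in> (?A n)" for \<phi>
      using that a[of n] by (intro cos_gt_zero_pi) auto
    have "(\<integral>\<^sup>+y. g y * indicator {tan (- ?a n)..tan (?a n)} y \<partial>lborel) =
      (\<integral>\<^sup>+\<phi>. ?k \<phi> * indicator (?A n) \<phi> \<partial>lborel)"
    proof (rule nn_integral_substitution_aux)
      show "(tan has_real_derivative inverse ((cos \<phi>)\<^sup>2)) (at \<phi>)" if "\<phi> \<in> (?A n)" for \<phi>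
        using cos[OF that] by (intro DERIV_tan) auto
      show "continuous_on (?A n) (\<lambda>\<phi>. inverse ((cos \<phi>)\<^sup>2))"
        using cos by (intro continuous_intros) force
    qed (use a[of n] in auto)
    then show ?thesis by (simp add: tan_arctan)
  qed
  have D: "(SUP n. \<integral>\<^sup>+\<phi>. ?k \<phi> * indicator (?A n) \<phi> \<partial>lborel) =
      (\<integral>\<^sup>+\<phi>. (SUP n. ?k \<phi> * indicator (?A n) \<phi>) \<partial>lborel)"
  proof (rule nn_integral_monotone_convergence_SUP[symmetric])
    have "?a m \<le> ?a n" if "m \<le> n" for m n using that by (simp add: arctan_le_iff)
    then show "incseq (\<lambda>n \<phi>. ?k \<phi> * indicator (?A n) \<phi>)"
      unfolding incseq_def le_fun_def
      by (intro allI impI mult_left_mono zero_le) (simp add: indicator_def, meson neg_le_iff_le order_trans)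
    have [measurable]: "(tan :: real \<Rightarrow> real) \<in> borel_measurable borel"
      unfolding tan_def by measurable
    show "(\<lambda>\<phi>. ?k \<phi> * indicator (?A n) \<phi>) \<in> borel_measurable lborel" for n
      by measurable
  qed
  have E: "(\<lambda>\<phi>. SUP n. ?k \<phi> * indicator (?A n) \<phi>) =
      (\<lambda>\<phi>. ?k \<phi> * indicator ?J \<phi>)"
  proof (intro ext antisym SUP_least)
    fix \<phi> :: real
    show "?k \<phi> * indicator ?J \<phi> \<le>
      (SUP n. ?k \<phi> * indicator (?A n) \<phi>)"
    proof (cases "\<phi> \<in> ?J")
      case True
      obtain n where n: "\<bar>tan \<phi>\<bar> \<le> real n" using real_arch_simple by blast
      have "\<phi> = arctan (tan \<phi>)" using True by (simp add: arctan_tan)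
      also have "\<dots> \<le> ?a n" using n by (subst arctan_le_iff) auto
      finally have 1: "\<phi> \<le> ?a n" .
      have "- ?a n = arctan (- real (Suc n))" by (simp only: arctan_minus)
      also have "\<dots> \<le> arctan (tan \<phi>)" using n by (subst arctan_le_iff) auto
      also have "\<dots> = \<phi>" using True by (simp add: arctan_tan)
      finally have "\<phi> \<in> (?A n)" using 1 by auto
      then have "?k \<phi> * indicator ?J \<phi> \<le>
        ?k \<phi> * indicator (?A n) \<phi>"
        using True by simp
      also have "\<dots> \<le> (SUP n. ?k \<phi> * indicator (?A n) \<phi>)"
        by (rule SUP_upper) simp
      finally show ?thesis .
    qed simp
    fix n
    show "?k \<phi> * indicator (?A n) \<phi> \<le>
        ?k \<phi> * indicator ?J \<phi>"
      using a[of n] by (intro mult_left_mono) (auto simp: indicator_def)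
  qed
  show ?thesis using A unfolding B C D E .
qed

text \<open>Two substitutions in one variable: \<open>y = x tan \<phi>\<close> for fixed \<open>x\<close> and then, after the integrals are
exchanged, \<open>x = r cos \<phi>\<close> for fixed \<open>\<phi>\<close>. The factors \<open>x / (cos \<phi>)^2\<close> and \<open>cos \<phi>\<close> leave \<open>r\<close>.\<close>

lemma nn_integral_half_plane_polar:
  fixes f :: "complex \<Rightarrow> ennreal"
  assumes [measurable]: "f \<in> borel_measurable borel"
  shows "(\<integral>\<^sup>+x. \<integral>\<^sup>+y. f (Complex x y) * indicator {0<..} x \<partial>lborel \<partial>lborel) =
    (\<integral>\<^sup>+\<phi>. \<integral>\<^sup>+r. ennreal r * f (rcis r \<phi>) * indicator {0<..} r * indicator {-(pi/2)<..<pi/2} \<phi> \<partial>lborel \<partial>lborel)"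
proof -
  have [measurable]: "(tan :: real \<Rightarrow> real) \<in> borel_measurable borel"
    unfolding tan_def by measurable
  let ?J = "indicator {-(pi/2)<..<pi/2} :: real \<Rightarrow> ennreal" and ?H = "indicator {0<..} :: real \<Rightarrow> ennreal"
  let ?s = "\<lambda>\<phi>::real. ennreal (inverse ((cos \<phi>)\<^sup>2))"
  have "(\<integral>\<^sup>+y. f (Complex x y) * ?H x \<partial>lborel) =
      (\<integral>\<^sup>+\<phi>. ennreal x * f (Complex x (x * tan \<phi>)) * ?H x * ?s \<phi> * ?J \<phi> \<partial>lborel)" for x
  proof (cases "x > 0")
    case True
    have "(\<integral>\<^sup>+y. f (Complex x y) * ?H x \<partial>lborel) = ennreal x * (\<integral>\<^sup>+t. f (Complex x (x * t)) * ?H x \<partial>lborel)"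
      using True by (subst nn_integral_real_affine[where c = x and t = 0]) auto
    also have "\<dots> = ennreal x * (\<integral>\<^sup>+\<phi>. f (Complex x (x * tan \<phi>)) * ?H x * ?s \<phi> * ?J \<phi> \<partial>lborel)"
      by (subst nn_integral_tan_substitution) auto
    also have "\<dots> = (\<integral>\<^sup>+\<phi>. ennreal x * (f (Complex x (x * tan \<phi>)) * ?H x * ?s \<phi> * ?J \<phi>) \<partial>lborel)"
      by (rule nn_integral_cmult[symmetric]) measurable
    finally show ?thesis by (simp add: mult.assoc)
  qed simp
  then have "(\<integral>\<^sup>+x. \<integral>\<^sup>+y. f (Complex x y) * ?H x \<partial>lborel \<partial>lborel) =
      (\<integral>\<^sup>+x. \<integral>\<^sup>+\<phi>. ennreal x * f (Complex x (x * tan \<phi>)) * ?H x * ?s \<phi> * ?J \<phi> \<partial>lborel \<partial>lborel)"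
    by simp
  also have "\<dots> = (\<integral>\<^sup>+\<phi>. \<integral>\<^sup>+x. ennreal x * f (Complex x (x * tan \<phi>)) * ?H x * ?s \<phi> * ?J \<phi> \<partial>lborel \<partial>lborel)"
    by (rule lborel_pair.Fubini') measurable
  also have "\<dots> = (\<integral>\<^sup>+\<phi>. \<integral>\<^sup>+r. ennreal r * f (rcis r \<phi>) * ?H r * ?J \<phi> \<partial>lborel \<partial>lborel)"
  proof (rule nn_integral_cong)
    fix \<phi> :: real
    show "(\<integral>\<^sup>+x. ennreal x * f (Complex x (x * tan \<phi>)) * ?H x * ?s \<phi> * ?J \<phi> \<partial>lborel) =
      (\<integral>\<^sup>+r. ennreal r * f (rcis r \<phi>) * ?H r * ?J \<phi> \<partial>lborel)"
    proof (cases "\<phi> \<in> {-(pi/2)<..<pi/2}")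
      case True
      then have c: "cos \<phi> > 0" by (intro cos_gt_zero_pi) auto
      have "(\<integral>\<^sup>+x. ennreal x * f (Complex x (x * tan \<phi>)) * ?H x * ?s \<phi> * ?J \<phi> \<partial>lborel) =
        ennreal (cos \<phi>) * (\<integral>\<^sup>+r. ennreal (cos \<phi> * r) * f (Complex (cos \<phi> * r) (cos \<phi> * r * tan \<phi>)) * ?H (cos \<phi> * r) * ?s \<phi> * ?J \<phi> \<partial>lborel)"
        using c by (subst nn_integral_real_affine[where c = "cos \<phi>" and t = 0]) auto
      also have "\<dots> = (\<integral>\<^sup>+r. ennreal (cos \<phi>) * (ennreal (cos \<phi> * r) * f (Complex (cos \<phi> * r) (cos \<phi> * r * tan \<phi>)) * ?H (cos \<phi> * r) * ?s \<phi> * ?J \<phi>) \<partial>lborel)"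
        by (rule nn_integral_cmult[symmetric]) measurable
      also have "\<dots> = (\<integral>\<^sup>+r. ennreal r * f (rcis r \<phi>) * ?H r * ?J \<phi> \<partial>lborel)"
      proof (rule nn_integral_cong)
        fix r :: real
        have 1: "Complex (cos \<phi> * r) (cos \<phi> * r * tan \<phi>) = rcis r \<phi>"
          using c by (simp add: complex_eq_iff tan_def)
        have 2: "?H (cos \<phi> * r) = ?H r"
          using c by (simp add: indicator_def zero_less_mult_iff)
        have 3: "ennreal (cos \<phi>) * (ennreal (cos \<phi> * r) * ?s \<phi>) = ennreal r" if "r > 0"
          using c that by (simp add: power2_eq_square field_simps flip: ennreal_mult)
        show "ennreal (cos \<phi>) * (ennreal (cos \<phi> * r) * f (Complex (cos \<phi> * r) (cos \<phi> * r * tan \<phi>)) * ?H (cos \<phi> * r) * ?s \<phi> * ?J \<phi>)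
            = ennreal r * f (rcis r \<phi>) * ?H r * ?J \<phi>"
        proof (cases "r > 0")
          case True
          have "ennreal (cos \<phi>) * (ennreal (cos \<phi> * r) * F * h * ?s \<phi> * j) =
              (ennreal (cos \<phi>) * (ennreal (cos \<phi> * r) * ?s \<phi>)) * F * h * j" for F h j :: ennreal
            by (simp only: mult_ac)
          then show ?thesis by (simp only: 1 2 3[OF True])
        qed (simp add: 2)
      qed
      finally show ?thesis .
    qed simp
  qed
  finally show ?thesis .
qed

text \<open>The upper and the lower half plane are the images of the right half plane under multiplication by
\<open>\<i>\<close> and \<open>- \<i>\<close>. Cut in this way, the plane has the angles \<open>(0, \<pi>)\<close> and \<open>(\<pi>, 2 \<pi>)\<close>, and no
angle has to be reduced modulo \<open>2 \<pi>\<close>.\<close>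

lemma nn_integral_polar:
  fixes f :: "complex \<Rightarrow> ennreal"
  assumes [measurable]: "f \<in> borel_measurable borel"
  shows "(\<integral>\<^sup>+z. f z \<partial>lborel) =
    (\<integral>\<^sup>+r. \<integral>\<^sup>+\<theta>. ennreal r * f (rcis r \<theta>) * indicator {0..} r * indicator {0..2*pi} \<theta> \<partial>lborel \<partial>lborel)"
proof -
  let ?g = "\<lambda>r \<theta>. ennreal r * f (rcis r \<theta>) * indicator {0<..} r"
  let ?h = "\<lambda>F. \<integral>\<^sup>+x. \<integral>\<^sup>+y. F x y * indicator {0<..} x \<partial>lborel \<partial>lborel"
  have half: "(?h (\<lambda>x y. f (u * Complex x y))) =
    (\<integral>\<^sup>+\<theta>. \<integral>\<^sup>+r. ?g r \<theta> * indicator {\<alpha>-pi/2<..<\<alpha>+pi/2} \<theta> \<partial>lborel \<partial>lborel)"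
    if u: "u = cis \<alpha>" for u \<alpha>
  proof -
    have "(\<integral>\<^sup>+\<theta>. \<integral>\<^sup>+r. ?g r \<theta> * indicator {\<alpha>-pi/2<..<\<alpha>+pi/2} \<theta> \<partial>lborel \<partial>lborel)
      = (\<integral>\<^sup>+\<phi>. \<integral>\<^sup>+r. ennreal r * f (rcis r (\<alpha> + \<phi>)) * indicator {0<..} r * indicator {\<alpha>-pi/2<..<\<alpha>+pi/2} (\<alpha> + \<phi>) \<partial>lborel \<partial>lborel)"
      by (subst nn_integral_real_affine[where c = 1 and t = \<alpha>]) auto
    also have "\<dots> = (\<integral>\<^sup>+\<phi>. \<integral>\<^sup>+r. ennreal r * f (u * rcis r \<phi>) * indicator {0<..} r * indicator {-(pi/2)<..<pi/2} \<phi> \<partial>lborel \<partial>lborel)"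
      by (intro nn_integral_cong) (auto simp: u rcis_def cis_mult mult_ac indicator_def simp flip: cis_mult)
    also have "\<dots> = (?h (\<lambda>x y. f (u * Complex x y)))"
      by (rule nn_integral_half_plane_polar[symmetric]) measurable
    finally show ?thesis ..
  qed
  have 1: "(\<integral>\<^sup>+x. \<integral>\<^sup>+y. f (\<i> * Complex x y) * indicator {0<..} x \<partial>lborel \<partial>lborel) =
      (\<integral>\<^sup>+y. \<integral>\<^sup>+x. f (Complex x y) * indicator {0<..} y \<partial>lborel \<partial>lborel)"
  proof (rule nn_integral_cong)
    fix x
    have "(\<integral>\<^sup>+y. f (Complex y x) * indicator {0<..} x \<partial>lborel) = (\<integral>\<^sup>+y. f (Complex (- y) x) * indicator {0<..} x \<partial>lborel)"
      by (subst nn_integral_real_affine[where c = "-1" and t = 0]) auto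
    then show "(\<integral>\<^sup>+y. f (\<i> * Complex x y) * indicator {0<..} x \<partial>lborel) = (\<integral>\<^sup>+y. f (Complex y x) * indicator {0<..} x \<partial>lborel)"
      by (simp add: complex_eq_iff Complex_eq algebra_simps)
  qed
  have 2: "(\<integral>\<^sup>+x. \<integral>\<^sup>+y. f (- \<i> * Complex x y) * indicator {0<..} x \<partial>lborel \<partial>lborel) =
      (\<integral>\<^sup>+y. \<integral>\<^sup>+x. f (Complex x y) * indicator {..<0} y \<partial>lborel \<partial>lborel)"
  proof -
    have "(\<integral>\<^sup>+y. \<integral>\<^sup>+x. f (Complex x y) * indicator {..<0} y \<partial>lborel \<partial>lborel) =
        (\<integral>\<^sup>+y. \<integral>\<^sup>+x. f (Complex x (- y)) * indicator {..<0} (- y) \<partial>lborel \<partial>lborel)"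
      by (subst nn_integral_real_affine[where c = "-1" and t = 0]) auto
    also have "\<dots> = (\<integral>\<^sup>+x. \<integral>\<^sup>+y. f (- \<i> * Complex x y) * indicator {0<..} x \<partial>lborel \<partial>lborel)"
      by (simp add: Complex_eq algebra_simps indicator_def)
    finally show ?thesis ..
  qed
  have "(\<integral>\<^sup>+z. f z \<partial>lborel) = (\<integral>\<^sup>+p. f (Complex (fst p) (snd p)) \<partial>(lborel \<Otimes>\<^sub>M lborel))"
    by (subst lborel_complex, subst nn_integral_distr) (auto simp: split_def)
  also have "\<dots> = (\<integral>\<^sup>+y. \<integral>\<^sup>+x. f (Complex x y) \<partial>lborel \<partial>lborel)"
    by (subst lborel_pair.nn_integral_snd[symmetric]) auto
  also have "\<dots> = (\<integral>\<^sup>+y. (\<integral>\<^sup>+x. f (Complex x y) * indicator {0<..} y \<partial>lborel) + (\<integral>\<^sup>+x. f (Complex x y) * indicator {..<0} y \<partial>lborel) \<partial>lborel)"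
    by (rule nn_integral_cong_AE, rule AE_mp[OF AE_lborel_singleton[of 0]]) (auto simp: indicator_def)
  also have "\<dots> = (\<integral>\<^sup>+y. \<integral>\<^sup>+x. f (Complex x y) * indicator {0<..} y \<partial>lborel \<partial>lborel) +
      (\<integral>\<^sup>+y. \<integral>\<^sup>+x. f (Complex x y) * indicator {..<0} y \<partial>lborel \<partial>lborel)"
    by (rule nn_integral_add) measurable
  also have "\<dots> = (\<integral>\<^sup>+\<theta>. \<integral>\<^sup>+r. ?g r \<theta> * indicator {pi/2-pi/2<..<pi/2+pi/2} \<theta> \<partial>lborel \<partial>lborel) +
      (\<integral>\<^sup>+\<theta>. \<integral>\<^sup>+r. ?g r \<theta> * indicator {3*pi/2-pi/2<..<3*pi/2+pi/2} \<theta> \<partial>lborel \<partial>lborel)"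
  proof -
    have c: "cis (3 * pi / 2) = - \<i>"
    proof -
      have "cis (3 * pi / 2) = cis (pi + pi / 2)" by (rule arg_cong[where f = cis]) (simp add: field_simps)
      then show ?thesis by (simp only: cis_mult[symmetric]) simp
    qed
    show ?thesis unfolding 1[symmetric] 2[symmetric]
      by (intro arg_cong2[where f = "(+)"] half) (simp_all add: c)
  qed
  also have "\<dots> = (\<integral>\<^sup>+\<theta>. (\<integral>\<^sup>+r. ?g r \<theta> * indicator {0<..<pi} \<theta> \<partial>lborel) +
      (\<integral>\<^sup>+r. ?g r \<theta> * indicator {pi<..<2*pi} \<theta> \<partial>lborel) \<partial>lborel)"
  proof -
    have "pi/2-pi/2 = 0" "pi/2+pi/2 = pi" "3*pi/2-pi/2 = pi" "3*pi/2+pi/2 = 2*pi" by auto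
    then show ?thesis by (simp only:) (rule nn_integral_add[symmetric]; measurable)
  qed
  also have "\<dots> = (\<integral>\<^sup>+\<theta>. \<integral>\<^sup>+r. ennreal r * f (rcis r \<theta>) * indicator {0..} r * indicator {0..2*pi} \<theta> \<partial>lborel \<partial>lborel)"
  proof (rule nn_integral_cong_AE)
    have "AE \<theta>::real in lborel. \<theta> \<noteq> 0 \<and> \<theta> \<noteq> pi \<and> \<theta> \<noteq> 2 * pi"
      by (intro AE_conjI AE_lborel_singleton)
    then show "AE \<theta> in lborel. (\<integral>\<^sup>+r. ?g r \<theta> * indicator {0<..<pi} \<theta> \<partial>lborel) +
      (\<integral>\<^sup>+r. ?g r \<theta> * indicator {pi<..<2*pi} \<theta> \<partial>lborel) =
      (\<integral>\<^sup>+r. ennreal r * f (rcis r \<theta>) * indicator {0..} r * indicator {0..2*pi} \<theta> \<partial>lborel)"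
    proof eventually_elim
      case (elim \<theta>)
      have H: "?g r \<theta> = ennreal r * f (rcis r \<theta>) * indicator {0..} r" for r
        by (auto simp: indicator_def)
      show ?case unfolding H using elim by (auto simp: indicator_def)
    qed
  qed
  also have "\<dots> = (\<integral>\<^sup>+r. \<integral>\<^sup>+\<theta>. ennreal r * f (rcis r \<theta>) * indicator {0..} r * indicator {0..2*pi} \<theta> \<partial>lborel \<partial>lborel)"
    by (rule lborel_pair.Fubini') measurable
  finally show ?thesis .
qed

definition polar_point :: "real^'n \<Rightarrow> real^'n \<Rightarrow> complex^'n" where
  "polar_point r \<theta> = (\<chi> i. rcis (r $ i) (\<theta> $ i))"

text \<open>The Jacobian of polar coordinates in every component, set to zero outside their range.\<close>

definition polar_weight :: "real^'n \<Rightarrow> real^'n \<Rightarrow> ennreal" where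
  "polar_weight r \<theta> = (\<Prod>i\<in>UNIV. ennreal (r $ i) * indicator {0..} (r $ i) * indicator {0..2*pi} (\<theta> $ i))"

definition modulus_density :: "(complex^'n \<Rightarrow> real) \<Rightarrow> real^'n \<Rightarrow> real" where
  "modulus_density p r = (if \<forall>l. 0 \<le> r $ l
     then (\<Prod>l\<in>UNIV. r $ l) * (LBINT \<theta>:cbox 0 (\<chi> l. 2 * pi). p (\<chi> l. rcis (r $ l) (\<theta> $ l))) else 0)"

lemma measurable_polar [measurable (raw)]:
  fixes f g :: "'a \<Rightarrow> real^'n"
  assumes [measurable]: "f \<in> borel_measurable M" "g \<in> borel_measurable M"
  shows "(\<lambda>x. polar_point (f x) (g x)) \<in> borel_measurable M"
    and "(\<lambda>x. polar_weight (f x) (g x)) \<in> borel_measurable M"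
  unfolding polar_point_def polar_weight_def by measurable

lemma modulus_vector_polar_point: "(\<And>i. 0 \<le> r $ i) \<Longrightarrow> modulus_vector (polar_point r \<theta>) = r"
  by (simp add: modulus_vector_def polar_point_def vec_eq_iff)

lemma polar_weight_eq_0: "\<not> (\<forall>l. 0 \<le> r $ l) \<Longrightarrow> polar_weight r \<theta> = 0"
proof -
  assume "\<not> (\<forall>l. 0 \<le> r $ l)"
  then obtain l where "\<not> 0 \<le> r $ l" by auto
  then show ?thesis unfolding polar_weight_def by (intro prod_zero[OF _ bexI[of _ l]]) auto
qed

text \<open>Both sides are integrals with respect to measures on complex vectors, and it is enough to compare
these measures on boxes. The indicator of a box is a product over the components, so that the plane
formula applies to each factor.\<close>

lemma nn_integral_vec_polar:
  fixes f :: "complex ^ 'n \<Rightarrow> ennreal"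
  assumes [measurable]: "f \<in> borel_measurable borel"
  shows "(\<integral>\<^sup>+z. f z \<partial>lborel) =
    (\<integral>\<^sup>+r. \<integral>\<^sup>+\<theta>. polar_weight r \<theta> * f (polar_point r \<theta>) \<partial>lborel \<partial>lborel)"
proof -
  let ?w = "\<lambda>(r :: real^'n, \<theta> :: real^'n). polar_weight r \<theta>"
  let ?T = "\<lambda>(r :: real^'n, \<theta> :: real^'n). polar_point r \<theta>"
  let ?N = "distr (density (lborel \<Otimes>\<^sub>M lborel) ?w) borel ?T"
  have T[measurable]: "?T \<in> borel_measurable (lborel \<Otimes>\<^sub>M lborel)"
    and w[measurable]: "?w \<in> borel_measurable (lborel \<Otimes>\<^sub>M lborel)"
    by measurable
  have int: "(\<integral>\<^sup>+z. g z \<partial>?N) = (\<integral>\<^sup>+r. \<integral>\<^sup>+\<theta>. ?w (r, \<theta>) * g (?T (r, \<theta>)) \<partial>lborel \<partial>lborel)"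
    if [measurable]: "g \<in> borel_measurable borel" for g
  proof -
    have "(\<integral>\<^sup>+z. g z \<partial>?N) = (\<integral>\<^sup>+p. ?w p * g (?T p) \<partial>(lborel \<Otimes>\<^sub>M lborel))"
      by (subst nn_integral_distr, simp, simp, subst nn_integral_density) measurable
    also have "\<dots> = (\<integral>\<^sup>+r. \<integral>\<^sup>+\<theta>. ?w (r, \<theta>) * g (?T (r, \<theta>)) \<partial>lborel \<partial>lborel)"
      by (rule lborel.nn_integral_fst[symmetric]) measurable
    finally show ?thesis .
  qed
  have "lborel = ?N"
  proof (rule lborel_eqI)
    fix l u :: "complex ^ 'n" assume le: "\<And>b. b \<in> Basis \<Longrightarrow> l \<bullet> b \<le> u \<bullet> b"
    let ?b = "\<lambda>i. box (l $ i) (u $ i)"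
    have box: "indicator (box l u) z = (\<Prod>i\<in>UNIV. indicator (?b i) (z $ i) :: ennreal)" for z
    proof -
      have "z \<in> box l u \<longleftrightarrow> (\<forall>i. z $ i \<in> ?b i)"
        by (auto simp: box_def Basis_vec_def inner_axis)
      then show ?thesis by (auto simp: indicator_def intro!: prod_zero)
    qed
    have "emeasure ?N (box l u) = (\<integral>\<^sup>+z. indicator (box l u) z \<partial>?N)" by simp
    also have "\<dots> = (\<integral>\<^sup>+r. \<integral>\<^sup>+\<theta>. (\<Prod>i\<in>UNIV. ennreal (r $ i) * indicator {0..} (r $ i) * indicator {0..2*pi} (\<theta> $ i) *
        indicator (?b i) (rcis (r $ i) (\<theta> $ i))) \<partial>lborel \<partial>lborel)"
      by (subst int) (simp_all add: box prod.distrib polar_weight_def polar_point_def)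
    also have "\<dots> = (\<integral>\<^sup>+r. (\<Prod>i\<in>UNIV. \<integral>\<^sup>+\<theta>. ennreal (r $ i) * indicator {0..} (r $ i) * indicator {0..2*pi} \<theta> *
        indicator (?b i) (rcis (r $ i) \<theta>) \<partial>lborel) \<partial>lborel)"
      by (intro nn_integral_cong nn_integral_lborel_vec_prod) measurable
    also have "\<dots> = (\<Prod>i\<in>UNIV. \<integral>\<^sup>+r. \<integral>\<^sup>+\<theta>. ennreal r * indicator {0..} r * indicator {0..2*pi} \<theta> *
        indicator (?b i) (rcis r \<theta>) \<partial>lborel \<partial>lborel)"
      by (rule nn_integral_lborel_vec_prod) measurable
    also have "\<dots> = (\<Prod>i\<in>UNIV. \<integral>\<^sup>+z. indicator (?b i) z \<partial>lborel)"
      by (intro prod.cong refl, subst nn_integral_polar) (auto simp: mult_ac)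
    also have "\<dots> = (\<integral>\<^sup>+z. indicator (box l u) z \<partial>lborel)"
      unfolding box by (rule nn_integral_lborel_vec_prod[symmetric]) measurable
    also have "\<dots> = (\<Prod>b\<in>Basis. (u - l) \<bullet> b)" using le by simp
    finally show "emeasure ?N (box l u) = (\<Prod>b\<in>Basis. (u - l) \<bullet> b)" .
  qed simp
  with int[OF assms] show ?thesis by simp
qed

text \<open>Continuity of \<open>p\<close> makes the angular integral over the compact cube finite, so that it can be read as
a nonnegative integral.\<close>

lemma ennreal_modulus_density:
  fixes p :: "complex ^ 'n \<Rightarrow> real"
  assumes p: "continuous_on UNIV p" and p0: "\<And>z. 0 \<le> p z"
  shows "0 \<le> modulus_density p r"
    "ennreal (modulus_density p r) = (\<integral>\<^sup>+\<theta>. polar_weight r \<theta> * ennreal (p (polar_point r \<theta>)) \<partial>lborel)"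
proof -
  have [measurable]: "p \<in> borel_measurable borel" by (rule borel_measurable_continuous_onI[OF p])
  let ?B = "cbox 0 (\<chi> l. 2 * pi) :: (real^'n) set" and ?p = "\<lambda>\<theta>. p (\<chi> l. rcis (r $ l) (\<theta> $ l))"
  have int: "set_integrable lborel ?B ?p"
    unfolding set_integrable_def
    by (rule borel_integrable_compact, simp)
       (auto intro!: continuous_intros continuous_on_compose2[OF p] continuous_on_vec_lambda simp: rcis_def cis_conv_exp)
  have I0: "0 \<le> (LBINT \<theta>:?B. ?p \<theta>)"
    using p0 unfolding set_lebesgue_integral_def by (intro Bochner_Integration.integral_nonneg) auto
  then show "0 \<le> modulus_density p r"
    by (auto simp: modulus_density_def intro!: mult_nonneg_nonneg prod_nonneg)
  show "ennreal (modulus_density p r) = (\<integral>\<^sup>+\<theta>. polar_weight r \<theta> * ennreal (p (polar_point r \<theta>)) \<partial>lborel)"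
  proof (cases "\<forall>l. 0 \<le> r $ l")
    case True
    have "\<theta> \<in> ?B \<longleftrightarrow> (\<forall>i. \<theta> $ i \<in> {0..2*pi})" for \<theta>
      by (auto simp: cbox_def Basis_vec_def inner_axis)
    then have ind: "(\<Prod>i\<in>UNIV. indicator {0..2*pi} (\<theta> $ i) :: ennreal) = indicator ?B \<theta>" for \<theta>
      by (auto simp: indicator_def intro!: prod_zero)
    have "ennreal (modulus_density p r) = ennreal (\<Prod>l\<in>UNIV. r $ l) * ennreal (LBINT \<theta>:?B. ?p \<theta>)"
      using True I0 by (simp add: modulus_density_def ennreal_mult[OF prod_nonneg])
    also have "ennreal (LBINT \<theta>:?B. ?p \<theta>) = (\<integral>\<^sup>+\<theta>. ennreal (indicator ?B \<theta> * ?p \<theta>) \<partial>lborel)"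
      using int p0 unfolding set_integrable_def set_lebesgue_integral_def
      by (subst nn_integral_eq_integral) auto
    also have "ennreal (\<Prod>l\<in>UNIV. r $ l) * \<dots> =
        (\<integral>\<^sup>+\<theta>. ennreal (\<Prod>l\<in>UNIV. r $ l) * ennreal (indicator ?B \<theta> * ?p \<theta>) \<partial>lborel)"
      by (rule nn_integral_cmult[symmetric]) measurable
    also have "\<dots> = (\<integral>\<^sup>+\<theta>. polar_weight r \<theta> * ennreal (p (polar_point r \<theta>)) \<partial>lborel)"
    proof (intro nn_integral_cong)
      fix \<theta> :: "real^'n"
      have "polar_weight r \<theta> = (\<Prod>i\<in>UNIV. ennreal (r $ i) * indicator {0..2*pi} (\<theta> $ i))"
        unfolding polar_weight_def using True by (intro prod.cong) auto
      also have "\<dots> = ennreal (\<Prod>i\<in>UNIV. r $ i) * indicator ?B \<theta>"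
        using True by (simp only: prod.distrib ind) (simp add: prod_ennreal)
      finally show "ennreal (\<Prod>l\<in>UNIV. r $ l) * ennreal (indicator ?B \<theta> * ?p \<theta>) =
          polar_weight r \<theta> * ennreal (p (polar_point r \<theta>))"
        by (cases "\<theta> \<in> ?B") (auto simp: polar_point_def)
    qed
    finally show ?thesis .
  next
    case False
    then show ?thesis unfolding modulus_density_def if_not_P[OF False] polar_weight_eq_0[OF False] by simp
  qed
qed

lemma has_pdf_modulus_vector:
  fixes W :: "'w \<Rightarrow> complex ^ 'n" and p :: "complex ^ 'n \<Rightarrow> real"
  assumes W: "has_pdf M W p" and p: "continuous_on UNIV p"
  shows "has_pdf M (\<lambda>\<omega>. modulus_vector (W \<omega>)) (modulus_density p)"
proof -
  have p0: "0 \<le> p z" for z using W by (simp add: has_pdf_def)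
  have D: "distributed M lborel W (\<lambda>x. ennreal (p x))" using W by (simp add: has_pdf_def)
  have [measurable]: "p \<in> borel_measurable borel" by (rule borel_measurable_continuous_onI[OF p])
  have [measurable]: "W \<in> borel_measurable M" using distributed_measurable[OF D] by simp
  have mv[measurable]: "modulus_vector \<in> borel_measurable (borel :: (complex^'n) measure)"
    unfolding modulus_vector_def by measurable
  note q = ennreal_modulus_density[OF p p0]
  have qm: "(\<lambda>r. ennreal (modulus_density p r)) \<in> borel_measurable lborel"
    unfolding q(2) by measurable
  have "distr M lborel (\<lambda>\<omega>. modulus_vector (W \<omega>)) = density lborel (\<lambda>r. ennreal (modulus_density p r))"
  proof (rule measure_eqI)
    fix A :: "(real^'n) set" assume "A \<in> sets (distr M lborel (\<lambda>\<omega>. modulus_vector (W \<omega>)))"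
    then have A[measurable]: "A \<in> sets borel" by simp
    have "emeasure (distr M lborel (\<lambda>\<omega>. modulus_vector (W \<omega>))) A = (\<integral>\<^sup>+\<omega>. indicator A (modulus_vector (W \<omega>)) \<partial>M)"
      by (subst nn_integral_indicator[symmetric], simp, subst nn_integral_distr) auto
    also have "\<dots> = (\<integral>\<^sup>+z. ennreal (p z) * indicator A (modulus_vector z) \<partial>lborel)"
      by (rule distributed_nn_integral[OF D, symmetric]) measurable
    also have "\<dots> = (\<integral>\<^sup>+r. \<integral>\<^sup>+\<theta>. polar_weight r \<theta> *
        (ennreal (p (polar_point r \<theta>)) * indicator A (modulus_vector (polar_point r \<theta>))) \<partial>lborel \<partial>lborel)"
      by (rule nn_integral_vec_polar) measurable
    also have "\<dots> = (\<integral>\<^sup>+r. \<integral>\<^sup>+\<theta>. polar_weight r \<theta> * ennreal (p (polar_point r \<theta>)) * indicator A r \<partial>lborel \<partial>lborel)"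
    proof (intro nn_integral_cong)
      fix r \<theta> :: "real^'n"
      show "polar_weight r \<theta> * (ennreal (p (polar_point r \<theta>)) * indicator A (modulus_vector (polar_point r \<theta>))) =
        polar_weight r \<theta> * ennreal (p (polar_point r \<theta>)) * indicator A r"
      proof (cases "\<forall>l. 0 \<le> r $ l")
        case True
        then show ?thesis by (simp add: mult.assoc modulus_vector_polar_point)
      next
        case False
        show ?thesis by (simp only: polar_weight_eq_0[OF False] mult_zero_left)
      qed
    qed
    also have "\<dots> = (\<integral>\<^sup>+r. ennreal (modulus_density p r) * indicator A r \<partial>lborel)"
      unfolding q(2) by (intro nn_integral_cong nn_integral_multc) measurable
    also have "\<dots> = emeasure (density lborel (\<lambda>r. ennreal (modulus_density p r))) A"
      by (rule emeasure_density[symmetric, OF qm]) simp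
    finally show "emeasure (distr M lborel (\<lambda>\<omega>. modulus_vector (W \<omega>))) A =
      emeasure (density lborel (\<lambda>r. ennreal (modulus_density p r))) A" .
  qed simp
  then show ?thesis
    unfolding has_pdf_def distributed_def using q(1) qm by simp
qed

section \<open>The Rice density as an angular integral\<close>

lemma set_lborel_integral_Icc:
  fixes g :: "real \<Rightarrow> real"
  assumes "continuous_on {a..b} g"
  shows "(LBINT x:{a..b}. g x) = integral {a..b} g"
  by (rule set_borel_integral_eq_integral(2)) (rule borel_integrable_atLeastAtMost', fact)

text \<open>Integrate the derivative of \<open>cos^(k + 1) sin\<close>, shifted by \<open>\<phi>\<close>, over a full period. A phase costs
nothing here, so that the interval of integration never has to be shifted.\<close>

lemma cos_power_integral_step:
  "real (k + 2) * integral {0..2*pi} (\<lambda>\<theta>. cos (\<theta> - \<phi>) ^ (k + 2)) =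
   real (k + 1) * integral {0..2*pi} (\<lambda>\<theta>. cos (\<theta> - \<phi>) ^ k)"
proof -
  let ?G = "\<lambda>\<theta>. cos (\<theta> - \<phi>) ^ (k + 1) * sin (\<theta> - \<phi>)"
  let ?g = "\<lambda>\<theta>. real (k + 2) * cos (\<theta> - \<phi>) ^ (k + 2) - real (k + 1) * cos (\<theta> - \<phi>) ^ k"
  have "(?g has_integral ?G (2 * pi) - ?G 0) {0..2*pi}"
  proof (rule fundamental_theorem_of_calculus)
    fix \<theta> :: real
    have s: "(sin (\<theta> - \<phi>))\<^sup>2 = 1 - (cos (\<theta> - \<phi>))\<^sup>2" by (simp add: sin_squared_eq)
    have "(?G has_real_derivative
        cos (\<theta> - \<phi>) ^ (k + 1) * cos (\<theta> - \<phi>) - real (k + 1) * cos (\<theta> - \<phi>) ^ k * (sin (\<theta> - \<phi>))\<^sup>2)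
        (at \<theta> within {0..2*pi})"
      by (rule derivative_eq_intros refl | simp add: power2_eq_square algebra_simps)+
    also have "cos (\<theta> - \<phi>) ^ (k + 1) * cos (\<theta> - \<phi>) - real (k + 1) * cos (\<theta> - \<phi>) ^ k * (sin (\<theta> - \<phi>))\<^sup>2 = ?g \<theta>"
      unfolding s by (simp add: power2_eq_square algebra_simps)
    finally show "(?G has_vector_derivative ?g \<theta>) (at \<theta> within {0..2*pi})"
      by (simp add: has_real_derivative_iff_has_vector_derivative)
  qed simp
  moreover have "?G (2 * pi) - ?G 0 = 0"
    by (simp add: cos_diff sin_diff)
  ultimately have "integral {0..2*pi} ?g = 0" by (simp only: integral_unique)
  moreover have "integral {0..2*pi} ?g = real (k + 2) * integral {0..2*pi} (\<lambda>\<theta>. cos (\<theta> - \<phi>) ^ (k + 2)) -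
      real (k + 1) * integral {0..2*pi} (\<lambda>\<theta>. cos (\<theta> - \<phi>) ^ k)"
    by (subst Henstock_Kurzweil_Integration.integral_diff)
       (auto intro!: integrable_continuous_interval continuous_intros)
  ultimately show ?thesis by simp
qed

lemma cos_power_integral_even:
  "integral {0..2*pi} (\<lambda>\<theta>. cos (\<theta> - \<phi>) ^ (2 * k)) = 2 * pi * fact (2 * k) / (4 ^ k * (fact k)\<^sup>2)"
proof (induction k)
  case (Suc k)
  have S: "2 * Suc k = 2 * k + 2" by simp
  have "real (2 * k + 2) * integral {0..2*pi} (\<lambda>\<theta>. cos (\<theta> - \<phi>) ^ (2 * Suc k)) =
      real (2 * k + 1) * (2 * pi * fact (2 * k) / (4 ^ k * (fact k)\<^sup>2))"
    unfolding S Suc.IH[symmetric] by (rule cos_power_integral_step)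
  then have "integral {0..2*pi} (\<lambda>\<theta>. cos (\<theta> - \<phi>) ^ (2 * Suc k)) =
      real (2 * k + 1) * (2 * pi * fact (2 * k) / (4 ^ k * (fact k)\<^sup>2)) / real (2 * k + 2)"
  proof -
    have "x = b / a" if "a * x = b" "a \<noteq> 0" for a b x :: real
      using that by (simp add: field_simps)
    moreover assume "real (2 * k + 2) * integral {0..2*pi} (\<lambda>\<theta>. cos (\<theta> - \<phi>) ^ (2 * Suc k)) =
      real (2 * k + 1) * (2 * pi * fact (2 * k) / (4 ^ k * (fact k)\<^sup>2))"
    moreover have "real (2 * k + 2) \<noteq> 0" by simp
    ultimately show ?thesis by blast
  qed
  also have "\<dots> = 2 * pi * fact (2 * Suc k) / (4 ^ Suc k * (fact (Suc k))\<^sup>2)"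
  proof -
    have "2 * Suc k = Suc (Suc (2 * k))" by simp
    then have f: "fact (2 * Suc k) = real (2 * k + 2) * (real (2 * k + 1) * fact (2 * k))" by simp
    have g: "real (2 * k + 2) = 2 * real (Suc k)" by simp
    have "a * (2 * pi * b / (c * d\<^sup>2)) / (2 * e) = 2 * pi * ((2 * e) * (a * b)) / (4 * c * (e * d)\<^sup>2)"
      if "c \<noteq> 0" "d \<noteq> 0" "e \<noteq> 0" for a b c d e :: real
      using that by (simp add: field_simps power2_eq_square)
    then show ?thesis unfolding f g fact_Suc power_Suc by this simp_all
  qed
  finally show ?case .
qed simp

lemma cos_power_integral_odd:
  "integral {0..2*pi} (\<lambda>\<theta>. cos (\<theta> - \<phi>) ^ (2 * k + 1)) = 0"
proof (induction k)
  case 0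
  have "((\<lambda>\<theta>. cos (\<theta> - \<phi>)) has_integral sin (2 * pi - \<phi>) - sin (0 - \<phi>)) {0..2*pi}"
    by (rule fundamental_theorem_of_calculus)
       (auto intro!: derivative_eq_intros simp flip: has_real_derivative_iff_has_vector_derivative)
  then have "integral {0..2*pi} (\<lambda>\<theta>. cos (\<theta> - \<phi>)) = sin (2 * pi - \<phi>) - sin (0 - \<phi>)"
    by (rule integral_unique)
  then show ?case by (simp add: sin_diff)
next
  case (Suc k)
  have "2 * Suc k + 1 = 2 * k + 1 + 2" by simp
  then show ?case using cos_power_integral_step[of "2 * k + 1" \<phi>] unfolding Suc.IH by (simp only:) simp
qed

text \<open>Expand the exponential and integrate term by term: the odd moments of the cosine vanish and the even
ones are \<open>2 \<pi>\<close> times the central binomial coefficients over \<open>4^k\<close>.\<close>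

lemma bessel_I0_integral:
  "(LBINT \<theta>:{0..2*pi}. exp (x * cos (\<theta> - \<phi>))) = 2 * pi * bessel_I0 x"
proof -
  let ?I = "{0..2*pi}"
  let ?f = "\<lambda>k \<theta>. indicator ?I \<theta> * ((x * cos (\<theta> - \<phi>)) ^ k / fact k)"
  have int: "integrable lborel (?f k)" for k
    using borel_integrable_atLeastAtMost'[of 0 "2 * pi" "\<lambda>\<theta>. (x * cos (\<theta> - \<phi>)) ^ k / fact k"]
    unfolding set_integrable_def by (simp add: continuous_intros)
  have bnd: "norm (?f k \<theta>) \<le> indicator ?I \<theta> * (\<bar>x\<bar> ^ k / fact k)" for k \<theta>
  proof -
    have "\<bar>x * cos (\<theta> - \<phi>)\<bar> ^ k \<le> \<bar>x\<bar> ^ k"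
      by (intro power_mono) (auto simp: abs_mult intro: mult_left_le)
    then show ?thesis by (auto simp: abs_mult power_abs indicator_def divide_right_mono)
  qed
  have summ: "summable (\<lambda>k. \<bar>x\<bar> ^ k / fact k)"
    using summable_exp[of "\<bar>x\<bar>"] by (simp add: field_simps)
  have "(LBINT \<theta>:?I. exp (x * cos (\<theta> - \<phi>))) = (LINT \<theta>|lborel. suminf (\<lambda>k. ?f k \<theta>))"
    unfolding set_lebesgue_integral_def
  proof (intro Bochner_Integration.integral_cong refl)
    fix \<theta> :: real
    have "(\<lambda>k. (x * cos (\<theta> - \<phi>)) ^ k / fact k) sums exp (x * cos (\<theta> - \<phi>))"
      using exp_converges[of "x * cos (\<theta> - \<phi>)"] by (simp add: field_simps)
    from sums_mult[OF this, of "indicator ?I \<theta>"]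
    show "indicat_real ?I \<theta> *\<^sub>R exp (x * cos (\<theta> - \<phi>)) = (\<Sum>k. ?f k \<theta>)"
      by (simp add: sums_iff)
  qed
  also have "\<dots> = suminf (\<lambda>k. LINT \<theta>|lborel. ?f k \<theta>)"
  proof (rule integral_suminf[OF int])
    show "AE \<theta> in lborel. summable (\<lambda>k. norm (?f k \<theta>))"
    proof (rule AE_I2)
      fix \<theta>
      show "summable (\<lambda>k. norm (?f k \<theta>))"
        by (rule summable_comparison_test'[OF summable_mult[OF summ, of "indicator ?I \<theta>"], of 0])
           (use bnd in auto)
    qed
    show "summable (\<lambda>k. LINT \<theta>|lborel. norm (?f k \<theta>))"
    proof (rule summable_comparison_test'[OF summable_mult[OF summ, of "2 * pi"], of 0])
      fix k
      have "(LINT \<theta>|lborel. norm (?f k \<theta>)) \<le> (LINT \<theta>|lborel. indicator ?I \<theta> * (\<bar>x\<bar> ^ k / fact k))"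
        by (intro integral_mono bnd integrable_norm int) auto
      also have "\<dots> = 2 * pi * (\<bar>x\<bar> ^ k / fact k)" by simp
      finally show "norm (LINT \<theta>|lborel. norm (?f k \<theta>)) \<le> 2 * pi * (\<bar>x\<bar> ^ k / fact k)"
        by simp
    qed
  qed
  also have "\<dots> = 2 * pi * bessel_I0 x"
  proof -
    let ?J = "\<lambda>k. LINT \<theta>|lborel. ?f k \<theta>"
    have J: "?J k = x ^ k / fact k * integral ?I (\<lambda>\<theta>. cos (\<theta> - \<phi>) ^ k)" for k
    proof -
      have "?J k = (LBINT \<theta>:?I. x ^ k / fact k * cos (\<theta> - \<phi>) ^ k)"
        unfolding set_lebesgue_integral_def
        by (intro Bochner_Integration.integral_cong refl) (simp add: power_mult_distrib)
      also have "\<dots> = x ^ k / fact k * integral ?I (\<lambda>\<theta>. cos (\<theta> - \<phi>) ^ k)"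
        by (subst set_lborel_integral_Icc) (auto intro!: continuous_intros)
      finally show ?thesis .
    qed
    have odd: "?J n = 0" if "n \<notin> range (\<lambda>k. 2 * k)" for n
    proof -
      have "odd n" using that by (metis evenE rangeI)
      then obtain k where n: "n = 2 * k + 1" by (rule oddE)
      show ?thesis unfolding n J cos_power_integral_odd by simp
    qed
    have even: "?J (2 * k) = 2 * pi * ((x\<^sup>2 / 4) ^ k / (fact k)\<^sup>2)" for k
      unfolding J cos_power_integral_even by (simp add: power_divide power_mult)
    have "summable ?J"
    proof (rule summable_comparison_test'[OF summable_mult[OF summ, of "2 * pi"], of 0])
      fix k
      have "norm (?J k) \<le> (LINT \<theta>|lborel. norm (?f k \<theta>))" by (rule integral_norm_bound)
      also have "\<dots> \<le> (LINT \<theta>|lborel. indicator ?I \<theta> * (\<bar>x\<bar> ^ k / fact k))"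
        by (intro integral_mono bnd integrable_norm int) auto
      also have "\<dots> = 2 * pi * (\<bar>x\<bar> ^ k / fact k)" by simp
      finally show "norm (?J k) \<le> 2 * pi * (\<bar>x\<bar> ^ k / fact k)" .
    qed
    then have "?J sums suminf ?J" by (rule summable_sums)
    moreover have m: "strict_mono (\<lambda>k::nat. 2 * k)" by (simp add: strict_mono_def)
    ultimately have "(\<lambda>k. ?J (2 * k)) sums suminf ?J"
      by (subst sums_mono_reindex[OF m odd])
    then have s: "(\<lambda>k. 2 * pi * ((x\<^sup>2 / 4) ^ k / (fact k)\<^sup>2)) sums suminf ?J"
      unfolding even .
    from sums_mult[OF s, of "1 / (2 * pi)"]
    have "(\<lambda>k. (x\<^sup>2 / 4) ^ k / (fact k)\<^sup>2) sums (suminf ?J / (2 * pi))" by simp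
    then show ?thesis by (simp add: bessel_I0_def sums_iff)
  qed
  finally show ?thesis .
qed

text \<open>By the law of cosines the exponent is a constant plus a multiple of the cosine of the angle between
\<open>rcis r \<theta>\<close> and \<open>c\<close>.\<close>

lemma rice_density_eq_angular_integral:
  assumes S: "S > 0"
  shows "r / (pi * S) * (LBINT \<theta>:{0..2*pi}. exp (- ((cmod (rcis r \<theta> - c))\<^sup>2 / S))) = rice_density r (cmod c) (1 / 2 * S)"
proof -
  have "exp (- ((cmod (rcis r \<theta> - c))\<^sup>2 / S)) =
      exp (- (r\<^sup>2 + (cmod c)\<^sup>2) / S) * exp (2 * cmod c * r / S * cos (\<theta> - Arg c))" for \<theta>
  proof -
    have "(cmod (rcis r \<theta> - rcis m \<alpha>))\<^sup>2 = r\<^sup>2 + m\<^sup>2 - 2 * m * r * cos (\<theta> - \<alpha>)" for m \<alpha>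
    proof -
      have "(r * c - m * c')\<^sup>2 + (r * s - m * s')\<^sup>2 =
          r\<^sup>2 * (c\<^sup>2 + s\<^sup>2) + m\<^sup>2 * (c'\<^sup>2 + s'\<^sup>2) - 2 * m * r * (c * c' + s * s')" for c s c' s' :: real
        by (simp add: power2_eq_square algebra_simps)
      from this[of "cos \<theta>" "cos \<alpha>" "sin \<theta>" "sin \<alpha>"] show ?thesis
        by (simp add: cmod_power2 cos_diff)
    qed
    from this[of "cmod c" "Arg c"]
    have "(cmod (rcis r \<theta> - c))\<^sup>2 = r\<^sup>2 + (cmod c)\<^sup>2 - 2 * cmod c * r * cos (\<theta> - Arg c)"
      unfolding rcis_cmod_Arg .
    then show ?thesis
      unfolding mult_exp_exp by (simp add: diff_divide_distrib add_divide_distrib)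
  qed
  then have "(LBINT \<theta>:{0..2*pi}. exp (- ((cmod (rcis r \<theta> - c))\<^sup>2 / S))) =
      exp (- (r\<^sup>2 + (cmod c)\<^sup>2) / S) * (2 * pi * bessel_I0 (2 * cmod c * r / S))"
    by (simp only: set_integral_mult_right bessel_I0_integral)
  then show ?thesis using S by (simp add: rice_density_def field_simps)
qed

section \<open>Weighted integrals of stationary Gaussian noise\<close>

lemma sigma_finite_lebesgue: "sigma_finite_measure (lebesgue :: 'a::euclidean_space measure)"
proof
  obtain A :: "'a set set" where A: "countable A" "A \<subseteq> sets lborel" "\<Union>A = space lborel"
      "\<forall>a\<in>A. emeasure lborel a \<noteq> \<infinity>"
    using lborel.sigma_finite_countable by blast
  have "emeasure lebesgue a \<noteq> \<infinity>" if "a \<in> A" for a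
    using A(2,4) that by (auto simp: emeasure_completion subset_iff)
  with A show "\<exists>A::'a set set. countable A \<and> A \<subseteq> sets lebesgue \<and> \<Union>A = space lebesgue \<and> (\<forall>a\<in>A. emeasure lebesgue a \<noteq> \<infinity>)"
    by (intro exI[of _ A]) (auto intro: sets_completionI_sets)
qed

lemma measurable_lebesgue_of_borel:
  fixes h :: "real \<Rightarrow> 'b::topological_space"
  assumes "h \<in> borel_measurable borel"
  shows "h \<in> borel_measurable lebesgue"
  using measurable_completion[of h lborel borel] assms by simp

lemma integrable_times_iexp:
  fixes h :: "real \<Rightarrow> complex"
  assumes h: "integrable lebesgue h"
  shows "integrable lebesgue (\<lambda>\<tau>. h \<tau> * iexp (\<tau> * l))"
proof (rule Bochner_Integration.integrable_bound[OF h])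
  have "(\<lambda>\<tau>. iexp (\<tau> * l)) \<in> borel_measurable lebesgue"
    by (rule measurable_lebesgue_of_borel) measurable
  with h show "(\<lambda>\<tau>. h \<tau> * iexp (\<tau> * l)) \<in> borel_measurable lebesgue"
    by (intro borel_measurable_times) simp_all
qed (auto simp: norm_mult)

lemma cmod_iexp_diff_le: "cmod (iexp x - iexp y) \<le> \<bar>x - y\<bar>"
proof -
  have "iexp x - iexp y = iexp y * (iexp (x - y) - 1)"
    by (simp add: algebra_simps mult_exp_exp)
  then have "cmod (iexp x - iexp y) = cmod (iexp (x - y) - 1)" by (simp add: norm_mult)
  also have "\<dots> \<le> \<bar>x - y\<bar>" using iexp_approx1[of "x - y" 0] by simp
  finally show ?thesis .
qed

lemma (in prob_space) gaussian_rv_moments: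
  assumes "gaussian_rv M X"
  shows "X \<in> borel_measurable M" "integrable M X" "integrable M (\<lambda>\<omega>. (X \<omega>)\<^sup>2)"
    "(CLINT \<omega>|M. iexp (X \<omega>)) =
      exp (\<i> * complex_of_real (expectation X) - complex_of_real (variance X / 2))"
proof -
  show [measurable]: "X \<in> borel_measurable M" using assms by (simp add: gaussian_rv_def)
  consider \<mu> \<sigma> where "0 < \<sigma>" "distributed M lborel X (\<lambda>x. ennreal (normal_density \<mu> \<sigma> x))"
    | \<mu> where "AE \<omega> in M. X \<omega> = \<mu>"
    using assms by (auto simp: gaussian_rv_def)
  then have "integrable M X \<and> integrable M (\<lambda>\<omega>. (X \<omega>)\<^sup>2) \<and> (CLINT \<omega>|M. iexp (X \<omega>)) =
      exp (\<i> * complex_of_real (expectation X) - complex_of_real (variance X / 2))"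
  proof cases
    case (1 \<mu> \<sigma>)
    note \<sigma> = 1(1) and D = 1(2)
    have "integrable lborel (\<lambda>x. normal_density \<mu> \<sigma> x * x)"
      using \<sigma> by (rule integrable_normal_moment_nz_1)
    then have iX: "integrable M X"
      using distributed_integrable[OF D, of "\<lambda>x. x"] by simp
    have "integrable lborel (\<lambda>x. normal_density \<mu> \<sigma> x * (x - \<mu>)\<^sup>2)"
      using \<sigma> by (rule integrable_normal_moment)
    then have "integrable M (\<lambda>\<omega>. (X \<omega> - \<mu>)\<^sup>2)"
      using distributed_integrable[OF D, of "\<lambda>x. (x - \<mu>)\<^sup>2"] by simp
    then have "integrable M (\<lambda>\<omega>. (X \<omega> - \<mu>)\<^sup>2 + 2 * \<mu> * X \<omega> - \<mu>\<^sup>2)"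
      using iX by simp
    also have "(\<lambda>\<omega>. (X \<omega> - \<mu>)\<^sup>2 + 2 * \<mu> * X \<omega> - \<mu>\<^sup>2) = (\<lambda>\<omega>. (X \<omega>)\<^sup>2)"
      by (simp add: power2_eq_square algebra_simps)
    finally have iX2: "integrable M (\<lambda>\<omega>. (X \<omega>)\<^sup>2)" .
    have "distr M borel X = distr M lborel X" by (rule distr_cong) auto
    also have "\<dots> = density lborel (\<lambda>x. ennreal (normal_density \<mu> \<sigma> x))"
      using D by (simp add: distributed_def)
    finally have "char (distr M borel X) 1 = exp (\<i> * complex_of_real (\<mu> * 1) - complex_of_real (\<sigma>\<^sup>2 * 1\<^sup>2 / 2))"
      by (simp only: char_normal_density[OF \<sigma>])
    moreover have "char (distr M borel X) 1 = (CLINT \<omega>|M. iexp (X \<omega>))"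
      by (simp add: char_def integral_distr)
    ultimately show ?thesis
      using iX iX2 normal_distributed_expectation[OF \<sigma> D] normal_distributed_variance[OF \<sigma> D] by simp
  next
    case (2 \<mu>)
    have "integrable M X" using 2 by (subst integrable_cong_AE[where g = "\<lambda>_. \<mu>"]) auto
    moreover have "integrable M (\<lambda>\<omega>. (X \<omega>)\<^sup>2)"
      using 2 by (subst integrable_cong_AE[where g = "\<lambda>_. \<mu>\<^sup>2"]) auto
    moreover have E: "expectation X = \<mu>"
      using 2 by (subst integral_cong_AE[where g = "\<lambda>_. \<mu>"]) (auto simp: prob_space)
    moreover have "variance X = 0"
      unfolding E using 2 by (subst integral_cong_AE[where g = "\<lambda>_. 0"]) auto
    moreover have "(CLINT \<omega>|M. iexp (X \<omega>)) = iexp \<mu>"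
      using 2 by (subst integral_cong_AE[where g = "\<lambda>_. iexp \<mu>"]) (auto simp: prob_space)
    ultimately show ?thesis by simp
  qed
  then show "integrable M X" "integrable M (\<lambda>\<omega>. (X \<omega>)\<^sup>2)"
    "(CLINT \<omega>|M. iexp (X \<omega>)) =
      exp (\<i> * complex_of_real (expectation X) - complex_of_real (variance X / 2))"
    by auto
qed

lemma integrable_mult_of_squares:
  fixes X Y :: "'a \<Rightarrow> real"
  assumes "X \<in> borel_measurable M" "Y \<in> borel_measurable M"
    and "integrable M (\<lambda>\<omega>. (X \<omega>)\<^sup>2)" "integrable M (\<lambda>\<omega>. (Y \<omega>)\<^sup>2)"
  shows "integrable M (\<lambda>\<omega>. X \<omega> * Y \<omega>)"
proof (rule Bochner_Integration.integrable_bound[OF Bochner_Integration.integrable_add[OF assms(3,4)]])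
  show "AE \<omega> in M. norm (X \<omega> * Y \<omega>) \<le> norm ((X \<omega>)\<^sup>2 + (Y \<omega>)\<^sup>2)"
  proof (rule AE_I2)
    fix \<omega>
    have "0 \<le> (\<bar>X \<omega>\<bar> - \<bar>Y \<omega>\<bar>)\<^sup>2" by simp
    then have "2 * (\<bar>X \<omega>\<bar> * \<bar>Y \<omega>\<bar>) \<le> (X \<omega>)\<^sup>2 + (Y \<omega>)\<^sup>2" by (simp add: power2_diff)
    moreover have "0 \<le> \<bar>X \<omega>\<bar> * \<bar>Y \<omega>\<bar>" by simp
    ultimately have "\<bar>X \<omega>\<bar> * \<bar>Y \<omega>\<bar> \<le> (X \<omega>)\<^sup>2 + (Y \<omega>)\<^sup>2" by linarith
    then show "norm (X \<omega> * Y \<omega>) \<le> norm ((X \<omega>)\<^sup>2 + (Y \<omega>)\<^sup>2)" by (simp add: abs_mult)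
  qed
qed (use assms in measurable)

text \<open>The characteristic function determines the law, which is normal if \<open>v > 0\<close> and a point mass if
\<open>v = 0\<close>; the moments are those of that law.\<close>

lemma (in prob_space) moments_of_gaussian_char:
  fixes X :: "'a \<Rightarrow> real"
  assumes [measurable]: "X \<in> borel_measurable M" and v: "v \<ge> 0"
    and char: "\<And>\<theta>. (CLINT \<omega>|M. iexp (\<theta> * X \<omega>)) = exp (\<i> * complex_of_real (m * \<theta>) - complex_of_real (v * \<theta>\<^sup>2 / 2))"
  shows "expectation X = m" "variance X = v" "integrable M (\<lambda>\<omega>. (X \<omega>)\<^sup>2)"
proof -
  have c: "char (distr M borel X) t = exp (\<i> * complex_of_real (m * t) - complex_of_real (v * t\<^sup>2 / 2))" for t
    unfolding char[symmetric] by (simp add: char_def integral_distr)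
  have R: "real_distribution (distr M borel X)" by (rule real_distribution_distr) measurable
  have "gaussian_rv M X \<and> expectation X = m \<and> variance X = v"
  proof (cases "v = 0")
    case False
    define \<sigma> where "\<sigma> = sqrt v"
    have \<sigma>: "\<sigma> > 0" "\<sigma>\<^sup>2 = v" using v False by (auto simp: \<sigma>_def)
    have "real_distribution (density lborel (\<lambda>x. ennreal (normal_density m \<sigma> x)))"
      unfolding real_distribution_def real_distribution_axioms_def
      using prob_space_normal_density[OF \<sigma>(1)] by simp
    then have "distr M borel X = density lborel (\<lambda>x. ennreal (normal_density m \<sigma> x))"
      by (intro Levy_uniqueness R ext) (simp_all only: c char_normal_density[OF \<sigma>(1)] \<sigma>(2))
    moreover have "distr M lborel X = distr M borel X" by (rule distr_cong) auto
    ultimately have D: "distributed M lborel X (\<lambda>x. ennreal (normal_density m \<sigma> x))"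
      unfolding distributed_def by simp
    then show ?thesis
      using \<sigma> normal_distributed_expectation[OF \<sigma>(1) D] normal_distributed_variance[OF \<sigma>(1) D]
      by (auto simp: gaussian_rv_def)
  next
    case True
    have "real_distribution (return borel m)"
      unfolding real_distribution_def real_distribution_axioms_def by (simp add: prob_space_return)
    moreover have "char (return borel m) t = iexp (t * m)" for t
      unfolding char_def by (subst integral_return) auto
    ultimately have D: "distr M borel X = return borel m"
      by (intro Levy_uniqueness R ext) (simp_all add: c True mult.commute)
    have "AE x in return borel m. x = m" by (subst AE_return) auto
    then have "AE x in distr M borel X. x = m" unfolding D .
    then have AE: "AE \<omega> in M. X \<omega> = m"
      by (subst (asm) AE_distr_iff) auto
    then have E: "expectation X = m"
      by (subst integral_cong_AE[where g = "\<lambda>_. m"]) (auto simp: prob_space)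
    have "variance X = 0"
      unfolding E using AE by (subst integral_cong_AE[where g = "\<lambda>_. 0"]) auto
    with AE E True show ?thesis by (auto simp: gaussian_rv_def)
  qed
  then show "expectation X = m" "variance X = v" "integrable M (\<lambda>\<omega>. (X \<omega>)\<^sup>2)"
    using gaussian_rv_moments(3) by auto
qed

locale stationary_gaussian_noise = prob_space M for M :: "'w measure" +
  fixes \<Phi> :: "real \<Rightarrow> 'w \<Rightarrow> real" and C :: "real \<Rightarrow> real" and F :: "real measure"
  assumes stationary: "stationary_gaussian_process M \<Phi> C"
    and spectral: "spectral_measure C F"
begin

sublocale F: finite_borel_measure F
  using spectral by (simp add: spectral_measure_def)

sublocale L: sigma_finite_measure "lebesgue :: real measure"
  by (rule sigma_finite_lebesgue)

sublocale P: pair_sigma_finite M "lebesgue :: real measure" ..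

definition \<mu> where "\<mu> = expectation (\<Phi> 0)"

text \<open>With this sign of the exponent, the variance of the integral of the noise against \<open>g\<close> is the
integral of the squared modulus of the transform against the spectral measure.\<close>

definition weight_transform :: "(real \<Rightarrow> real) \<Rightarrow> real \<Rightarrow> complex" where
  "weight_transform g l = (LINT \<tau>|lebesgue. g \<tau> *\<^sub>R iexp (\<tau> * l))"

lemma sets_F [measurable_cong]: "sets F = sets borel" by (rule F.M_is_borel)

lemma \<Phi>_pair [measurable]: "(\<lambda>p. \<Phi> (snd p) (fst p)) \<in> borel_measurable (M \<Otimes>\<^sub>M lebesgue)"
  using stationary by (simp add: stationary_gaussian_process_def split_def)

lemma gaussian_combination: "gaussian_rv M (\<lambda>\<omega>. \<Sum>t\<in>T. a t * \<Phi> t \<omega>)" if "finite T"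
  using stationary that by (simp add: stationary_gaussian_process_def gaussian_process_def)

lemma gaussian_marginal: "gaussian_rv M (\<Phi> t)"
  using gaussian_combination[of "{t}" "\<lambda>_. 1"] by simp

lemmas \<Phi>_rv [measurable] = gaussian_rv_moments(1)[OF gaussian_marginal]
  and \<Phi>_int = gaussian_rv_moments(2)[OF gaussian_marginal]
  and \<Phi>_sq = gaussian_rv_moments(3)[OF gaussian_marginal]

lemma mean: "expectation (\<Phi> t) = \<mu>"
  using stationary unfolding stationary_gaussian_process_def \<mu>_def by metis

lemma centred_sq: "integrable M (\<lambda>\<omega>. (\<Phi> t \<omega> - \<mu>)\<^sup>2)"
proof -
  have "(\<lambda>\<omega>. (\<Phi> t \<omega> - \<mu>)\<^sup>2) = (\<lambda>\<omega>. (\<Phi> t \<omega>)\<^sup>2 - 2 * \<mu> * \<Phi> t \<omega> + \<mu>\<^sup>2)"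
    by (simp add: power2_eq_square algebra_simps)
  then show ?thesis using \<Phi>_sq[of t] \<Phi>_int[of t] by simp
qed

lemma centred_mult: "integrable M (\<lambda>\<omega>. (\<Phi> t \<omega> - \<mu>) * (\<Phi> u \<omega> - \<mu>))"
  by (rule integrable_mult_of_squares) (auto intro: centred_sq)

lemma cov: "expectation (\<lambda>\<omega>. (\<Phi> t \<omega> - \<mu>) * (\<Phi> u \<omega> - \<mu>)) = C (t - u)"
  using stationary unfolding stationary_gaussian_process_def mean by blast

lemma C_eq_char: "complex_of_real (C t) = char F t"
  using spectral by (simp add: spectral_measure_def)

lemma C_measurable [measurable]: "C \<in> borel_measurable borel" and C_cont: "isCont C t"
  and C_le: "\<bar>C t\<bar> \<le> C 0"
proof -
  have 1: "isCont (char F) t" for t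
    unfolding continuous_at_sequentially
  proof safe
    fix X assume X: "X \<longlonglongrightarrow> t"
    show "(char F \<circ> X) \<longlonglongrightarrow> char F t"
      unfolding comp_def char_def
      by (rule integral_dominated_convergence[where w="\<lambda>_. 1"]) (auto intro!: tendsto_intros X)
  qed
  have C: "C = (\<lambda>t. Re (char F t))"
    by (simp add: fun_eq_iff flip: C_eq_char)
  show 2: "isCont C t" for t
    unfolding C by (rule continuous_Re[OF 1])
  show "C \<in> borel_measurable borel"
    by (intro borel_measurable_continuous_onI continuous_at_imp_continuous_on ballI 2)
  have "norm (char F t) \<le> (LINT x|F. norm (iexp (t * x)))"
    unfolding char_def by (intro integral_norm_bound)
  also have "\<dots> = C 0"
    using spectral sets_eq_imp_space_eq[OF F.M_is_borel] by (simp add: spectral_measure_def)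
  finally show "\<bar>C t\<bar> \<le> C 0" by (simp flip: C_eq_char)
qed

text \<open>The second moment of the increment is \<open>2 (C 0 - C (t - u))\<close>, and the square of the first absolute
moment is at most that. Since \<open>C\<close> is continuous, nearby values of the noise are close in mean.\<close>

lemma increment_bound: "expectation (\<lambda>\<omega>. \<bar>\<Phi> t \<omega> - \<Phi> u \<omega>\<bar>) \<le> sqrt (2 * (C 0 - C (t - u)))"
proof -
  have sym: "C (u - t) = C (t - u)"
    unfolding cov[symmetric] by (simp add: mult.commute)
  have eq: "(\<lambda>\<omega>. \<bar>\<Phi> t \<omega> - \<Phi> u \<omega>\<bar>\<^sup>2) = (\<lambda>\<omega>. (\<Phi> t \<omega> - \<mu>) * (\<Phi> t \<omega> - \<mu>) - (\<Phi> t \<omega> - \<mu>) * (\<Phi> u \<omega> - \<mu>)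
      - (\<Phi> u \<omega> - \<mu>) * (\<Phi> t \<omega> - \<mu>) + (\<Phi> u \<omega> - \<mu>) * (\<Phi> u \<omega> - \<mu>))"
    by (simp add: power2_eq_square algebra_simps)
  have i: "integrable M (\<lambda>\<omega>. \<bar>\<Phi> t \<omega> - \<Phi> u \<omega>\<bar>\<^sup>2)"
    unfolding eq by (intro Bochner_Integration.integrable_add Bochner_Integration.integrable_diff centred_mult)
  have i1: "integrable M (\<lambda>\<omega>. \<bar>\<Phi> t \<omega> - \<Phi> u \<omega>\<bar>)" using \<Phi>_int by simp
  have "expectation (\<lambda>\<omega>. \<bar>\<Phi> t \<omega> - \<Phi> u \<omega>\<bar>\<^sup>2) = 2 * (C 0 - C (t - u))"
    unfolding eq by (simp add: centred_mult cov sym)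
  moreover have "0 \<le> variance (\<lambda>\<omega>. \<bar>\<Phi> t \<omega> - \<Phi> u \<omega>\<bar>)" by (rule variance_positive)
  ultimately have "(expectation (\<lambda>\<omega>. \<bar>\<Phi> t \<omega> - \<Phi> u \<omega>\<bar>))\<^sup>2 \<le> 2 * (C 0 - C (t - u))"
    by (simp add: variance_eq[OF i1 i])
  then show ?thesis by (rule real_le_rsqrt)
qed

text \<open>The variance is the double sum of \<open>a t * a u * C (t - u)\<close>. Since \<open>C\<close> is the characteristic function of
\<open>F\<close>, this is the integral of a squared modulus.\<close>

lemma char_finite_combination:
  assumes "finite T"
  shows "(CLINT \<omega>|M. iexp (\<Sum>t\<in>T. a t * \<Phi> t \<omega>)) =
    exp (\<i> * complex_of_real (\<mu> * (\<Sum>t\<in>T. a t)) -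
      complex_of_real ((LINT l|F. (cmod (\<Sum>t\<in>T. a t *\<^sub>R iexp (t * l)))\<^sup>2) / 2))"
proof -
  let ?S = "\<lambda>\<omega>. \<Sum>t\<in>T. a t * \<Phi> t \<omega>"
  have E: "expectation ?S = \<mu> * (\<Sum>t\<in>T. a t)"
    unfolding sum_distrib_left by (simp add: \<Phi>_int mean mult.commute)
  have "variance ?S = expectation (\<lambda>\<omega>. \<Sum>t\<in>T. \<Sum>u\<in>T. a t * a u * ((\<Phi> t \<omega> - \<mu>) * (\<Phi> u \<omega> - \<mu>)))"
  proof -
    have "?S \<omega> - \<mu> * (\<Sum>t\<in>T. a t) = (\<Sum>t\<in>T. a t * (\<Phi> t \<omega> - \<mu>))" for \<omega>
      unfolding sum_distrib_left by (simp add: right_diff_distrib sum_subtractf mult.commute)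
    then show ?thesis unfolding E
      by (simp add: power2_eq_square sum_product mult_ac)
  qed
  also have "\<dots> = (\<Sum>t\<in>T. \<Sum>u\<in>T. a t * a u * C (t - u))"
    by (simp add: Bochner_Integration.integral_sum centred_mult cov)
  finally have "complex_of_real (variance ?S) = (\<Sum>t\<in>T. \<Sum>u\<in>T. complex_of_real (a t * a u) * char F (t - u))"
    by (simp add: C_eq_char)
  also have "\<dots> = (CLINT l|F. \<Sum>t\<in>T. \<Sum>u\<in>T. complex_of_real (a t * a u) * iexp ((t - u) * l))"
  proof -
    have "integrable F (\<lambda>l. complex_of_real (a t * a u) * iexp ((t - u) * l))" for t u
      by (intro integrable_mult_right F.integrable_const_bound[of _ 1]) auto
    then show ?thesis
      by (simp add: char_def Bochner_Integration.integral_sum)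
  qed
  also have "\<dots> = (CLINT l|F. complex_of_real ((cmod (\<Sum>t\<in>T. a t *\<^sub>R iexp (t * l)))\<^sup>2))"
  proof (intro Bochner_Integration.integral_cong refl)
    fix l
    have "complex_of_real ((cmod (\<Sum>t\<in>T. a t *\<^sub>R iexp (t * l)))\<^sup>2) =
      (\<Sum>t\<in>T. a t *\<^sub>R iexp (t * l)) * (\<Sum>u\<in>T. a u *\<^sub>R iexp (- (u * l)))"
      by (simp add: complex_norm_square exp_cnj del: of_real_power)
    also have "\<dots> = (\<Sum>t\<in>T. \<Sum>u\<in>T. complex_of_real (a t * a u) * iexp ((t - u) * l))"
      unfolding sum_product
      by (intro sum.cong refl) (simp add: scaleR_conv_of_real mult_exp_exp algebra_simps)
    finally show "(\<Sum>t\<in>T. \<Sum>u\<in>T. complex_of_real (a t * a u) * iexp ((t - u) * l)) =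
      complex_of_real ((cmod (\<Sum>t\<in>T. a t *\<^sub>R iexp (t * l)))\<^sup>2)" ..
  qed
  also have "\<dots> = complex_of_real (LINT l|F. (cmod (\<Sum>t\<in>T. a t *\<^sub>R iexp (t * l)))\<^sup>2)"
    by (rule integral_complex_of_real)
  finally have "variance ?S = (LINT l|F. (cmod (\<Sum>t\<in>T. a t *\<^sub>R iexp (t * l)))\<^sup>2)"
    unfolding of_real_eq_iff .
  with gaussian_rv_moments(4)[OF gaussian_combination[OF assms]] E show ?thesis by simp
qed

text \<open>Tonelli's theorem, for a random field \<open>Z\<close> whose first absolute moments are bounded by \<open>\<delta>\<close>. It is used
for the noise itself and for the error made by sampling it at nearby points.\<close>

lemma weighted_field_bound:
  fixes g :: "real \<Rightarrow> 'b::{banach, second_countable_topology}" and Z :: "'w \<times> real \<Rightarrow> real"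
  assumes Z[measurable]: "Z \<in> borel_measurable (M \<Otimes>\<^sub>M lebesgue)" and g[measurable]: "g \<in> borel_measurable lebesgue"
    and Zi: "\<And>\<tau>. integrable M (\<lambda>\<omega>. Z (\<omega>, \<tau>))"
    and Z\<delta>: "\<And>\<tau>. expectation (\<lambda>\<omega>. \<bar>Z (\<omega>, \<tau>)\<bar>) \<le> \<delta> \<tau>"
    and \<delta>: "integrable lebesgue (\<lambda>\<tau>. norm (g \<tau>) * \<delta> \<tau>)"
  shows "integrable (M \<Otimes>\<^sub>M lebesgue) (\<lambda>p. Z p *\<^sub>R g (snd p))" (is ?I)
    and "expectation (\<lambda>\<omega>. norm (LINT \<tau>|lebesgue. Z (\<omega>, \<tau>) *\<^sub>R g \<tau>)) \<le> (LINT \<tau>|lebesgue. norm (g \<tau>) * \<delta> \<tau>)"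
proof -
  have \<delta>0: "0 \<le> \<delta> \<tau>" for \<tau>
    by (rule order_trans[OF _ Z\<delta>]) (rule Bochner_Integration.integral_nonneg, simp)
  have inner: "(\<integral>\<^sup>+\<omega>. ennreal (norm (Z (\<omega>, \<tau>) *\<^sub>R g \<tau>)) \<partial>M) = ennreal (norm (g \<tau>) * expectation (\<lambda>\<omega>. \<bar>Z (\<omega>, \<tau>)\<bar>))" for \<tau>
    using Zi[of \<tau>] by (subst nn_integral_eq_integral) (auto simp: mult.commute)
  have "(\<integral>\<^sup>+p. ennreal (norm (Z p *\<^sub>R g (snd p))) \<partial>(M \<Otimes>\<^sub>M lebesgue)) =
      (\<integral>\<^sup>+\<tau>. \<integral>\<^sup>+\<omega>. ennreal (norm (Z (\<omega>, \<tau>) *\<^sub>R g \<tau>)) \<partial>M \<partial>lebesgue)"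
    by (subst P.nn_integral_snd[symmetric]) auto
  also have "\<dots> \<le> (\<integral>\<^sup>+\<tau>. ennreal (norm (g \<tau>) * \<delta> \<tau>) \<partial>lebesgue)"
    unfolding inner by (intro nn_integral_mono ennreal_leI mult_left_mono Z\<delta>) auto
  also have "\<dots> = ennreal (LINT \<tau>|lebesgue. norm (g \<tau>) * \<delta> \<tau>)"
    using \<delta> \<delta>0 by (intro nn_integral_eq_integral) auto
  finally have le: "(\<integral>\<^sup>+p. ennreal (norm (Z p *\<^sub>R g (snd p))) \<partial>(M \<Otimes>\<^sub>M lebesgue)) \<le> ennreal (LINT \<tau>|lebesgue. norm (g \<tau>) * \<delta> \<tau>)" .
  show I: ?I
    unfolding integrable_iff_bounded using le by (auto intro: le_less_trans)
  have "expectation (\<lambda>\<omega>. norm (LINT \<tau>|lebesgue. Z (\<omega>, \<tau>) *\<^sub>R g \<tau>)) \<le>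
      expectation (\<lambda>\<omega>. LINT \<tau>|lebesgue. norm (Z (\<omega>, \<tau>) *\<^sub>R g \<tau>))"
  proof (rule integral_mono)
    show "integrable M (\<lambda>\<omega>. norm (LINT \<tau>|lebesgue. Z (\<omega>, \<tau>) *\<^sub>R g \<tau>))"
      using P.integrable_fst'[OF I] by simp
    show "integrable M (\<lambda>\<omega>. LINT \<tau>|lebesgue. norm (Z (\<omega>, \<tau>) *\<^sub>R g \<tau>))"
      using P.integrable_fst'[OF integrable_norm[OF I]] by simp
  qed (rule integral_norm_bound)
  also have "\<dots> = (LINT p|(M \<Otimes>\<^sub>M lebesgue). norm (Z p *\<^sub>R g (snd p)))"
    using P.integral_fst'[OF integrable_norm[OF I]] by simp
  also have "\<dots> \<le> (LINT \<tau>|lebesgue. norm (g \<tau>) * \<delta> \<tau>)"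
  proof -
    have "0 \<le> (LINT \<tau>|lebesgue. norm (g \<tau>) * \<delta> \<tau>)"
      using \<delta>0 by (intro Bochner_Integration.integral_nonneg) auto
    then show ?thesis
      using le by (subst (asm) nn_integral_eq_integral[OF integrable_norm[OF I]]) auto
  qed
  finally show "expectation (\<lambda>\<omega>. norm (LINT \<tau>|lebesgue. Z (\<omega>, \<tau>) *\<^sub>R g \<tau>)) \<le> (LINT \<tau>|lebesgue. norm (g \<tau>) * \<delta> \<tau>)" .
qed

lemma abs_mean_bound: "expectation (\<lambda>\<omega>. \<bar>\<Phi> t \<omega>\<bar>) \<le> sqrt (4 * C 0) + expectation (\<lambda>\<omega>. \<bar>\<Phi> 0 \<omega>\<bar>)"
proof -
  have "expectation (\<lambda>\<omega>. \<bar>\<Phi> t \<omega>\<bar>) \<le> expectation (\<lambda>\<omega>. \<bar>\<Phi> t \<omega> - \<Phi> 0 \<omega>\<bar> + \<bar>\<Phi> 0 \<omega>\<bar>)"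
    using \<Phi>_int by (intro integral_mono) auto
  also have "\<dots> = expectation (\<lambda>\<omega>. \<bar>\<Phi> t \<omega> - \<Phi> 0 \<omega>\<bar>) + expectation (\<lambda>\<omega>. \<bar>\<Phi> 0 \<omega>\<bar>)"
    using \<Phi>_int by (intro Bochner_Integration.integral_add) auto
  also have "expectation (\<lambda>\<omega>. \<bar>\<Phi> t \<omega> - \<Phi> 0 \<omega>\<bar>) \<le> sqrt (4 * C 0)"
    by (rule order_trans[OF increment_bound]) (use C_le[of t] in simp)
  finally show ?thesis by simp
qed

lemma weighted_noise_integrable:
  fixes g :: "real \<Rightarrow> 'b::{banach, second_countable_topology}"
  assumes g: "integrable lebesgue g"
  shows "integrable (M \<Otimes>\<^sub>M lebesgue) (\<lambda>p. \<Phi> (snd p) (fst p) *\<^sub>R g (snd p))"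
    and "AE \<omega> in M. integrable lebesgue (\<lambda>\<tau>. \<Phi> \<tau> \<omega> *\<^sub>R g \<tau>)"
    and "integrable M (\<lambda>\<omega>. LINT \<tau>|lebesgue. \<Phi> \<tau> \<omega> *\<^sub>R g \<tau>)"
proof -
  have [measurable]: "g \<in> borel_measurable lebesgue" using g by simp
  show I: "integrable (M \<Otimes>\<^sub>M lebesgue) (\<lambda>p. \<Phi> (snd p) (fst p) *\<^sub>R g (snd p))"
    by (rule weighted_field_bound(1)[where \<delta> = "\<lambda>_. sqrt (4 * C 0) + expectation (\<lambda>\<omega>. \<bar>\<Phi> 0 \<omega>\<bar>)"])
       (use g \<Phi>_int abs_mean_bound in auto)
  show "AE \<omega> in M. integrable lebesgue (\<lambda>\<tau>. \<Phi> \<tau> \<omega> *\<^sub>R g \<tau>)"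
    using P.AE_integrable_fst'[OF I] by simp
  show "integrable M (\<lambda>\<omega>. LINT \<tau>|lebesgue. \<Phi> \<tau> \<omega> *\<^sub>R g \<tau>)"
    using P.integrable_fst'[OF I] by simp
qed

text \<open>With the noise for \<open>h\<close>, this shows that a sampled integral is a finite combination of values of the
process; with an exponential for \<open>h\<close>, it identifies the transform of the coefficients.\<close>

lemma simple_weighted_sum:
  fixes h :: "real \<Rightarrow> 'b::{banach, second_countable_topology}" and g :: "real \<Rightarrow> real"
  assumes q: "simple_function lebesgue (q :: real \<Rightarrow> real)" and g: "integrable lebesgue g"
  shows "(\<Sum>v\<in>range q. (LINT \<tau>|lebesgue. g \<tau> * indicator {\<tau>. q \<tau> = v} \<tau>) *\<^sub>R h v) = (LINT \<tau>|lebesgue. g \<tau> *\<^sub>R h (q \<tau>))"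
    and "integrable lebesgue (\<lambda>\<tau>. g \<tau> *\<^sub>R h (q \<tau>))"
proof -
  have fin: "finite (range q)" using simple_functionD(1)[OF q] by simp
  have meas: "{\<tau>. q \<tau> = v} \<in> sets lebesgue" for v
    using simple_functionD(2)[OF q, of "{v}"] by (simp add: vimage_def)
  have i: "integrable lebesgue (\<lambda>\<tau>. g \<tau> * indicator {\<tau>. q \<tau> = v} \<tau>)" for v
    using integrable_real_mult_indicator[OF meas g] by simp
  have eq: "g \<tau> *\<^sub>R h (q \<tau>) = (\<Sum>v\<in>range q. (g \<tau> * indicator {\<tau>. q \<tau> = v} \<tau>) *\<^sub>R h v)" for \<tau>
    using fin by (subst sum.remove[of _ "q \<tau>"]) (auto intro!: sum.neutral)
  show "integrable lebesgue (\<lambda>\<tau>. g \<tau> *\<^sub>R h (q \<tau>))"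
    unfolding eq by (intro Bochner_Integration.integrable_sum integrable_scaleR_left i)
  show "(\<Sum>v\<in>range q. (LINT \<tau>|lebesgue. g \<tau> * indicator {\<tau>. q \<tau> = v} \<tau>) *\<^sub>R h v) = (LINT \<tau>|lebesgue. g \<tau> *\<^sub>R h (q \<tau>))"
    unfolding eq by (subst Bochner_Integration.integral_sum) (auto intro!: integrable_scaleR_left i sum.cong integral_scaleR_left[symmetric])
qed

lemma cmod_weight_integral_le: "cmod (LINT \<tau>|lebesgue. g \<tau> *\<^sub>R iexp (q \<tau> * l)) \<le> (LINT \<tau>|lebesgue. \<bar>g \<tau>\<bar>)"
  by (rule order_trans[OF integral_norm_bound]) simp

lemma ident_lebesgue_measurable: "(\<lambda>\<tau>::real. \<tau>) \<in> borel_measurable lebesgue"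
  by (rule measurable_lebesgue_of_borel) simp

lemma sampled_variance_tendsto:
  fixes g :: "real \<Rightarrow> real"
  assumes g: "integrable lebesgue g" and [measurable]: "\<And>i. q i \<in> borel_measurable lebesgue"
    and q_lim: "\<And>\<tau>. (\<lambda>i. q i \<tau>) \<longlonglongrightarrow> \<tau>"
  shows "(\<lambda>i. LINT l|F. (cmod (LINT \<tau>|lebesgue. g \<tau> *\<^sub>R iexp (q i \<tau> * l)))\<^sup>2) \<longlonglongrightarrow>
    (LINT l|F. (cmod (weight_transform g l))\<^sup>2)"
proof -
  have [measurable]: "g \<in> borel_measurable lebesgue" using g by simp
  show ?thesis
  proof (rule integral_dominated_convergence[where w = "\<lambda>_. (LINT \<tau>|lebesgue. \<bar>g \<tau>\<bar>)\<^sup>2"])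
  have m: "(\<lambda>l. (cmod (LINT \<tau>|lebesgue. g \<tau> *\<^sub>R iexp (p \<tau> * l)))\<^sup>2) \<in> borel_measurable F"
    if [measurable]: "p \<in> borel_measurable lebesgue" for p
  proof -
    have "(\<lambda>l. LINT \<tau>|lebesgue. g \<tau> *\<^sub>R iexp (p \<tau> * l)) \<in> borel_measurable F"
      by (intro L.borel_measurable_lebesgue_integral) measurable
    then show ?thesis by measurable
  qed
  show "(\<lambda>l. (cmod (weight_transform g l))\<^sup>2) \<in> borel_measurable F"
    unfolding weight_transform_def by (rule m[OF ident_lebesgue_measurable])
  show "(\<lambda>l. (cmod (LINT \<tau>|lebesgue. g \<tau> *\<^sub>R iexp (q i \<tau> * l)))\<^sup>2) \<in> borel_measurable F" for i
    by (rule m) simp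
  show "AE l in F. (\<lambda>i. (cmod (LINT \<tau>|lebesgue. g \<tau> *\<^sub>R iexp (q i \<tau> * l)))\<^sup>2) \<longlonglongrightarrow> (cmod (weight_transform g l))\<^sup>2"
    unfolding weight_transform_def
    by (intro AE_I2 tendsto_power tendsto_norm integral_dominated_convergence[where w = "\<lambda>\<tau>. \<bar>g \<tau>\<bar>"])
       (use g q_lim in \<open>auto intro!: tendsto_intros borel_measurable_scaleR measurable_compose[OF ident_lebesgue_measurable, of "\<lambda>\<tau>. exp (\<i> * (complex_of_real \<tau> * complex_of_real _))"]\<close>)
  show "AE l in F. norm ((cmod (LINT \<tau>|lebesgue. g \<tau> *\<^sub>R iexp (q i \<tau> * l)))\<^sup>2) \<le> (LINT \<tau>|lebesgue. \<bar>g \<tau>\<bar>)\<^sup>2" for i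
    using cmod_weight_integral_le by (auto intro!: power_mono AE_I2)
qed simp
qed

text \<open>The sampling error at \<open>\<tau>\<close> is an increment of the noise between nearby points. Its mean \<open>\<delta> i \<tau>\<close> is
bounded, and it tends to zero because the covariance function is continuous.\<close>

lemma sampled_noise_tendsto_in_mean:
  fixes g :: "real \<Rightarrow> real"
  assumes g: "integrable lebesgue g" and q: "\<And>i. simple_function lebesgue (q i)"
    and q_lim: "\<And>\<tau>. (\<lambda>i. q i \<tau>) \<longlonglongrightarrow> \<tau>"
  shows "(\<lambda>i. expectation (\<lambda>\<omega>. \<bar>(LINT \<tau>|lebesgue. \<Phi> \<tau> \<omega> * g \<tau>) -
    (LINT \<tau>|lebesgue. g \<tau> *\<^sub>R \<Phi> (q i \<tau>) \<omega>)\<bar>)) \<longlonglongrightarrow> 0"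
proof -
  let ?X = "\<lambda>\<omega>. LINT \<tau>|lebesgue. \<Phi> \<tau> \<omega> * g \<tau>" and ?Y = "\<lambda>i \<omega>. LINT \<tau>|lebesgue. g \<tau> *\<^sub>R \<Phi> (q i \<tau>) \<omega>"
  have gm[measurable]: "g \<in> borel_measurable lebesgue" using g by simp
  have [measurable]: "q i \<in> borel_measurable lebesgue" for i
    using q by (rule borel_measurable_simple_function)
  have Ym: "?Y i \<in> borel_measurable M" for i
    by (subst simple_weighted_sum(1)[OF q[of i] g, where h = "\<lambda>v. \<Phi> v _", symmetric]) measurable
  define \<delta> where "\<delta> i \<tau> = sqrt (2 * (C 0 - C (\<tau> - q i \<tau>)))" for i \<tau>
  have \<delta>[measurable]: "\<delta> i \<in> borel_measurable lebesgue" for i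
  proof -
    have "(\<lambda>\<tau>. C (\<tau> - q i \<tau>)) \<in> borel_measurable lebesgue"
      by (rule measurable_compose[OF borel_measurable_diff[OF ident_lebesgue_measurable] C_measurable]) simp
    then show ?thesis unfolding \<delta>_def by measurable
  qed
  have \<delta>_bound: "0 \<le> \<delta> i \<tau>" "\<delta> i \<tau> \<le> sqrt (4 * C 0)" for i \<tau>
    using C_le[of "\<tau> - q i \<tau>"] by (auto simp: \<delta>_def)
  have g\<delta>: "integrable lebesgue (\<lambda>\<tau>. norm (g \<tau>) * \<delta> i \<tau>)" for i
  proof (rule Bochner_Integration.integrable_bound)
    show "integrable lebesgue (\<lambda>\<tau>. \<bar>g \<tau>\<bar> * sqrt (4 * C 0))" using g by simp
    show "AE \<tau> in lebesgue. norm (norm (g \<tau>) * \<delta> i \<tau>) \<le> norm (\<bar>g \<tau>\<bar> * sqrt (4 * C 0))"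
      using \<delta>_bound[of i] C_le[of 0] by (intro AE_I2) (auto simp: abs_mult intro!: mult_left_mono)
  qed measurable
  have g\<delta>_lim: "(\<lambda>i. LINT \<tau>|lebesgue. norm (g \<tau>) * \<delta> i \<tau>) \<longlonglongrightarrow> (LINT \<tau>|(lebesgue :: real measure). 0)"
  proof (rule integral_dominated_convergence[where w = "\<lambda>\<tau>. \<bar>g \<tau>\<bar> * sqrt (4 * C 0)"])
    show "AE \<tau> in lebesgue. (\<lambda>i. norm (g \<tau>) * \<delta> i \<tau>) \<longlonglongrightarrow> 0"
    proof (rule AE_I2)
      fix \<tau>
      \<comment> \<open>Continuity of the covariance function at zero.\<close>
      have "(\<lambda>i. C (\<tau> - q i \<tau>)) \<longlonglongrightarrow> C (\<tau> - \<tau>)"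
        by (rule isCont_tendsto_compose[OF C_cont]) (intro tendsto_intros q_lim)
      then have "(\<lambda>i. norm (g \<tau>) * \<delta> i \<tau>) \<longlonglongrightarrow> norm (g \<tau>) * sqrt (2 * (C 0 - C (\<tau> - \<tau>)))"
        unfolding \<delta>_def by (intro tendsto_intros)
      then show "(\<lambda>i. norm (g \<tau>) * \<delta> i \<tau>) \<longlonglongrightarrow> 0" by simp
    qed
    show "AE \<tau> in lebesgue. norm (norm (g \<tau>) * \<delta> i \<tau>) \<le> \<bar>g \<tau>\<bar> * sqrt (4 * C 0)" for i
      using \<delta>_bound[of i] by (intro AE_I2) (auto simp: abs_mult intro!: mult_left_mono)
  qed (use g in auto)
  have L1: "expectation (\<lambda>\<omega>. \<bar>?X \<omega> - ?Y i \<omega>\<bar>) \<le> (LINT \<tau>|lebesgue. norm (g \<tau>) * \<delta> i \<tau>)" for i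
  proof -
    let ?Z = "\<lambda>p. \<Phi> (snd p) (fst p) - \<Phi> (q i (snd p)) (fst p)"
    have fin: "finite (range (q i))" using simple_functionD(1)[OF q[of i]] by simp
    have "(\<lambda>p. \<Sum>v\<in>range (q i). indicator {v} (q i (snd p)) * \<Phi> v (fst p)) \<in> borel_measurable (M \<Otimes>\<^sub>M lebesgue)"
      by (intro borel_measurable_sum) measurable
    also have "(\<lambda>p. \<Sum>v\<in>range (q i). indicator {v} (q i (snd p)) * \<Phi> v (fst p)) = (\<lambda>p. \<Phi> (q i (snd p)) (fst p))"
    proof
      fix p :: "'w \<times> real"
      show "(\<Sum>v\<in>range (q i). indicator {v} (q i (snd p)) * \<Phi> v (fst p)) = \<Phi> (q i (snd p)) (fst p)"
        using fin by (subst sum.remove[of _ "q i (snd p)"]) (auto intro!: sum.neutral simp: indicator_def)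
    qed
    finally have Z: "?Z \<in> borel_measurable (M \<Otimes>\<^sub>M lebesgue)" by measurable
    have "expectation (\<lambda>\<omega>. norm (LINT \<tau>|lebesgue. ?Z (\<omega>, \<tau>) *\<^sub>R g \<tau>)) \<le> (LINT \<tau>|lebesgue. norm (g \<tau>) * \<delta> i \<tau>)"
      using increment_bound by (intro weighted_field_bound(2)[OF Z _ _ _ g\<delta>]) (simp_all add: \<Phi>_int \<delta>_def)
    moreover have "expectation (\<lambda>\<omega>. norm (LINT \<tau>|lebesgue. ?Z (\<omega>, \<tau>) *\<^sub>R g \<tau>)) = expectation (\<lambda>\<omega>. \<bar>?X \<omega> - ?Y i \<omega>\<bar>)"
    proof (rule integral_cong_AE)
      show "AE \<omega> in M. norm (LINT \<tau>|lebesgue. ?Z (\<omega>, \<tau>) *\<^sub>R g \<tau>) = \<bar>?X \<omega> - ?Y i \<omega>\<bar>"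
        using weighted_noise_integrable(2)[OF g]
      proof eventually_elim
        case (elim \<omega>)
        have "integrable lebesgue (\<lambda>\<tau>. g \<tau> *\<^sub>R \<Phi> (q i \<tau>) \<omega>)"
          by (rule simple_weighted_sum(2)[OF q g])
        then show ?case
          using elim by (simp add: right_diff_distrib mult.commute)
      qed
      show "(\<lambda>\<omega>. norm (LINT \<tau>|lebesgue. ?Z (\<omega>, \<tau>) *\<^sub>R g \<tau>)) \<in> borel_measurable M"
        using Z by measurable
      show "(\<lambda>\<omega>. \<bar>?X \<omega> - ?Y i \<omega>\<bar>) \<in> borel_measurable M"
        using weighted_noise_integrable(3)[OF g] Ym by simp
    qed
    ultimately show ?thesis by simp
  qed
  show ?thesis
  proof (rule Lim_null_comparison)
    show "\<forall>\<^sub>F i in sequentially. norm (expectation (\<lambda>\<omega>. \<bar>?X \<omega> - ?Y i \<omega>\<bar>)) \<le> (LINT \<tau>|lebesgue. norm (g \<tau>) * \<delta> i \<tau>)"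
      using L1 by (intro always_eventually allI) simp
    show "(\<lambda>i. LINT \<tau>|lebesgue. norm (g \<tau>) * \<delta> i \<tau>) \<longlonglongrightarrow> 0" using g\<delta>_lim by simp
  qed
qed

text \<open>Sample the noise at the points \<open>q i \<tau>\<close>, where the simple functions \<open>q i\<close> converge pointwise to the
identity. The sampled integral is a finite combination of values of the process, so that its
characteristic function is known, and it converges in mean; hence the characteristic functions converge.\<close>

lemma char_weighted_noise:
  fixes g :: "real \<Rightarrow> real"
  assumes g: "integrable lebesgue g"
  shows "(CLINT \<omega>|M. iexp (LINT \<tau>|lebesgue. \<Phi> \<tau> \<omega> * g \<tau>)) =
    exp (\<i> * complex_of_real (\<mu> * (LINT \<tau>|lebesgue. g \<tau>)) - complex_of_real ((LINT l|F. (cmod (weight_transform g l))\<^sup>2) / 2))"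
proof -
  from borel_measurable_implies_sequence_metric[OF ident_lebesgue_measurable, of 0]
  obtain q :: "nat \<Rightarrow> real \<Rightarrow> real" where q: "\<And>i. simple_function lebesgue (q i)"
    and q_lim: "\<And>\<tau>. (\<lambda>i. q i \<tau>) \<longlonglongrightarrow> \<tau>" by auto
  have qm: "q i \<in> borel_measurable lebesgue" for i
    using q by (rule borel_measurable_simple_function)
  define c where "c i v = (LINT \<tau>|lebesgue. g \<tau> * indicator {\<tau>. q i \<tau> = v} \<tau>)" for i v
  note sums = simple_weighted_sum[OF q g, folded c_def]
  define X where "X \<omega> = (LINT \<tau>|lebesgue. \<Phi> \<tau> \<omega> * g \<tau>)" for \<omega>
  define Xi where "Xi i \<omega> = (\<Sum>v\<in>range (q i). c i v * \<Phi> v \<omega>)" for i \<omega>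
  define V where "V i = (LINT l|F. (cmod (LINT \<tau>|lebesgue. g \<tau> *\<^sub>R iexp (q i \<tau> * l)))\<^sup>2)" for i
  have X[measurable]: "integrable M X" "X \<in> borel_measurable M"
    using weighted_noise_integrable(3)[OF g] by (simp_all add: X_def[abs_def])
  have Xi[measurable]: "integrable M (Xi i)" "Xi i \<in> borel_measurable M" for i
    using \<Phi>_int by (simp_all add: Xi_def[abs_def])
  have char_Xi: "(CLINT \<omega>|M. iexp (Xi i \<omega>)) =
      exp (\<i> * complex_of_real (\<mu> * (LINT \<tau>|lebesgue. g \<tau>)) - complex_of_real (V i / 2))" for i
  proof -
    have "finite (range (q i))" using simple_functionD(1)[OF q[of i]] by simp
    from char_finite_combination[OF this, of "c i"] show ?thesis
      using sums(1)[of i "\<lambda>_. 1 :: real"]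
      by (simp only: Xi_def V_def sums(1) real_scaleR_def mult_1_right)
  qed
  have V: "V \<longlonglongrightarrow> (LINT l|F. (cmod (weight_transform g l))\<^sup>2)"
    unfolding V_def by (rule sampled_variance_tendsto[OF g qm q_lim])
  have Xi_eq: "Xi i \<omega> = (LINT \<tau>|lebesgue. g \<tau> *\<^sub>R \<Phi> (q i \<tau>) \<omega>)" for i \<omega>
    using sums(1)[of i "\<lambda>v. \<Phi> v \<omega>"] by (simp add: Xi_def)
  have L1: "(\<lambda>i. expectation (\<lambda>\<omega>. \<bar>X \<omega> - Xi i \<omega>\<bar>)) \<longlonglongrightarrow> 0"
    unfolding X_def Xi_eq by (rule sampled_noise_tendsto_in_mean[OF g q q_lim])
  have "(\<lambda>i. CLINT \<omega>|M. iexp (Xi i \<omega>)) \<longlonglongrightarrow> (CLINT \<omega>|M. iexp (X \<omega>))"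
  proof (rule LIM_zero_cancel, rule Lim_null_comparison)
    show "\<forall>\<^sub>F i in sequentially. norm ((CLINT \<omega>|M. iexp (Xi i \<omega>)) - (CLINT \<omega>|M. iexp (X \<omega>))) \<le>
        expectation (\<lambda>\<omega>. \<bar>X \<omega> - Xi i \<omega>\<bar>)"
    proof (intro always_eventually allI)
      fix i
      have int: "integrable M (\<lambda>\<omega>. iexp (Y \<omega>))" if [measurable]: "Y \<in> borel_measurable M" for Y :: "'w \<Rightarrow> real"
        by (rule integrable_bounded[where B = 1]) auto
      have "norm ((CLINT \<omega>|M. iexp (Xi i \<omega>)) - (CLINT \<omega>|M. iexp (X \<omega>))) =
          norm (CLINT \<omega>|M. iexp (Xi i \<omega>) - iexp (X \<omega>))"
        by (subst Bochner_Integration.integral_diff) (auto intro!: int)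
      also have "\<dots> \<le> expectation (\<lambda>\<omega>. cmod (iexp (Xi i \<omega>) - iexp (X \<omega>)))"
        by (rule integral_norm_bound)
      also have "\<dots> \<le> expectation (\<lambda>\<omega>. \<bar>X \<omega> - Xi i \<omega>\<bar>)"
      proof (rule integral_mono)
        show "integrable M (\<lambda>\<omega>. cmod (iexp (Xi i \<omega>) - iexp (X \<omega>)))"
          by (intro integrable_norm Bochner_Integration.integrable_diff int) measurable
        show "integrable M (\<lambda>\<omega>. \<bar>X \<omega> - Xi i \<omega>\<bar>)" using X(1) Xi(1) by simp
        show "cmod (iexp (Xi i \<omega>) - iexp (X \<omega>)) \<le> \<bar>X \<omega> - Xi i \<omega>\<bar>" for \<omega>
          using cmod_iexp_diff_le[of "Xi i \<omega>" "X \<omega>"] by (simp add: abs_minus_commute)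
      qed
      finally show "norm ((CLINT \<omega>|M. iexp (Xi i \<omega>)) - (CLINT \<omega>|M. iexp (X \<omega>))) \<le>
        expectation (\<lambda>\<omega>. \<bar>X \<omega> - Xi i \<omega>\<bar>)" .
    qed
    show "(\<lambda>i. expectation (\<lambda>\<omega>. \<bar>X \<omega> - Xi i \<omega>\<bar>)) \<longlonglongrightarrow> 0" by (rule L1)
  qed
  moreover have "(\<lambda>i. CLINT \<omega>|M. iexp (Xi i \<omega>)) \<longlonglongrightarrow>
      exp (\<i> * complex_of_real (\<mu> * (LINT \<tau>|lebesgue. g \<tau>)) - complex_of_real ((LINT l|F. (cmod (weight_transform g l))\<^sup>2) / 2))"
    unfolding char_Xi by (intro tendsto_intros V) simp
  ultimately show ?thesis
    unfolding X_def by (rule LIMSEQ_unique)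
qed

lemma weight_transform_scale: "weight_transform (\<lambda>\<tau>. \<theta> * g \<tau>) l = \<theta> *\<^sub>R weight_transform g l"
  unfolding weight_transform_def by (simp flip: scaleR_scaleR)

lemma weighted_noise_moments:
  fixes g :: "real \<Rightarrow> real"
  assumes g: "integrable lebesgue g"
  defines "X \<equiv> \<lambda>\<omega>. LINT \<tau>|lebesgue. \<Phi> \<tau> \<omega> * g \<tau>"
  shows "expectation X = \<mu> * (LINT \<tau>|lebesgue. g \<tau>)" "variance X = (LINT l|F. (cmod (weight_transform g l))\<^sup>2)"
    "integrable M (\<lambda>\<omega>. (X \<omega>)\<^sup>2)" "X \<in> borel_measurable M"
proof -
  have "integrable M X" using weighted_noise_integrable(3)[OF g] by (simp add: X_def)
  then show X: "X \<in> borel_measurable M" by simp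
  have char: "(CLINT \<omega>|M. iexp (\<theta> * X \<omega>)) =
      exp (\<i> * complex_of_real ((\<mu> * (LINT \<tau>|lebesgue. g \<tau>)) * \<theta>) - complex_of_real ((LINT l|F. (cmod (weight_transform g l))\<^sup>2) * \<theta>\<^sup>2 / 2))" for \<theta>
  proof -
    have "integrable lebesgue (\<lambda>\<tau>. \<theta> * g \<tau>)" using g by simp
    from char_weighted_noise[OF this]
    have "(CLINT \<omega>|M. iexp (LINT \<tau>|lebesgue. \<theta> * (\<Phi> \<tau> \<omega> * g \<tau>))) =
      exp (\<i> * complex_of_real (\<mu> * (\<theta> * (LINT \<tau>|lebesgue. g \<tau>))) - complex_of_real ((LINT l|F. \<theta>\<^sup>2 * (cmod (weight_transform g l))\<^sup>2) / 2))"
      by (simp add: weight_transform_scale power_mult_distrib mult.left_commute)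
    then show ?thesis
      unfolding X_def integral_mult_right_zero by (simp add: mult_ac)
  qed
  have v: "0 \<le> (LINT l|F. (cmod (weight_transform g l))\<^sup>2)" by (intro Bochner_Integration.integral_nonneg) simp
  show "expectation X = \<mu> * (LINT \<tau>|lebesgue. g \<tau>)" "variance X = (LINT l|F. (cmod (weight_transform g l))\<^sup>2)"
    "integrable M (\<lambda>\<omega>. (X \<omega>)\<^sup>2)"
    using moments_of_gaussian_char[OF X v char] by auto
qed

text \<open>Let \<open>H\<close> be the transform of \<open>h\<close>. The transform of the real weight \<open>Re (u h)\<close> at \<open>l\<close> is half the sum of
\<open>u * H l\<close> and the conjugate of \<open>u * H (- l)\<close>. Since one of \<open>H l\<close> and \<open>H (- l)\<close> is zero, its modulus
does not depend on the unimodular number \<open>u\<close>. So the real part of \<open>u Z\<close> is centred normal with a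
variance that is the same for all \<open>u\<close>, namely half the second absolute moment of \<open>Z\<close>.\<close>

lemma analytic_weighted_noise:
  fixes h :: "real \<Rightarrow> complex"
  assumes h: "integrable lebesgue h"
    and analytic: "\<And>l. l \<le> 0 \<Longrightarrow> (LINT \<tau>|lebesgue. h \<tau> * iexp (\<tau> * l)) = 0"
  defines "Z \<equiv> \<lambda>\<omega>. LINT \<tau>|lebesgue. \<Phi> \<tau> \<omega> *\<^sub>R h \<tau>"
  shows "Z \<in> borel_measurable M" "integrable M (\<lambda>\<omega>. (cmod (Z \<omega>))\<^sup>2)" "integrable M Z" "expectation Z = 0"
    "(CLINT \<omega>|M. iexp (Re (Z \<omega>))) = complex_of_real (exp (- expectation (\<lambda>\<omega>. (cmod (Z \<omega>))\<^sup>2) / 4))"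
proof -
  have hm[measurable]: "h \<in> borel_measurable lebesgue" using h by simp
  show Zi: "integrable M Z" using weighted_noise_integrable(3)[OF h] by (simp add: Z_def)
  then show [measurable]: "Z \<in> borel_measurable M" by simp
  define H where "H l = (LINT \<tau>|lebesgue. h \<tau> * iexp (\<tau> * l))" for l
  have H0: "H l = 0 \<or> H (- l) = 0" for l
    using analytic[of l] analytic[of "- l"] by (cases "l \<le> 0") (auto simp: H_def)
  have hi: "integrable lebesgue (\<lambda>\<tau>. u * (h \<tau> * iexp (\<tau> * l)))" for u l
    by (intro integrable_mult_right integrable_times_iexp h)
  define V where "V = (LINT l|F. ((cmod (H l) + cmod (H (- l))) / 2)\<^sup>2)"
  \<comment> \<open>Multiplying by \<open>u = 1\<close> and \<open>u = - \<i>\<close> picks out the real and the imaginary part.\<close>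
  have part: "integrable M (\<lambda>\<omega>. (Re (u * Z \<omega>))\<^sup>2)" "expectation (\<lambda>\<omega>. (Re (u * Z \<omega>))\<^sup>2) = V"
    "expectation (\<lambda>\<omega>. Re (u * Z \<omega>)) = 0"
    "(CLINT \<omega>|M. iexp (Re (u * Z \<omega>))) = exp (- complex_of_real (V / 2))" if u: "cmod u = 1" for u
  proof -
    let ?g = "\<lambda>\<tau>. Re (u * h \<tau>)" and ?X = "\<lambda>\<omega>. LINT \<tau>|lebesgue. \<Phi> \<tau> \<omega> * Re (u * h \<tau>)"
    have gi: "integrable lebesgue ?g" using h by auto
    have wt: "weight_transform ?g l = (u * H l + cnj (u * H (- l))) / 2" for l
    proof -
      have "weight_transform ?g l = (LINT \<tau>|lebesgue. (u * (h \<tau> * iexp (\<tau> * l)) + cnj (u * (h \<tau> * iexp (\<tau> * - l)))) / 2)"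
        unfolding weight_transform_def
      proof (intro Bochner_Integration.integral_cong refl)
        fix \<tau>
        have "Re z *\<^sub>R e = (z * e + cnj z * e) / 2" for z e :: complex
          by (simp add: complex_add_cnj scaleR_conv_of_real flip: distrib_right)
        from this[of "u * h \<tau>" "iexp (\<tau> * l)"]
        show "Re (u * h \<tau>) *\<^sub>R iexp (\<tau> * l) = (u * (h \<tau> * iexp (\<tau> * l)) + cnj (u * (h \<tau> * iexp (\<tau> * - l)))) / 2"
          by (simp add: exp_cnj mult.assoc)
      qed
      also have "\<dots> = (u * H l + cnj (u * H (- l))) / 2"
        unfolding H_def integral_mult_right_zero[symmetric] Bochner_Integration.integral_cnj[symmetric] integral_divide_zero
        by (subst Bochner_Integration.integral_add[OF hi integrable_cnj[OF hi]]) (rule refl)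
      finally show ?thesis .
    qed
    have cw: "cmod (weight_transform ?g l) = (cmod (H l) + cmod (H (- l))) / 2" for l
      unfolding wt using H0[of l] u by (auto simp: norm_mult norm_divide)
    have V: "(LINT l|F. (cmod (weight_transform ?g l))\<^sup>2) = V" by (simp only: cw V_def)
    have "(LINT \<tau>|lebesgue. h \<tau>) = 0" using analytic[of 0] by simp
    then have g0: "(LINT \<tau>|lebesgue. ?g \<tau>) = 0" using h by simp
    have AE: "AE \<omega> in M. Re (u * Z \<omega>) = ?X \<omega>"
      using weighted_noise_integrable(2)[OF h]
    proof eventually_elim
      case (elim \<omega>)
      have "u * Z \<omega> = (LINT \<tau>|lebesgue. \<Phi> \<tau> \<omega> *\<^sub>R (u * h \<tau>))"
        unfolding Z_def by (simp flip: integral_mult_right_zero)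
      moreover have "integrable lebesgue (\<lambda>\<tau>. \<Phi> \<tau> \<omega> *\<^sub>R (u * h \<tau>))"
        using integrable_mult_right[OF elim, of u] by simp
      ultimately show ?case by (simp flip: integral_Re)
    qed
    note mom = weighted_noise_moments[OF gi]
    note [measurable] = mom(4)
    show "integrable M (\<lambda>\<omega>. (Re (u * Z \<omega>))\<^sup>2)"
      by (subst integrable_cong_AE[where g = "\<lambda>\<omega>. (?X \<omega>)\<^sup>2"]) (use AE mom(3) in auto)
    have "expectation (\<lambda>\<omega>. (Re (u * Z \<omega>))\<^sup>2) = expectation (\<lambda>\<omega>. (?X \<omega>)\<^sup>2)"
      using AE by (intro integral_cong_AE) auto
    then show "expectation (\<lambda>\<omega>. (Re (u * Z \<omega>))\<^sup>2) = V"
      using mom(1,2) by (simp only: g0 V mult_zero_right diff_zero)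
    have "expectation (\<lambda>\<omega>. Re (u * Z \<omega>)) = expectation ?X" using AE by (intro integral_cong_AE) auto
    then show "expectation (\<lambda>\<omega>. Re (u * Z \<omega>)) = 0" by (simp only: mom(1) g0 mult_zero_right)
    have "AE \<omega> in M. iexp (Re (u * Z \<omega>)) = iexp (?X \<omega>)"
      using AE by eventually_elim (simp only:)
    then have "(CLINT \<omega>|M. iexp (Re (u * Z \<omega>))) = (CLINT \<omega>|M. iexp (?X \<omega>))"
      by (rule integral_cong_AE[rotated 2]) measurable
    then show "(CLINT \<omega>|M. iexp (Re (u * Z \<omega>))) = exp (- complex_of_real (V / 2))"
      by (simp only: char_weighted_noise[OF gi] g0 V) simp
  qed
  note re = part[of 1, simplified] and im = part[of "- \<i>", simplified]
  show "integrable M (\<lambda>\<omega>. (cmod (Z \<omega>))\<^sup>2)"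
    unfolding cmod_power2 using re(1) im(1) by simp
  have EZ2: "expectation (\<lambda>\<omega>. (cmod (Z \<omega>))\<^sup>2) = 2 * V"
    unfolding cmod_power2 using re(1,2) im(1,2) by simp
  show "expectation Z = 0"
    using re(3) im(3) Zi by (simp add: complex_eq_iff)
  show "(CLINT \<omega>|M. iexp (Re (Z \<omega>))) = complex_of_real (exp (- expectation (\<lambda>\<omega>. (cmod (Z \<omega>))\<^sup>2) / 4))"
    unfolding EZ2 re(4) by (simp flip: exp_of_real)
qed

end

text \<open>The transform of the atom at \<open>l\<close> is a multiple of the conjugate of the Fourier transform of \<open>\<psi>\<close> at
\<open>s * l\<close>.\<close>

lemma wavelet_atom:
  fixes t s l :: real
  assumes \<psi>: "analytic_mother_wavelet \<psi>" and s: "s > 0"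
  defines "\<phi> \<equiv> \<lambda>\<tau>. complex_of_real (1 / sqrt s) * cnj (\<psi> ((\<tau> - t) / s))"
  shows "integrable lebesgue \<phi>" "l \<le> 0 \<Longrightarrow> (LINT \<tau>|lebesgue. \<phi> \<tau> * iexp (\<tau> * l)) = 0"
proof -
  have i: "integrable lebesgue \<psi>" using \<psi> by (simp add: analytic_mother_wavelet_def)
  have aff: "(\<tau> - t) / s = - t / s + (1 / s) * \<tau>" for \<tau> using s by (simp add: field_simps)
  have i': "integrable lebesgue (\<lambda>\<tau>. \<psi> ((\<tau> - t) / s))"
    unfolding aff using s i by (subst lebesgue_integrable_real_affine_iff) auto
  then show "integrable lebesgue \<phi>" unfolding \<phi>_def by (simp add: integrable_cnj)
  assume l: "l \<le> 0"
  have "(LINT \<tau>|lebesgue. \<phi> \<tau> * iexp (\<tau> * l)) = \<bar>s\<bar> *\<^sub>R (LINT u|lebesgue. \<phi> (t + s * u) * iexp ((t + s * u) * l))"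
    using s by (intro lebesgue_integral_real_affine) auto
  also have "(\<lambda>u. \<phi> (t + s * u) * iexp ((t + s * u) * l)) =
      (\<lambda>u. (complex_of_real (1 / sqrt s) * iexp (t * l)) * cnj (exp (- (\<i> * complex_of_real u * complex_of_real (s * l))) * \<psi> u))"
    using s by (simp add: fun_eq_iff \<phi>_def exp_cnj mult_exp_exp algebra_simps)
  also have "(LINT u|lebesgue. \<dots> u) = (complex_of_real (1 / sqrt s) * iexp (t * l)) * cnj (fourier_transform \<psi> (s * l))"
    unfolding fourier_transform_def integral_mult_right_zero Bochner_Integration.integral_cnj ..
  also have "fourier_transform \<psi> (s * l) = 0"
    using \<psi> s l by (simp add: analytic_mother_wavelet_def mult_nonneg_nonpos)
  finally show "(LINT \<tau>|lebesgue. \<phi> \<tau> * iexp (\<tau> * l)) = 0" by simp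
qed

section \<open>Densities of circularly symmetric Gaussian vectors\<close>

lemma inner_complex_vec: "x \<bullet> y = Re (\<Sum>i\<in>UNIV. cnj (x $ i) * y $ i)" for x y :: "complex ^ 'n"
  by (simp add: inner_vec_def inner_complex_def)

lemma prod_normal_density:
  fixes u :: "complex ^ 'n"
  shows "(\<Prod>b\<in>Basis. normal_density 0 (sqrt (1 / 2)) (u \<bullet> b)) = exp (- (norm u)\<^sup>2) / pi ^ CARD('n)"
proof -
  have "(\<Prod>b\<in>Basis. normal_density 0 (sqrt (1 / 2)) (u \<bullet> b)) = (\<Prod>b\<in>(Basis :: (complex^'n) set). 1 / sqrt pi) * (\<Prod>b\<in>Basis. exp (- (u \<bullet> b)\<^sup>2))"
  proof -
    have "normal_density 0 (sqrt (1 / 2)) x = 1 / sqrt pi * exp (- x\<^sup>2)" for x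
      by (simp add: normal_density_def)
    then show ?thesis by (simp only: prod.distrib)
  qed
  also have "(\<Prod>b\<in>(Basis :: (complex^'n) set). 1 / sqrt pi) = 1 / pi ^ CARD('n)"
    by (simp add: power_divide power_mult power_mult[of _ 2] mult.commute[of "CARD('n)"])
  also have "(\<Prod>b\<in>Basis. exp (- (u \<bullet> b)\<^sup>2)) = exp (- (norm u)\<^sup>2)"
    by (subst exp_sum[symmetric]) (simp_all add: sum_negf norm_eq_sqrt_inner euclidean_inner[of u u] sum_nonneg power2_eq_square)
  finally show ?thesis by simp
qed

text \<open>Whitening: if \<open>\<Gamma>\<close> inverse is \<open>B* B\<close>, then \<open>B \<Gamma> B*\<close> is the identity, so that \<open>U = B D\<close> has the
characteristic function of independent normal coordinates with variance \<open>1/2\<close>. The exponent of its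
density at \<open>B w\<close> is \<open>- |B w|^2\<close>, which is the Hermitian form of \<open>\<Gamma>\<close> inverse at \<open>w\<close>, and the factor
\<open>|det B|^2\<close> is \<open>1 / det \<Gamma>\<close>.\<close>

lemma (in prob_space) complex_normal_of_char:
  fixes D :: "'a \<Rightarrow> complex ^ 'n"
  assumes D[measurable]: "D \<in> borel_measurable M"
    and pd: "pos_definite \<Gamma>" and inv: "invertible \<Gamma>"
    and char: "\<And>a. (CLINT \<omega>|M. iexp (a \<bullet> D \<omega>)) = complex_of_real (exp (- Re (hermitian_form \<Gamma> a) / 4))"
  obtains p where "\<And>w. complex_of_real (p w) = complex_normal_density 0 \<Gamma> w"
    "has_pdf M D p" "continuous_on UNIV p"
proof -
  define K where "K = matrix_inv \<Gamma>"
  have \<Gamma>K: "\<Gamma> ** K = mat 1" "K ** \<Gamma> = mat 1" using matrix_inv_both[OF inv] by (simp_all add: K_def)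
  have "pos_definite K" unfolding K_def by (rule pos_definite_matrix_inv[OF pd inv])
  then obtain B where B: "conj_transpose B ** B = K"
    and scale: "\<And>f. f \<in> borel_measurable borel \<Longrightarrow>
      ennreal ((cmod (det B))\<^sup>2) * (\<integral>\<^sup>+z. f (B *v z) \<partial>lborel) = (\<integral>\<^sup>+z. f z \<partial>lborel)"
    using pos_definite_Cholesky by blast
  define J where "J = \<Gamma> ** conj_transpose B"
  have JB: "J ** B = mat 1" unfolding J_def by (simp add: B \<Gamma>K flip: matrix_mul_assoc)
  then have BJ: "B ** J = mat 1" by (simp add: matrix_left_right_inverse)
  have [measurable]: "(*v) A \<in> borel_measurable borel" for A :: "complex^'n^'n"
    by (intro borel_measurable_continuous_onI linear_continuous_on matrix_vector_mul_bounded_linear)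
  define U where "U \<omega> = B *v D \<omega>" for \<omega>
  have U[measurable]: "U \<in> borel_measurable M" unfolding U_def by measurable
  have DJ: "D \<omega> = J *v U \<omega>" for \<omega> by (simp add: U_def matrix_vector_mul_assoc JB)
  have charU: "(CLINT \<omega>|M. iexp (a \<bullet> U \<omega>)) = complex_of_real (exp (- (sqrt (1 / 2))\<^sup>2 * (norm a)\<^sup>2 / 2))" for a
  proof -
    have "a \<bullet> U \<omega> = (conj_transpose B *v a) \<bullet> D \<omega>" for \<omega>
      using conj_transpose_adjoint[of a "conj_transpose B" "D \<omega>"] by (simp add: inner_complex_vec U_def)
    then have "(CLINT \<omega>|M. iexp (a \<bullet> U \<omega>)) = complex_of_real (exp (- Re (hermitian_form \<Gamma> (conj_transpose B *v a)) / 4))"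
      by (simp only: char)
    also have "hermitian_form \<Gamma> (conj_transpose B *v a) = hermitian_form (B ** J) a"
      by (simp add: J_def matrix_mul_assoc flip: hermitian_form_congruence)
    finally show ?thesis by (simp add: BJ hermitian_form_mat_1)
  qed
  define g where "g u = exp (- (norm u)\<^sup>2) / pi ^ CARD('n)" for u :: "complex^'n"
  have U_dist: "distributed M lborel U (\<lambda>u. ennreal (g u))"
    using distributed_isotropic_gaussian[OF U _ charU] unfolding prod_normal_density g_def by simp
  have g0: "0 \<le> g u" for u by (simp add: g_def)
  have [measurable]: "g \<in> borel_measurable borel" unfolding g_def by measurable
  define p where "p w = (cmod (det B))\<^sup>2 * g (B *v w)" for w
  have p0: "0 \<le> p w" for w by (simp add: p_def g0)
  have [measurable]: "p \<in> borel_measurable borel" unfolding p_def by measurable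
  show ?thesis
  proof
    have "det \<Gamma> * det K = 1" using \<Gamma>K(1) by (metis det_I det_mul)
    moreover have detK: "det K = complex_of_real ((cmod (det B))\<^sup>2)"
      by (simp add: B[symmetric] det_mul det_conj_transpose complex_norm_square mult.commute del: of_real_power)
    ultimately have det: "complex_of_real ((cmod (det B))\<^sup>2) = 1 / det \<Gamma>"
      by (metis mult_zero_left nonzero_eq_divide_eq mult.commute zero_neq_one)
    fix w :: "complex^'n"
    have "hermitian_form K w = complex_of_real ((norm (B *v w))\<^sup>2)"
      unfolding hermitian_form_mat_1[symmetric] by (simp add: B flip: hermitian_form_congruence)
    then have K: "(\<Sum>i\<in>UNIV. cnj (w $ i) * (matrix_inv \<Gamma> *v w) $ i) = complex_of_real ((norm (B *v w))\<^sup>2)"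
      by (simp only: K_def hermitian_form_def)
    have "complex_of_real (p w) = complex_of_real ((cmod (det B))\<^sup>2) * (exp (- complex_of_real ((norm (B *v w))\<^sup>2)) / complex_of_real (pi ^ CARD('n)))"
      unfolding p_def g_def by (simp flip: exp_of_real)
    then show "complex_of_real (p w) = complex_normal_density 0 \<Gamma> w"
      unfolding complex_normal_density_def diff_zero K det by simp
  next
    have "distr M lborel D = density lborel (\<lambda>w. ennreal (p w))"
    proof (rule measure_eqI)
      fix A :: "(complex^'n) set" assume "A \<in> sets (distr M lborel D)"
      then have A[measurable]: "A \<in> sets borel" by simp
      have "emeasure (distr M lborel D) A = (\<integral>\<^sup>+\<omega>. indicator A (J *v U \<omega>) \<partial>M)"
        unfolding DJ[symmetric] by (subst nn_integral_indicator[symmetric], simp, subst nn_integral_distr) auto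
      also have "\<dots> = (\<integral>\<^sup>+u. ennreal (g u) * indicator A (J *v u) \<partial>lborel)"
        by (rule distributed_nn_integral[OF U_dist, symmetric]) measurable
      also have "\<dots> = ennreal ((cmod (det B))\<^sup>2) * (\<integral>\<^sup>+w. ennreal (g (B *v w)) * indicator A (J *v (B *v w)) \<partial>lborel)"
        by (rule scale[symmetric]) measurable
      also have "\<dots> = (\<integral>\<^sup>+w. ennreal ((cmod (det B))\<^sup>2) * (ennreal (g (B *v w)) * indicator A (J *v (B *v w))) \<partial>lborel)"
        by (rule nn_integral_cmult[symmetric]) measurable
      also have "\<dots> = (\<integral>\<^sup>+w. ennreal (p w) * indicator A w \<partial>lborel)"
        by (simp add: p_def ennreal_mult g0 mult.assoc matrix_vector_mul_assoc JB)
      also have "\<dots> = emeasure (density lborel (\<lambda>w. ennreal (p w))) A"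
        by (rule emeasure_density[symmetric]) auto
      finally show "emeasure (distr M lborel D) A = emeasure (density lborel (\<lambda>w. ennreal (p w))) A" .
    qed simp
    then show "has_pdf M D p"
      unfolding has_pdf_def distributed_def using p0 by simp
    show "continuous_on UNIV p"
      unfolding p_def g_def
      by (intro continuous_intros linear_continuous_on matrix_vector_mul_bounded_linear) simp
  qed
qed

lemma has_pdf_shift:
  fixes c :: "'a::euclidean_space"
  assumes "has_pdf M D p" and [measurable]: "p \<in> borel_measurable borel"
  shows "has_pdf M (\<lambda>\<omega>. D \<omega> + c) (\<lambda>w. p (w - c))"
proof -
  have D: "distributed M lborel D (\<lambda>x. ennreal (p x))" using assms(1) by (simp add: has_pdf_def)
  have [measurable]: "D \<in> borel_measurable M" using distributed_measurable[OF D] by simp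
  have "distr M lborel (\<lambda>\<omega>. D \<omega> + c) = density lborel (\<lambda>w. ennreal (p (w - c)))"
  proof (rule measure_eqI)
    fix A :: "'a set" assume "A \<in> sets (distr M lborel (\<lambda>\<omega>. D \<omega> + c))"
    then have A[measurable]: "A \<in> sets borel" by simp
    have "emeasure (distr M lborel (\<lambda>\<omega>. D \<omega> + c)) A = (\<integral>\<^sup>+\<omega>. indicator A (D \<omega> + c) \<partial>M)"
      by (subst nn_integral_indicator[symmetric], simp, subst nn_integral_distr) auto
    also have "\<dots> = (\<integral>\<^sup>+w. ennreal (p w) * indicator A (w + c) \<partial>lborel)"
      by (rule distributed_nn_integral[OF D, symmetric]) measurable
    also have "\<dots> = (\<integral>\<^sup>+w. ennreal (p (w - c)) * indicator A w \<partial>lborel)"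
      using nn_integral_lborel_affine[of "\<lambda>w. ennreal (p (w - c)) * indicator A w" 1 c] by (simp add: add.commute)
    also have "\<dots> = emeasure (density lborel (\<lambda>w. ennreal (p (w - c)))) A"
      by (rule emeasure_density[symmetric]) auto
    finally show "emeasure (distr M lborel (\<lambda>\<omega>. D \<omega> + c)) A = emeasure (density lborel (\<lambda>w. ennreal (p (w - c)))) A" .
  qed simp
  then show ?thesis using assms(1) unfolding has_pdf_def distributed_def by simp
qed

lemma has_pdf_cong_AE:
  assumes X: "has_pdf M X p" and Y: "Y \<in> borel_measurable M" and eq: "AE \<omega> in M. Y \<omega> = X \<omega>"
  shows "has_pdf M Y p"
proof -
  have "distr M lborel Y = distr M lborel X"
    by (rule distr_cong_AE) (use X Y eq in \<open>auto simp: has_pdf_def distributed_def\<close>)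
  then show ?thesis using X Y by (simp add: has_pdf_def distributed_def)
qed

context stationary_gaussian_noise
begin

text \<open>The combination with coefficients \<open>cnj (a i)\<close> of the weights is again an analytic weight, and its
integral \<open>Q\<close> has the real part \<open>a \<bullet> D\<close>. So the scalar case applies, and the second absolute moment of
\<open>Q\<close> is the Hermitian form of the covariance matrix at \<open>a\<close>.\<close>

lemma analytic_weights_char:
  fixes h :: "'n::finite \<Rightarrow> real \<Rightarrow> complex"
  assumes h: "\<And>i. integrable lebesgue (h i)"
    and analytic: "\<And>i l. l \<le> 0 \<Longrightarrow> (LINT \<tau>|lebesgue. h i \<tau> * iexp (\<tau> * l)) = 0"
  defines "D \<equiv> \<lambda>\<omega>. \<chi> i. LINT \<tau>|lebesgue. \<Phi> \<tau> \<omega> *\<^sub>R h i \<tau>"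
  defines "\<Gamma> \<equiv> \<chi> i j. CLINT \<omega>|M. D \<omega> $ i * cnj (D \<omega> $ j)"
  shows "D \<in> borel_measurable M" "\<And>i. integrable M (\<lambda>\<omega>. D \<omega> $ i)" "\<And>i. expectation (\<lambda>\<omega>. D \<omega> $ i) = 0"
    and "\<And>a. (CLINT \<omega>|M. iexp (a \<bullet> D \<omega>)) = complex_of_real (exp (- Re (hermitian_form \<Gamma> a) / 4))"
    and "conj_transpose \<Gamma> = \<Gamma>" and "\<And>a. 0 \<le> Re (hermitian_form \<Gamma> a)"
proof -
  note N = analytic_weighted_noise[OF h analytic]
  have Di: "D \<omega> $ i = (LINT \<tau>|lebesgue. \<Phi> \<tau> \<omega> *\<^sub>R h i \<tau>)" for \<omega> i by (simp add: D_def)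
  have Dm[measurable]: "(\<lambda>\<omega>. D \<omega> $ i) \<in> borel_measurable M" for i unfolding Di by (rule N(1))
  show D[measurable]: "D \<in> borel_measurable M"
    unfolding D_def by (rule measurable_vec_lambda) (rule N(1))
  show "integrable M (\<lambda>\<omega>. D \<omega> $ i)" for i unfolding Di by (rule N(3))
  show "expectation (\<lambda>\<omega>. D \<omega> $ i) = 0" for i unfolding Di by (rule N(4))
  have D2: "integrable M (\<lambda>\<omega>. (cmod (D \<omega> $ i))\<^sup>2)" for i unfolding Di by (rule N(2))
  have cD[measurable]: "(\<lambda>\<omega>. cnj (D \<omega> $ i)) \<in> borel_measurable M" for i
    by (rule borel_measurable_continuous_on[OF _ Dm]) (intro continuous_intros)
  have DD: "integrable M (\<lambda>\<omega>. D \<omega> $ i * cnj (D \<omega> $ j))" for i j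
  proof (rule Bochner_Integration.integrable_bound)
    show "integrable M (\<lambda>\<omega>. cmod (D \<omega> $ i) * cmod (D \<omega> $ j))"
      by (rule integrable_mult_of_squares) (auto intro: D2)
  qed (auto simp: norm_mult)
  show herm: "conj_transpose \<Gamma> = \<Gamma>"
  proof -
    have "cnj (CLINT \<omega>|M. D \<omega> $ j * cnj (D \<omega> $ i)) = (CLINT \<omega>|M. D \<omega> $ i * cnj (D \<omega> $ j))" for i j
      by (subst Bochner_Integration.integral_cnj[symmetric]) (simp add: mult.commute)
    then show ?thesis by (simp add: conj_transpose_def \<Gamma>_def vec_eq_iff)
  qed
  define Q where "Q a \<omega> = (\<Sum>i\<in>UNIV. cnj (a $ i) * D \<omega> $ i)" for a \<omega>
  have Q2: "complex_of_real (expectation (\<lambda>\<omega>. (cmod (Q a \<omega>))\<^sup>2)) = hermitian_form \<Gamma> a" for a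
  proof -
    have "complex_of_real (expectation (\<lambda>\<omega>. (cmod (Q a \<omega>))\<^sup>2)) = (CLINT \<omega>|M. complex_of_real ((cmod (Q a \<omega>))\<^sup>2))"
      by (rule integral_complex_of_real[symmetric])
    also have "\<dots> = (CLINT \<omega>|M. \<Sum>i\<in>UNIV. \<Sum>j\<in>UNIV. (cnj (a $ i) * a $ j) * (D \<omega> $ i * cnj (D \<omega> $ j)))"
      unfolding complex_norm_square Q_def
      by (intro Bochner_Integration.integral_cong refl) 
        (simp only: cnj_sum sum_product complex_cnj_mult complex_cnj_cnj, simp only: mult_ac)
    also have "\<dots> = (\<Sum>i\<in>UNIV. \<Sum>j\<in>UNIV. (cnj (a $ i) * a $ j) * \<Gamma> $ i $ j)"
      by (simp add: Bochner_Integration.integral_sum DD \<Gamma>_def)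
    also have "\<dots> = hermitian_form \<Gamma> a"
      by (simp add: hermitian_form_def matrix_vector_mult_def sum_distrib_left mult_ac)
    finally show ?thesis .
  qed
  show "0 \<le> Re (hermitian_form \<Gamma> a)" for a
    unfolding Q2[symmetric] by simp
  show "(CLINT \<omega>|M. iexp (a \<bullet> D \<omega>)) = complex_of_real (exp (- Re (hermitian_form \<Gamma> a) / 4))" for a
  proof -
    define ha where "ha \<tau> = (\<Sum>i\<in>UNIV. cnj (a $ i) * h i \<tau>)" for \<tau>
    have hai: "integrable lebesgue ha" unfolding ha_def using h by simp
    have haa: "(LINT \<tau>|lebesgue. ha \<tau> * iexp (\<tau> * l)) = 0" if l: "l \<le> 0" for l
    proof -
      have "integrable lebesgue (\<lambda>\<tau>. h i \<tau> * iexp (\<tau> * l))" for i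
        by (rule integrable_times_iexp[OF h])
      then have "(LINT \<tau>|lebesgue. (\<Sum>i\<in>UNIV. cnj (a $ i) * (h i \<tau> * iexp (\<tau> * l)))) = (\<Sum>i\<in>UNIV. cnj (a $ i) * 0)"
        by (subst Bochner_Integration.integral_sum) (simp_all add: analytic[OF l, simplified])
      then show ?thesis by (simp add: ha_def sum_distrib_right mult.assoc)
    qed
    note A = analytic_weighted_noise[OF hai haa]
    let ?Z = "\<lambda>\<omega>. LINT \<tau>|lebesgue. \<Phi> \<tau> \<omega> *\<^sub>R ha \<tau>"
    have [measurable]: "?Z \<in> borel_measurable M" by (rule A(1))
    have "AE \<omega> in M. \<forall>i. integrable lebesgue (\<lambda>\<tau>. \<Phi> \<tau> \<omega> *\<^sub>R h i \<tau>)"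
      using weighted_noise_integrable(2)[OF h] by (simp add: AE_finite_all[of UNIV, simplified])
    then have ZQ: "AE \<omega> in M. ?Z \<omega> = Q a \<omega>"
    proof eventually_elim
      case (elim \<omega>)
      have "?Z \<omega> = (LINT \<tau>|lebesgue. (\<Sum>i\<in>UNIV. cnj (a $ i) * (\<Phi> \<tau> \<omega> *\<^sub>R h i \<tau>)))"
        by (simp add: ha_def scaleR_sum_right)
      also have "\<dots> = Q a \<omega>"
        using elim by (subst Bochner_Integration.integral_sum) (simp_all add: Q_def Di del: mult_scaleR_right)
      finally show ?case .
    qed
    have [measurable]: "Q a \<in> borel_measurable M" unfolding Q_def by measurable
    have "expectation (\<lambda>\<omega>. (cmod (?Z \<omega>))\<^sup>2) = expectation (\<lambda>\<omega>. (cmod (Q a \<omega>))\<^sup>2)"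
      using ZQ by (intro integral_cong_AE) auto
    then have "complex_of_real (expectation (\<lambda>\<omega>. (cmod (?Z \<omega>))\<^sup>2)) = hermitian_form \<Gamma> a" by (simp add: Q2)
    then have Z2: "expectation (\<lambda>\<omega>. (cmod (?Z \<omega>))\<^sup>2) = Re (hermitian_form \<Gamma> a)" by (metis Re_complex_of_real)
    have "(CLINT \<omega>|M. iexp (a \<bullet> D \<omega>)) = (CLINT \<omega>|M. iexp (Re (?Z \<omega>)))"
      using ZQ by (intro integral_cong_AE) (auto simp: inner_complex_vec Q_def)
    also have "\<dots> = complex_of_real (exp (- expectation (\<lambda>\<omega>. (cmod (?Z \<omega>))\<^sup>2) / 4))"
      by (rule A(5))
    finally show ?thesis unfolding Z2 .
  qed
qed


section \<open>The wavelet transform of signal plus noise\<close>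

lemma cnj_measurable: "g \<in> borel_measurable N \<Longrightarrow> (\<lambda>x. cnj (g x)) \<in> borel_measurable N"
  by (rule borel_measurable_continuous_on[of cnj]) (intro continuous_intros)

lemma wavelet_transform_eq_weighted:
  "wavelet_transform \<psi> g t s =
    (LINT \<tau>|lebesgue. g \<tau> *\<^sub>R (complex_of_real (1 / sqrt s) * cnj (\<psi> ((\<tau> - t) / s))))"
  by (simp add: wavelet_transform_def scaleR_conv_of_real mult.assoc)

text \<open>Linearity holds almost surely only: a path of the noise need not be integrable against the atom.\<close>

lemma wavelet_transform_signal_plus_noise:
  fixes f :: "real \<Rightarrow> real"
  assumes \<psi>: "analytic_mother_wavelet \<psi>" and s: "0 < s"
    and f: "f \<in> borel_measurable lebesgue" "bounded (range f)"
    and Y: "\<And>t \<omega>. Y t \<omega> = f t + \<Phi> t \<omega>"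
  shows "(\<lambda>\<omega>. wavelet_transform \<psi> (\<lambda>\<tau>. Y \<tau> \<omega>) t s) \<in> borel_measurable M"
    and "AE \<omega> in M. wavelet_transform \<psi> (\<lambda>\<tau>. Y \<tau> \<omega>) t s =
      wavelet_transform \<psi> (\<lambda>\<tau>. \<Phi> \<tau> \<omega>) t s + wavelet_transform \<psi> f t s"
proof -
  let ?\<phi> = "\<lambda>\<tau>. complex_of_real (1 / sqrt s) * cnj (\<psi> ((\<tau> - t) / s))"
  note W = wavelet_transform_eq_weighted
  have \<phi>: "integrable lebesgue ?\<phi>" by (rule wavelet_atom[OF \<psi> s])
  then have \<phi>m: "?\<phi> \<in> borel_measurable lebesgue" by simp
  have fm: "(\<lambda>p. f (snd p)) \<in> borel_measurable (M \<Otimes>\<^sub>M lebesgue)"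
    by (rule measurable_compose[OF measurable_snd f(1)])
  have \<phi>m': "(\<lambda>p. ?\<phi> (snd p)) \<in> borel_measurable (M \<Otimes>\<^sub>M lebesgue)"
    by (rule measurable_compose[OF measurable_snd \<phi>m])
  have "(\<lambda>p. (f (snd p) + \<Phi> (snd p) (fst p)) *\<^sub>R ?\<phi> (snd p)) \<in> borel_measurable (M \<Otimes>\<^sub>M lebesgue)"
    by (intro borel_measurable_scaleR borel_measurable_add fm \<phi>m' \<Phi>_pair)
  then show "(\<lambda>\<omega>. wavelet_transform \<psi> (\<lambda>\<tau>. Y \<tau> \<omega>) t s) \<in> borel_measurable M"
    unfolding W Y by (intro L.borel_measurable_lebesgue_integral) (simp add: split_def)
  obtain K where K: "\<And>\<tau>. norm (f \<tau>) \<le> K" using f(2) by (auto simp: bounded_iff)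
  have f\<phi>: "integrable lebesgue (\<lambda>\<tau>. f \<tau> *\<^sub>R ?\<phi> \<tau>)"
  proof (rule Bochner_Integration.integrable_bound)
    show "integrable lebesgue (\<lambda>\<tau>. K *\<^sub>R ?\<phi> \<tau>)" by (rule integrable_scaleR_right) (rule \<phi>)
    show "(\<lambda>\<tau>. f \<tau> *\<^sub>R ?\<phi> \<tau>) \<in> borel_measurable lebesgue"
      by (rule borel_measurable_scaleR[OF f(1) \<phi>m])
    show "AE \<tau> in lebesgue. norm (f \<tau> *\<^sub>R ?\<phi> \<tau>) \<le> norm (K *\<^sub>R ?\<phi> \<tau>)"
      unfolding norm_scaleR using K by (intro AE_I2 mult_right_mono) (auto intro: order_trans[OF _ abs_ge_self])
  qed
  show "AE \<omega> in M. wavelet_transform \<psi> (\<lambda>\<tau>. Y \<tau> \<omega>) t s =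
      wavelet_transform \<psi> (\<lambda>\<tau>. \<Phi> \<tau> \<omega>) t s + wavelet_transform \<psi> f t s"
    using weighted_noise_integrable(2)[OF \<phi>]
  proof eventually_elim
    case (elim \<omega>)
    show ?case unfolding W Y scaleR_add_left
      by (subst Bochner_Integration.integral_add[OF f\<phi> elim]) (rule add.commute)
  qed
qed

lemma wavelet_transform_noise_moments:
  assumes \<psi>: "analytic_mother_wavelet \<psi>" and s: "0 < s"
  shows "integrable M (\<lambda>\<omega>. wavelet_transform \<psi> (\<lambda>\<tau>. \<Phi> \<tau> \<omega>) t s)"
    "expectation (\<lambda>\<omega>. wavelet_transform \<psi> (\<lambda>\<tau>. \<Phi> \<tau> \<omega>) t s) = 0"
proof -
  note A = analytic_weighted_noise[OF wavelet_atom(1)[OF \<psi> s, where t = t] wavelet_atom(2)[OF \<psi> s, where t = t]]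
  show "integrable M (\<lambda>\<omega>. wavelet_transform \<psi> (\<lambda>\<tau>. \<Phi> \<tau> \<omega>) t s)"
    unfolding wavelet_transform_eq_weighted by (rule A(3))
  show "expectation (\<lambda>\<omega>. wavelet_transform \<psi> (\<lambda>\<tau>. \<Phi> \<tau> \<omega>) t s) = 0"
    unfolding wavelet_transform_eq_weighted by (rule A(4))
qed

text \<open>Almost surely the coefficients of \<open>Y\<close> are those of the noise, which are centred, shifted by those of
\<open>f\<close>. So \<open>\<Gamma>\<close> is the covariance matrix of the noise coefficients, and the density is a translate of
theirs.\<close>

lemma wavelet_vector_pdf:
  fixes f :: "real \<Rightarrow> real" and t s :: "real ^ 'n"
  assumes \<psi>: "analytic_mother_wavelet \<psi>" and s: "\<And>l. 0 < s $ l"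
    and f: "f \<in> borel_measurable lebesgue" "bounded (range f)"
    and Y: "\<And>t \<omega>. Y t \<omega> = f t + \<Phi> t \<omega>"
  defines "WY \<equiv> \<lambda>\<omega>. wavelet_vector \<psi> (\<lambda>\<tau>. Y \<tau> \<omega>) t s"
  defines "Wf \<equiv> wavelet_vector \<psi> f t s"
  defines "\<Gamma> \<equiv> covariance_matrix M WY"
  assumes inv: "invertible \<Gamma>"
  shows "pos_definite \<Gamma>"
    "\<exists>p. (\<forall>w. complex_of_real (p w) = complex_normal_density Wf \<Gamma> w) \<and>
         has_pdf M WY p \<and> continuous_on UNIV p \<and>
         has_pdf M (\<lambda>\<omega>. modulus_vector (WY \<omega>)) (modulus_density p)"
proof -
  define h where "h l = (\<lambda>\<tau>. complex_of_real (1 / sqrt (s $ l)) * cnj (\<psi> ((\<tau> - t $ l) / s $ l)))" for l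
  have h1: "integrable lebesgue (h l)" for l
    unfolding h_def by (rule wavelet_atom[OF \<psi> s])
  have h2: "(LINT \<tau>|lebesgue. h i \<tau> * iexp (\<tau> * l)) = 0" if "l \<le> 0" for i l
    unfolding h_def by (rule wavelet_atom(2)[OF \<psi> s that])
  define D where "D \<omega> = (\<chi> i. LINT \<tau>|lebesgue. \<Phi> \<tau> \<omega> *\<^sub>R h i \<tau>)" for \<omega>
  have D': "D \<omega> = wavelet_vector \<psi> (\<lambda>\<tau>. \<Phi> \<tau> \<omega>) t s" for \<omega>
    unfolding D_def wavelet_vector_def h_def wavelet_transform_eq_weighted ..
  define G where "G = (\<chi> i j. CLINT \<omega>|M. D \<omega> $ i * cnj (D \<omega> $ j))"
  note V = analytic_weights_char[of h, OF h1 h2, folded D_def, folded G_def]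
  have Dm[measurable]: "D \<in> borel_measurable M" by (rule V(1))
  have Di: "integrable M (\<lambda>\<omega>. D \<omega> $ i)" for i by (rule V(2))
  have D0: "expectation (\<lambda>\<omega>. D \<omega> $ i) = 0" for i by (rule V(3))
  have Dchar: "(CLINT \<omega>|M. iexp (a \<bullet> D \<omega>)) = complex_of_real (exp (- Re (hermitian_form G a) / 4))" for a by (rule V(4))
  have Gh: "conj_transpose G = G" by (rule V(5))
  have Gp: "0 \<le> Re (hermitian_form G a)" for a by (rule V(6))
  have WYm[measurable]: "WY \<in> borel_measurable M"
    unfolding WY_def wavelet_vector_def
    by (intro measurable_vec_lambda wavelet_transform_signal_plus_noise(1)[OF \<psi> s f Y])
  have "AE \<omega> in M. \<forall>l. WY \<omega> $ l = D \<omega> $ l + Wf $ l"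
    unfolding WY_def D' Wf_def wavelet_vector_def vec_lambda_beta
    using wavelet_transform_signal_plus_noise(2)[OF \<psi> s f Y]
    by (simp add: AE_finite_all[of UNIV, simplified])
  then have AE: "AE \<omega> in M. WY \<omega> = D \<omega> + Wf"
    by eventually_elim (simp add: vec_eq_iff)
  have EW: "expectation (\<lambda>\<omega>. WY \<omega> $ i) = Wf $ i" for i
  proof -
    have "expectation (\<lambda>\<omega>. WY \<omega> $ i) = expectation (\<lambda>\<omega>. D \<omega> $ i + Wf $ i)"
      using AE by (intro integral_cong_AE) auto
    then show ?thesis using Di[of i] D0[of i] by (simp add: prob_space)
  qed
  have \<Gamma>G: "\<Gamma> = G"
  proof -
    have "(CLINT \<omega>|M. (WY \<omega> $ i - Wf $ i) * cnj (WY \<omega> $ j - Wf $ j)) = (CLINT \<omega>|M. D \<omega> $ i * cnj (D \<omega> $ j))" for i j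
      using AE by (intro integral_cong_AE borel_measurable_times cnj_measurable) auto
    then show ?thesis by (simp add: \<Gamma>_def covariance_matrix_def EW G_def)
  qed
  show pd: "pos_definite \<Gamma>"
    using Gh Gp inv unfolding \<Gamma>G by (intro pos_definite_of_psd)
  obtain p where p: "\<And>w. complex_of_real (p w) = complex_normal_density 0 \<Gamma> w"
    "has_pdf M D p" "continuous_on UNIV p"
    using complex_normal_of_char[OF Dm pd inv] Dchar unfolding \<Gamma>G by blast
  have pm: "p \<in> borel_measurable borel" by (rule borel_measurable_continuous_onI[OF p(3)])
  let ?p = "\<lambda>w. p (w - Wf)"
  have 1: "complex_of_real (?p w) = complex_normal_density Wf \<Gamma> w" for w
    unfolding p(1) by (simp add: complex_normal_density_def)
  have 2: "has_pdf M WY ?p"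
    by (rule has_pdf_cong_AE[OF has_pdf_shift[OF p(2) pm] WYm AE])
  have 3: "continuous_on UNIV ?p"
    by (rule continuous_on_compose2[OF p(3)]) (auto intro!: continuous_intros)
  show "\<exists>p. (\<forall>w. complex_of_real (p w) = complex_normal_density Wf \<Gamma> w) \<and>
         has_pdf M WY p \<and> continuous_on UNIV p \<and>
         has_pdf M (\<lambda>\<omega>. modulus_vector (WY \<omega>)) (modulus_density p)"
    using 1 2 3 has_pdf_modulus_vector[OF 2 3] by (intro exI[of _ ?p]) blast
qed

end

section \<open>Real vectors of dimension one and two\<close>

lemma lborel_vec1: "(lborel :: real measure) = distr (lborel :: (real^1) measure) borel (\<lambda>x. x $ 1)"
proof (rule lborel_eqI)
  fix l u :: real assume le: "\<And>b. b \<in> Basis \<Longrightarrow> l \<bullet> b \<le> u \<bullet> b"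
  have "emeasure (distr (lborel :: (real^1) measure) borel (\<lambda>x. x $ 1)) (box l u) =
      emeasure (lborel :: (real^1) measure) (box (\<chi> i. l) (\<chi> i. u))"
    by (subst emeasure_distr) (auto simp: box_def Basis_vec_def inner_axis intro!: arg_cong[where f = "emeasure lborel"])
  also have "\<dots> = (\<Prod>b\<in>Basis. (u - l) \<bullet> b)"
    using le by (subst emeasure_lborel_box) (auto simp: prod_Basis_vec Basis_vec_def inner_axis)
  finally show "emeasure (distr (lborel :: (real^1) measure) borel (\<lambda>x. x $ 1)) (box l u) = (\<Prod>b\<in>Basis. (u - l) \<bullet> b)" .
qed simp

lemma set_integral_vec1:
  fixes G :: "real \<Rightarrow> real"
  assumes [measurable]: "G \<in> borel_measurable borel"
  shows "(LBINT \<theta>:cbox 0 (\<chi> l::1. 2 * pi). G (\<theta> $ 1)) = (LBINT \<theta>:{0..2*pi}. G \<theta>)"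
proof -
  have "(LBINT \<theta>:{0..2*pi}. G \<theta>) = (LINT \<theta>|distr (lborel :: (real^1) measure) borel (\<lambda>x. x $ 1). indicator {0..2*pi} \<theta> *\<^sub>R G \<theta>)"
    unfolding set_lebesgue_integral_def by (simp flip: lborel_vec1)
  also have "\<dots> = (LINT \<theta>|(lborel :: (real^1) measure). indicator {0..2*pi} (\<theta> $ 1) *\<^sub>R G (\<theta> $ 1))"
    by (rule integral_distr) measurable
  also have "\<dots> = (LBINT \<theta>:cbox 0 (\<chi> l::1. 2 * pi). G (\<theta> $ 1))"
    unfolding set_lebesgue_integral_def
    by (intro Bochner_Integration.integral_cong refl) (auto simp: cbox_def Basis_vec_def inner_axis indicator_def)
  finally show ?thesis ..
qed

lemma has_pdf_vec1:
  fixes X :: "'w \<Rightarrow> real ^ 1"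
  assumes "has_pdf M X (\<lambda>r. q (r $ 1))"
  shows "has_pdf M (\<lambda>\<omega>. X \<omega> $ 1) q"
proof -
  have D: "distributed M lborel X (\<lambda>r. ennreal (q (r $ 1)))" and q0: "0 \<le> q (r $ 1)" for r :: "real^1"
    using assms by (auto simp: has_pdf_def)
  have q0: "0 \<le> q x" for x using q0[of "\<chi> i. x"] by simp
  have [measurable]: "X \<in> borel_measurable M" using distributed_measurable[OF D] by simp
  have m: "(\<lambda>r :: real^1. ennreal (q (r $ 1))) \<in> borel_measurable borel"
    using distributed_borel_measurable[OF D] by simp
  have "(\<lambda>x. ennreal (q ((\<chi> i::1. x) $ 1))) \<in> borel_measurable borel"
    by (rule measurable_compose[OF _ m]) measurable
  then have qm[measurable]: "(\<lambda>x. ennreal (q x)) \<in> borel_measurable borel" by simp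
  have "distr M lborel (\<lambda>\<omega>. X \<omega> $ 1) = distr (distr M lborel X) borel (\<lambda>r. r $ 1)"
    by (subst distr_distr) (auto simp: comp_def cong: distr_cong)
  also have "\<dots> = distr (density lborel (\<lambda>r :: real^1. ennreal (q (r $ 1)))) borel (\<lambda>r. r $ 1)"
    by (simp only: distributed_distr_eq_density[OF D])
  also have "\<dots> = density (distr (lborel :: (real^1) measure) borel (\<lambda>r. r $ 1)) (\<lambda>x. ennreal (q x))"
    by (rule density_distr[symmetric]) auto
  finally show ?thesis
    using q0 qm unfolding has_pdf_def distributed_def by (simp flip: lborel_vec1)
qed

text \<open>The two coordinates are separated so that the integral over the two angles can be iterated.\<close>

lemma lborel_vec2: "(lborel :: (real^2) measure) = distr (lborel \<Otimes>\<^sub>M lborel) borel (\<lambda>(x, y). \<chi> i. if i = 1 then x else y)"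
proof (rule lborel_eqI)
  have [measurable]: "(\<lambda>(x, y). \<chi> i::2. if i = 1 then x else y) \<in> borel_measurable (lborel \<Otimes>\<^sub>M (lborel :: real measure))"
    unfolding split_def by measurable
  fix l u :: "real^2" assume le: "\<And>b. b \<in> Basis \<Longrightarrow> l \<bullet> b \<le> u \<bullet> b"
  have le': "l $ i \<le> u $ i" for i using le[of "axis i 1"] by (simp add: inner_axis)
  have "emeasure (distr (lborel \<Otimes>\<^sub>M lborel) borel (\<lambda>(x, y). \<chi> i::2. if i = 1 then x else y)) (box l u) =
      emeasure (lborel \<Otimes>\<^sub>M lborel) ({l $ 1 <..< u $ 1} \<times> {l $ 2 <..< u $ 2})"
    by (subst emeasure_distr)
       (auto simp: box_def Basis_vec_def inner_axis forall_2 space_pair_measure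
         intro!: arg_cong[where f = "emeasure (lborel \<Otimes>\<^sub>M lborel)"])
  also have "\<dots> = ennreal ((u $ 1 - l $ 1) * (u $ 2 - l $ 2))"
    using le' by (subst lborel.emeasure_pair_measure_Times) (simp_all add: ennreal_mult)
  also have "\<dots> = (\<Prod>b\<in>Basis. (u - l) \<bullet> b)"
    by (simp add: prod_Basis_vec inner_axis UNIV_2)
  finally show "emeasure (distr (lborel \<Otimes>\<^sub>M lborel) borel (\<lambda>(x, y). \<chi> i::2. if i = 1 then x else y)) (box l u)
      = (\<Prod>b\<in>Basis. (u - l) \<bullet> b)" .
qed simp

lemma set_integral_vec2:
  fixes G :: "real \<Rightarrow> real \<Rightarrow> real"
  assumes G: "continuous_on UNIV (\<lambda>p. G (fst p) (snd p))"
  shows "(LBINT \<theta>:cbox 0 (\<chi> l::2. 2 * pi). G (\<theta> $ 1) (\<theta> $ 2)) = (LBINT x:{0..2*pi}. LBINT y:{0..2*pi}. G x y)"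
proof -
  let ?I = "{0..2*pi}" and ?T = "\<lambda>(x :: real, y :: real). \<chi> i::2. if i = 1 then x else y"
  have Gm: "(\<lambda>p. G (fst p) (snd p)) \<in> borel_measurable borel" by (rule borel_measurable_continuous_onI[OF G])
  have T: "?T \<in> borel_measurable (lborel \<Otimes>\<^sub>M lborel)" unfolding split_def by measurable
  have G2: "(\<lambda>\<theta>. G (\<theta> $ 1) (\<theta> $ 2)) \<in> borel_measurable (borel :: (real^2) measure)"
    using measurable_compose[OF _ Gm, of "\<lambda>\<theta>. (\<theta> $ 1, \<theta> $ 2)" "borel :: (real^2) measure"] by simp
  have ind: "indicator (cbox 0 (\<chi> l::2. 2 * pi)) (?T p) = (indicator (?I \<times> ?I) p :: real)" for p
    by (auto simp: cbox_def Basis_vec_def inner_axis forall_2 indicator_def split: prod.splits)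
  have int: "integrable (lborel \<Otimes>\<^sub>M lborel) (\<lambda>p. indicator (?I \<times> ?I) p *\<^sub>R G (fst p) (snd p))"
    unfolding lborel_prod
    by (rule borel_integrable_compact) (auto intro!: compact_Times continuous_on_subset[OF G])
  have "(LBINT \<theta>:cbox 0 (\<chi> l::2. 2 * pi). G (\<theta> $ 1) (\<theta> $ 2)) =
      (LINT p|(lborel \<Otimes>\<^sub>M lborel). indicator (?I \<times> ?I) p *\<^sub>R G (fst p) (snd p))"
    unfolding set_lebesgue_integral_def
    by (subst lborel_vec2, subst integral_distr[OF T])
       (use G2 in \<open>auto simp: ind simp del: split_paired_All intro!: Bochner_Integration.integral_cong\<close>)
  also have "\<dots> = (LINT x|lborel. LINT y|lborel. indicator (?I \<times> ?I) (x, y) *\<^sub>R G x y)"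
    using lborel_pair.integral_fst'[OF int] by simp
  also have "\<dots> = (LBINT x:?I. LBINT y:?I. G x y)"
    unfolding set_lebesgue_integral_def
    by (simp add: indicator_times mult.assoc)
  finally show ?thesis .
qed

section \<open>Moduli of one and of two wavelet coefficients\<close>

lemma hermitian_form_matrix_inv_1:
  fixes A :: "complex^1^1"
  assumes "A $ 1 $ 1 = complex_of_real a" "a \<noteq> 0"
  shows "(\<Sum>i\<in>UNIV. cnj (d $ i) * (matrix_inv A *v d) $ i) = complex_of_real ((cmod (d $ 1))\<^sup>2 / a)"
proof -
  have "matrix_inv A = (\<chi> i j. 1 / complex_of_real a)"
    using assms by (intro matrix_inv_eqI) (simp add: matrix_matrix_mult_def mat_def vec_eq_iff)
  then show ?thesis
    by (simp add: matrix_vector_mult_def complex_norm_square mult.commute del: of_real_power)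
qed

text \<open>Completing the square in the second component of \<open>d\<close>. Here \<open>S\<close> is the Schur complement of \<open>a\<close>; for a
covariance matrix it is the variance of the second component given the first.\<close>

lemma hermitian_form_matrix_inv_2:
  fixes A :: "complex^2^2"
  assumes A: "A $ 1 $ 1 = complex_of_real a" "A $ 2 $ 2 = complex_of_real b" "A $ 2 $ 1 = cnj (A $ 1 $ 2)"
    and a: "a \<noteq> 0" and S: "S = b - (cmod (A $ 1 $ 2))\<^sup>2 / a" "S \<noteq> 0"
  shows "(\<Sum>i\<in>UNIV. cnj (d $ i) * (matrix_inv A *v d) $ i) =
    complex_of_real ((cmod (d $ 1))\<^sup>2 / a + (cmod (d $ 2 - cnj (A $ 1 $ 2) / complex_of_real a * d $ 1))\<^sup>2 / S)"
proof -
  define c where "c = A $ 1 $ 2"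
  define \<Delta> where "\<Delta> = complex_of_real (a * S)"
  have \<Delta>0: "\<Delta> \<noteq> 0" using a S(2) by (simp add: \<Delta>_def)
  have \<Delta>: "\<Delta> = complex_of_real a * complex_of_real b - c * cnj c"
    using a unfolding \<Delta>_def S(1) complex_norm_square[symmetric] c_def[symmetric] of_real_mult[symmetric] of_real_diff[symmetric]
    by (simp add: right_diff_distrib)
  have ab: "complex_of_real a * complex_of_real b = \<Delta> + c * cnj c" by (simp add: \<Delta>)
  define K :: "complex^2^2" where "K = (\<chi> i j. (if i = j then (if i = 1 then complex_of_real b else complex_of_real a)
      else (if i = 1 then - c else - cnj c)) / \<Delta>)"
  have "matrix_inv A = K"
  proof (rule matrix_inv_eqI)
    show "A ** K = mat 1"
      using \<Delta>0 by (simp add: vec_eq_iff forall_2 matrix_matrix_mult_def sum_2 mat_def K_def A c_def[symmetric])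
        (simp add: field_simps ab)
  qed
  then have "(\<Sum>i\<in>UNIV. cnj (d $ i) * (matrix_inv A *v d) $ i) =
      (cnj (d $ 1) * (complex_of_real b * d $ 1 - c * d $ 2) + cnj (d $ 2) * (complex_of_real a * d $ 2 - cnj c * d $ 1)) / \<Delta>"
    by (simp add: sum_2 matrix_vector_mult_def K_def field_simps add_divide_distrib diff_divide_distrib)
  also have "\<dots> = complex_of_real ((cmod (d $ 1))\<^sup>2 / a + (cmod (d $ 2 - cnj c / complex_of_real a * d $ 1))\<^sup>2 / S)"
  proof -
    have Sc: "complex_of_real S = \<Delta> / complex_of_real a" using a by (simp add: \<Delta>_def)
    have alg: "(x' * (B * x - c * y) + y' * (Aa * y - c' * x)) / D = x * x' / Aa + (y - c' / Aa * x) * (y' - c / Aa * x') / (D / Aa)"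
      if "Aa \<noteq> 0" "D \<noteq> 0" "D = Aa * B - c * c'" for x x' y y' B c c' Aa D :: complex
    proof -
      have "Aa * B = D + c * c'" using that(3) by simp
      then have e1: "Aa * (x' * (B * x - c * y) + y' * (Aa * y - c' * x)) = x * x' * D + (Aa * y - c' * x) * (Aa * y' - c * x')"
        by algebra
      have e2: "x * x' / Aa + (y - c' / Aa * x) * (y' - c / Aa * x') / (D / Aa) = (x * x' * D + (Aa * y - c' * x) * (Aa * y' - c * x')) / (Aa * D)"
        using that(1,2) by (simp add: field_simps)
      show ?thesis unfolding e2 e1[symmetric] using that(1,2) by simp
    qed
    have "complex_of_real ((cmod (d $ 1))\<^sup>2 / a + (cmod (d $ 2 - cnj c / complex_of_real a * d $ 1))\<^sup>2 / S) =
        d $ 1 * cnj (d $ 1) / complex_of_real a +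
        (d $ 2 - cnj c / complex_of_real a * d $ 1) * (cnj (d $ 2) - c / complex_of_real a * cnj (d $ 1)) / (\<Delta> / complex_of_real a)"
      unfolding of_real_add of_real_divide complex_norm_square Sc by simp
    then show ?thesis
      using alg[OF _ \<Delta>0 \<Delta>] a by simp
  qed
  finally show ?thesis by (simp add: c_def)
qed


text \<open>The coefficient is regarded as a vector with a single entry; the density of its modulus is then an
integral over one angle.\<close>

lemma (in stationary_gaussian_noise) wavelet_modulus_rice:
  fixes f :: "real \<Rightarrow> real" and t s :: real
  assumes \<psi>: "analytic_mother_wavelet \<psi>" and s: "0 < s"
    and f: "f \<in> borel_measurable lebesgue" "bounded (range f)"
    and Y: "\<And>t \<omega>. Y t \<omega> = f t + \<Phi> t \<omega>"
  defines "W \<equiv> \<lambda>\<omega>. wavelet_transform \<psi> (\<lambda>\<tau>. \<Phi> \<tau> \<omega>) t s"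
  assumes pos: "0 < expectation (\<lambda>\<omega>. (cmod (W \<omega> - expectation W))\<^sup>2)"
  shows "has_pdf M (\<lambda>\<omega>. cmod (wavelet_transform \<psi> (\<lambda>\<tau>. Y \<tau> \<omega>) t s))
    (\<lambda>r. if 0 \<le> r
      then rice_density r (cmod (wavelet_transform \<psi> f t s)) (1 / 2 * expectation (\<lambda>\<omega>. (cmod (W \<omega>))\<^sup>2))
      else 0)"
proof -
  let ?t = "\<chi> l::1. t" and ?s = "\<chi> l::1. s"
  define WY where "WY \<omega> = wavelet_vector \<psi> (\<lambda>\<tau>. Y \<tau> \<omega>) ?t ?s" for \<omega>
  define Wf where "Wf = wavelet_vector \<psi> f ?t ?s"
  define \<Gamma> where "\<Gamma> = covariance_matrix M WY"
  define c where "c = wavelet_transform \<psi> f t s"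
  have Wf1: "Wf $ 1 = c" by (simp add: Wf_def c_def wavelet_vector_def)
  have W: "integrable M W" "expectation W = 0"
    unfolding W_def by (rule wavelet_transform_noise_moments[OF \<psi> s])+
  have Wm[measurable]: "W \<in> borel_measurable M" using W(1) by simp
  have WY1: "WY \<omega> $ 1 = wavelet_transform \<psi> (\<lambda>\<tau>. Y \<tau> \<omega>) t s" for \<omega>
    by (simp add: WY_def wavelet_vector_def)
  have WY1m[measurable]: "(\<lambda>\<omega>. WY \<omega> $ 1) \<in> borel_measurable M"
    unfolding WY1 by (rule wavelet_transform_signal_plus_noise(1)[OF \<psi> s f Y])
  have AE: "AE \<omega> in M. WY \<omega> $ 1 = W \<omega> + c"
    unfolding WY1 W_def c_def by (rule wavelet_transform_signal_plus_noise(2)[OF \<psi> s f Y])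
  have "expectation (\<lambda>\<omega>. WY \<omega> $ 1) = expectation (\<lambda>\<omega>. W \<omega> + c)"
    using AE by (intro integral_cong_AE) auto
  then have EWY: "expectation (\<lambda>\<omega>. WY \<omega> $ 1) = c" using W by (simp add: prob_space)
  define v where "v = expectation (\<lambda>\<omega>. (cmod (W \<omega>))\<^sup>2)"
  have v: "v > 0" using pos by (simp add: v_def W(2))
  have \<Gamma>11: "\<Gamma> $ 1 $ 1 = complex_of_real v"
  proof -
    have "\<Gamma> $ 1 $ 1 = (CLINT \<omega>|M. (WY \<omega> $ 1 - c) * cnj (WY \<omega> $ 1 - c))"
      by (simp add: \<Gamma>_def covariance_matrix_def EWY)
    also have "\<dots> = (CLINT \<omega>|M. complex_of_real ((cmod (W \<omega>))\<^sup>2))"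
    proof (rule integral_cong_AE)
      show "(\<lambda>\<omega>. (WY \<omega> $ 1 - c) * cnj (WY \<omega> $ 1 - c)) \<in> borel_measurable M"
        by (intro borel_measurable_times cnj_measurable) auto
      show "AE \<omega> in M. (WY \<omega> $ 1 - c) * cnj (WY \<omega> $ 1 - c) = complex_of_real ((cmod (W \<omega>))\<^sup>2)"
        using AE by eventually_elim (simp add: complex_norm_square del: of_real_power)
    qed measurable
    also have "\<dots> = complex_of_real v" unfolding v_def by (rule integral_complex_of_real)
    finally show ?thesis .
  qed
  have inv: "invertible \<Gamma>" using v by (simp add: invertible_det_nz det_1 \<Gamma>11)
  obtain p where p: "\<And>w. complex_of_real (p w) = complex_normal_density Wf \<Gamma> w"
    and pdf: "has_pdf M (\<lambda>\<omega>. modulus_vector (WY \<omega>)) (modulus_density p)"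
    using wavelet_vector_pdf(2)[OF \<psi> _ f Y, of ?s ?t] s inv
    unfolding WY_def Wf_def \<Gamma>_def by auto
  have p': "p w = 1 / (pi * v) * exp (- ((cmod (w $ 1 - c))\<^sup>2 / v))" for w
  proof -
    have "complex_of_real (p w) = complex_of_real (1 / (pi * v) * exp (- ((cmod (w $ 1 - c))\<^sup>2 / v)))"
      unfolding p complex_normal_density_def hermitian_form_matrix_inv_1[OF \<Gamma>11 less_imp_neq[OF v, symmetric]]
      by (simp add: det_1 \<Gamma>11 Wf1 flip: exp_of_real)
    then show ?thesis unfolding of_real_eq_iff .
  qed
  let ?q = "\<lambda>r. if 0 \<le> r then rice_density r (cmod c) (1 / 2 * v) else 0"
  have "modulus_density p = (\<lambda>r. ?q (r $ 1))"
  proof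
    fix r :: "real^1"
    have "(LBINT \<theta>:cbox 0 (\<chi> l. 2 * pi). p (\<chi> l. rcis (r $ l) (\<theta> $ l))) =
        (LBINT \<theta>:{0..2*pi}. 1 / (pi * v) * exp (- ((cmod (rcis (r $ 1) \<theta> - c))\<^sup>2 / v)))"
      unfolding p' vec_lambda_beta by (rule set_integral_vec1) measurable
    then have "r $ 1 * (LBINT \<theta>:cbox 0 (\<chi> l. 2 * pi). p (\<chi> l. rcis (r $ l) (\<theta> $ l))) = rice_density (r $ 1) (cmod c) (1 / 2 * v)"
      unfolding rice_density_eq_angular_integral[OF v, symmetric] by simp
    then show "modulus_density p r = ?q (r $ 1)"
      by (simp add: modulus_density_def forall_1)
  qed
  with pdf have "has_pdf M (\<lambda>\<omega>. modulus_vector (WY \<omega>)) (\<lambda>r. ?q (r $ 1))" by simp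
  from has_pdf_vec1[OF this] show ?thesis
    by (simp only: modulus_vector_def vec_lambda_beta WY1 c_def v_def)
qed

text \<open>After completing the square, the integral over the angle of the second coefficient is taken with the
first coefficient fixed, and it is a Rice density whose noncentrality is the modulus of the conditional
mean \<open>m\<close> of the second coefficient.\<close>

lemma (in stationary_gaussian_noise) wavelet_modulus_pair_pdf:
  fixes f :: "real \<Rightarrow> real" and t s :: "real^2"
  assumes \<psi>: "analytic_mother_wavelet \<psi>" and s: "\<And>l. 0 < s $ l"
    and f: "f \<in> borel_measurable lebesgue" "bounded (range f)"
    and Y: "\<And>t \<omega>. Y t \<omega> = f t + \<Phi> t \<omega>"
  defines "WY \<equiv> \<lambda>\<omega>. wavelet_vector \<psi> (\<lambda>\<tau>. Y \<tau> \<omega>) t s"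
  defines "Wf \<equiv> wavelet_vector \<psi> f t s"
  defines "\<Gamma> \<equiv> covariance_matrix M WY"
  assumes inv: "invertible \<Gamma>"
  shows "\<exists>\<Gamma>11 \<Gamma>22. complex_of_real \<Gamma>11 = \<Gamma> $ 1 $ 1 \<and> complex_of_real \<Gamma>22 = \<Gamma> $ 2 $ 2 \<and>
     has_pdf M (\<lambda>\<omega>. modulus_vector (WY \<omega>))
       (\<lambda>r. if 0 \<le> r $ 1 \<and> 0 \<le> r $ 2
            then r $ 1 / (pi * \<Gamma>11) *
                 (LBINT \<theta>:{0..2 * pi}.
                    rice_density (r $ 2)
                      (cmod (cnj (\<Gamma> $ 1 $ 2) / complex_of_real \<Gamma>11 *
                               (rcis (r $ 1) \<theta> - Wf $ 1) + Wf $ 2))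
                      (1 / 2 * (\<Gamma>22 - (cmod (\<Gamma> $ 1 $ 2))\<^sup>2 / \<Gamma>11)) *
                    exp (- ((cmod (rcis (r $ 1) \<theta> - Wf $ 1))\<^sup>2 / \<Gamma>11)))
            else 0)"
proof -
  note P = wavelet_vector_pdf[OF \<psi> s f Y inv[unfolded \<Gamma>_def WY_def]]
  have pd: "pos_definite \<Gamma>" unfolding \<Gamma>_def WY_def by (rule P(1))
  obtain p where p: "\<And>w. complex_of_real (p w) = complex_normal_density Wf \<Gamma> w"
    and pdf: "has_pdf M (\<lambda>\<omega>. modulus_vector (WY \<omega>)) (modulus_density p)"
    using P(2) unfolding \<Gamma>_def WY_def Wf_def by blast
  have herm: "\<Gamma> $ i $ j = cnj (\<Gamma> $ j $ i)" for i j
    by (rule pos_definite_cnj[OF pd])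
  define a where "a = Re (\<Gamma> $ 1 $ 1)"
  define b where "b = Re (\<Gamma> $ 2 $ 2)"
  define S where "S = b - (cmod (\<Gamma> $ 1 $ 2))\<^sup>2 / a"
  have ab: "\<Gamma> $ 1 $ 1 = complex_of_real a" "\<Gamma> $ 2 $ 2 = complex_of_real b" and a: "a > 0"
    unfolding a_def b_def by (rule pos_definite_diagonal[OF pd])+
  have det: "det \<Gamma> = complex_of_real (a * S)"
  proof -
    have "det \<Gamma> = complex_of_real a * complex_of_real b - \<Gamma> $ 1 $ 2 * cnj (\<Gamma> $ 1 $ 2)"
      by (simp add: det_2 ab herm[of 2 1])
    also have "\<dots> = complex_of_real (a * b - (cmod (\<Gamma> $ 1 $ 2))\<^sup>2)"
      by (simp add: complex_norm_square[symmetric] del: of_real_power) 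
    also have "a * b - (cmod (\<Gamma> $ 1 $ 2))\<^sup>2 = a * S" using a by (simp add: S_def right_diff_distrib)
    finally show ?thesis .
  qed
  obtain d where "d > 0" "det \<Gamma> = complex_of_real d" by (rule pos_definite_det[OF pd])
  then have "a * S > 0" unfolding det of_real_eq_iff by simp
  then have S: "S > 0" using a by (simp add: zero_less_mult_iff)
  define m where "m r1 \<theta> = cnj (\<Gamma> $ 1 $ 2) / complex_of_real a * (rcis r1 \<theta> - Wf $ 1) + Wf $ 2" for r1 \<theta>
  let ?k = "cnj (\<Gamma> $ 1 $ 2) / complex_of_real a"
  have p': "p w = 1 / (pi * a) * exp (- ((cmod (w $ 1 - Wf $ 1))\<^sup>2 / a)) *
      (1 / (pi * S) * exp (- ((cmod (w $ 2 - (?k * (w $ 1 - Wf $ 1) + Wf $ 2)))\<^sup>2 / S)))" for w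
  proof -
    let ?x = "(cmod (w $ 1 - Wf $ 1))\<^sup>2 / a" and ?y = "(cmod (w $ 2 - (?k * (w $ 1 - Wf $ 1) + Wf $ 2)))\<^sup>2 / S"
    have e: "w $ 2 - Wf $ 2 - z = w $ 2 - (z + Wf $ 2)" for z by simp
    have "complex_of_real (p w) = complex_of_real (1 / (pi\<^sup>2 * (a * S)) * exp (- (?x + ?y)))"
      unfolding p complex_normal_density_def
        hermitian_form_matrix_inv_2[OF ab herm[of 2 1] less_imp_neq[OF a, symmetric] S_def less_imp_neq[OF S, symmetric]]
      unfolding vector_minus_component e det
      by (simp flip: exp_of_real)
    then have "p w = 1 / (pi\<^sup>2 * (a * S)) * exp (- (?x + ?y))"
      unfolding of_real_eq_iff .
    also have "\<dots> = 1 / (pi * a) * exp (- ?x) * (1 / (pi * S) * exp (- ?y))"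
      unfolding minus_add_distrib exp_add by (simp add: power2_eq_square)
    finally show ?thesis .
  qed
  have "modulus_density p =
      (\<lambda>r. if 0 \<le> r $ 1 \<and> 0 \<le> r $ 2
            then r $ 1 / (pi * a) *
                 (LBINT \<theta>:{0..2 * pi}. rice_density (r $ 2) (cmod (m (r $ 1) \<theta>)) (1 / 2 * S) *
                    exp (- ((cmod (rcis (r $ 1) \<theta> - Wf $ 1))\<^sup>2 / a)))
            else 0)"
  proof
    fix r :: "real^2"
    let ?E = "\<lambda>x. exp (- ((cmod (rcis (r $ 1) x - Wf $ 1))\<^sup>2 / a))"
    let ?H = "\<lambda>x y. exp (- ((cmod (rcis (r $ 2) y - m (r $ 1) x))\<^sup>2 / S))"
    have "(LBINT \<theta>:cbox 0 (\<chi> l. 2 * pi). p (\<chi> l. rcis (r $ l) (\<theta> $ l))) =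
        (LBINT \<theta>:cbox 0 (\<chi> l::2. 2 * pi). 1 / (pi * a) * ?E (\<theta> $ 1) * (1 / (pi * S) * ?H (\<theta> $ 1) (\<theta> $ 2)))"
      by (simp only: p' vec_lambda_beta m_def)
    also have "\<dots> = (LBINT x:{0..2*pi}. LBINT y:{0..2*pi}. 1 / (pi * a) * ?E x * (1 / (pi * S) * ?H x y))"
      by (rule set_integral_vec2)
         (use a S in \<open>auto intro!: continuous_intros simp: m_def rcis_def cis_conv_exp\<close>)
    also have "\<dots> = (LBINT x:{0..2*pi}. 1 / (pi * a) * ?E x * (1 / (pi * S) * (LBINT y:{0..2*pi}. ?H x y)))"
      by (simp only: set_integral_mult_right)
    finally have "r $ 1 * r $ 2 * (LBINT \<theta>:cbox 0 (\<chi> l. 2 * pi). p (\<chi> l. rcis (r $ l) (\<theta> $ l))) =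
        (LBINT x:{0..2*pi}. r $ 1 * r $ 2 * (1 / (pi * a) * ?E x * (1 / (pi * S) * (LBINT y:{0..2*pi}. ?H x y))))"
      by (simp only: set_integral_mult_right)
    also have "\<dots> = (LBINT x:{0..2*pi}. r $ 1 / (pi * a) * (rice_density (r $ 2) (cmod (m (r $ 1) x)) (1 / 2 * S) * ?E x))"
      unfolding rice_density_eq_angular_integral[OF S, symmetric]
      by (simp add: mult_ac)
    also have "\<dots> = r $ 1 / (pi * a) * (LBINT x:{0..2*pi}. rice_density (r $ 2) (cmod (m (r $ 1) x)) (1 / 2 * S) * ?E x)"
      by (rule set_integral_mult_right)
    finally have "r $ 1 * r $ 2 * (LBINT \<theta>:cbox 0 (\<chi> l. 2 * pi). p (\<chi> l. rcis (r $ l) (\<theta> $ l))) =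
      r $ 1 / (pi * a) * (LBINT x:{0..2*pi}. rice_density (r $ 2) (cmod (m (r $ 1) x)) (1 / 2 * S) * ?E x)" .
    then show "modulus_density p r =
      (if 0 \<le> r $ 1 \<and> 0 \<le> r $ 2
            then r $ 1 / (pi * a) *
                 (LBINT \<theta>:{0..2 * pi}. rice_density (r $ 2) (cmod (m (r $ 1) \<theta>)) (1 / 2 * S) *
                    exp (- ((cmod (rcis (r $ 1) \<theta> - Wf $ 1))\<^sup>2 / a)))
            else 0)"
      unfolding modulus_density_def forall_2 by (simp add: UNIV_2)
  qed
  with pdf show ?thesis
    unfolding m_def S_def by (intro exI[of _ a] exI[of _ b] conjI) (simp_all only: ab)
qed

theorem proposition1:
  fixes \<psi> :: "real \<Rightarrow> complex" and f :: "real \<Rightarrow> real"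
    and M :: "'w measure" and \<Phi> Y :: "real \<Rightarrow> 'w \<Rightarrow> real"
    and C :: "real \<Rightarrow> real" and F :: "real measure"
  assumes "analytic_mother_wavelet \<psi>"
    and "f \<in> borel_measurable lebesgue" and "bounded (range f)"
    and "prob_space M"
    and "stationary_gaussian_process M \<Phi> C"
    and "spectral_measure C F"
    and "\<And>t \<omega>. Y t \<omega> = f t + \<Phi> t \<omega>"
  shows
    "(\<forall>t s :: real^'n. (\<forall>l. 0 < s $ l) \<longrightarrow>
        (let WY = (\<lambda>\<omega>. wavelet_vector \<psi> (\<lambda>\<tau>. Y \<tau> \<omega>) t s);
             Wf = wavelet_vector \<psi> f t s;
             \<Gamma> = covariance_matrix M WY
         in invertible \<Gamma> \<longrightarrow>
            (\<exists>p. (\<forall>w. complex_of_real (p w) = complex_normal_density Wf \<Gamma> w) \<and>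
                 has_pdf M WY p \<and>
                 has_pdf M (\<lambda>\<omega>. modulus_vector (WY \<omega>))
                   (\<lambda>r. if \<forall>l. 0 \<le> r $ l
                        then (\<Prod>l\<in>UNIV. r $ l) *
                             (LBINT \<theta>:cbox 0 (\<chi> l. 2 * pi). p (\<chi> l. rcis (r $ l) (\<theta> $ l)))
                        else 0)))) \<and>
     (\<forall>t s :: real. 0 < s \<longrightarrow>
        (let W\<Phi> = (\<lambda>\<omega>. wavelet_transform \<psi> (\<lambda>\<tau>. \<Phi> \<tau> \<omega>) t s)
         in 0 < (LINT \<omega>|M. (cmod (W\<Phi> \<omega> - (LINT \<omega>'|M. W\<Phi> \<omega>')))\<^sup>2) \<longrightarrow>
            has_pdf M (\<lambda>\<omega>. cmod (wavelet_transform \<psi> (\<lambda>\<tau>. Y \<tau> \<omega>) t s))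
              (\<lambda>r. if 0 \<le> r
                   then rice_density r (cmod (wavelet_transform \<psi> f t s))
                          (1 / 2 * (LINT \<omega>|M. (cmod (W\<Phi> \<omega>))\<^sup>2))
                   else 0))) \<and>
     (\<forall>t s :: real^2. (\<forall>l. 0 < s $ l) \<longrightarrow>
        (let WY = (\<lambda>\<omega>. wavelet_vector \<psi> (\<lambda>\<tau>. Y \<tau> \<omega>) t s);
             Wf = wavelet_vector \<psi> f t s;
             \<Gamma> = covariance_matrix M WY
         in invertible \<Gamma> \<longrightarrow>
            (\<exists>\<Gamma>11 \<Gamma>22. complex_of_real \<Gamma>11 = \<Gamma> $ 1 $ 1 \<and> complex_of_real \<Gamma>22 = \<Gamma> $ 2 $ 2 \<and>
               has_pdf M (\<lambda>\<omega>. modulus_vector (WY \<omega>))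
                 (\<lambda>r. if 0 \<le> r $ 1 \<and> 0 \<le> r $ 2
                      then r $ 1 / (pi * \<Gamma>11) *
                           (LBINT \<theta>:{0..2 * pi}.
                              rice_density (r $ 2)
                                (cmod (cnj (\<Gamma> $ 1 $ 2) / complex_of_real \<Gamma>11 *
                                         (rcis (r $ 1) \<theta> - Wf $ 1) + Wf $ 2))
                                (1 / 2 * (\<Gamma>22 - (cmod (\<Gamma> $ 1 $ 2))\<^sup>2 / \<Gamma>11)) *
                              exp (- ((cmod (rcis (r $ 1) \<theta> - Wf $ 1))\<^sup>2 / \<Gamma>11)))
                      else 0))))"
proof -
  interpret stationary_gaussian_noise M \<Phi> C F
    using assms(4,5,6) by (simp add: stationary_gaussian_noise_def stationary_gaussian_noise_axioms_def)
  note setting = assms(2,3,7)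
  show ?thesis
    unfolding Let_def
  proof (intro conjI allI impI, goal_cases)
    case (1 t s)
    then show ?case
      using wavelet_vector_pdf(2)[OF assms(1) _ setting, of s t] by (auto simp: modulus_density_def[abs_def])
  next
    case (2 t s)
    then show ?case by (intro wavelet_modulus_rice[OF assms(1) _ setting])
  next
    case (3 t s)
    then show ?case by (intro wavelet_modulus_pair_pdf[OF assms(1) _ setting]) auto
  qed
qed

end
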